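(* Let $R$ be a finite commutative ring with $1$ and let $\mathfrak{U}\subset R^{\times}$ be a subgroup of the group of units of $R$. Then the category of $\mathrm{VIC}(R,\mathfrak{U})$-modules is locally Noetherian.
   Context: All rings are commutative with $1$. $\mathrm{VIC}(R)$ is the category whose objects are finite-rank free $R$-modules and whose morphisms $V\to W$ are pairs $(f,C)$, where $f:V\to W$ is an $R$-linear injection and $C\subset W$ is a free $R$-submodule with $W=f(V)\oplus C$; composition of $(f,C):V\to W$ and $(g,D):W\to X$ is $(g,D)\circ(f,C)=(g\circ f,\,g(C)\oplus D)$. The category $\mathrm{VIC}(R,\mathfrak{U})$ has objects $R^n$ for $n\ge 0$, and its morphisms $R^n\to R^{n'}$ are the $\mathrm{VIC}(R)$-morphisms $(f,C):R^n\to R^{n'}$ such that $\det(f)\in\mathfrak{U}$ if $n=n'$. For a category $\mathsf{C}$ and a ring $\mathbf{k}$, a $\mathsf{C}$-module over $\mathbf{k}$ is a functor $M$ from $\mathsf{C}$ to $\mathbf{k}$-modules, with value $M_C$ at an object $C$; morphisms are natural transformations, and submodules are defined pointwise. $M$ is finitely generated if there are finitely many objects $C_1,\dots,C_n$ and elements $x_i\in M_{C_i}$ such that the smallest $\mathsf{C}$-submodule of $M$ containing all $x_i$ is $M$. The category of $\mathsf{C}$-modules over $\mathbf{k}$ is locally Noetherian if every submodule of a finitely generated $\mathsf{C}$-module over $\mathbf{k}$ is finitely generated. The category of $\mathsf{C}$-modules is locally Noetherian if this holds over every Noetherian ring $\mathbf{k}$. *)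

theory Defs
  imports "HOL-Algebra.AbelCoset" "HOL-Algebra.Module" "HOL-Algebra.Ring_Divisibility"
    "HOL-Combinatorics.Permutations"
begin

section \<open>Modules over a category\<close>

text \<open>
  Hom-sets are not required to be disjoint, so composition and the action of a functor on
  morphisms take the objects as explicit arguments: \<open>Comp C a b c g f\<close> is the composite of
  \<open>f \<in> Hom C a b\<close> and \<open>g \<in> Hom C b c\<close>.
\<close>

record ('o, 'a) cat =
  Obj :: "'o set"
  Hom :: "'o \<Rightarrow> 'o \<Rightarrow> 'a set"
  Id :: "'o \<Rightarrow> 'a"
  Comp :: "'o \<Rightarrow> 'o \<Rightarrow> 'o \<Rightarrow> 'a \<Rightarrow> 'a \<Rightarrow> 'a"

definition linear_maps ::
  "('r, 'x) ring_scheme \<Rightarrow> ('r, 'v, 'y) module_scheme \<Rightarrow> ('r, 'w, 'z) module_scheme \<Rightarrow> ('v \<Rightarrow> 'w) set"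
  where "linear_maps R V W =
    {f \<in> carrier V \<rightarrow> carrier W.
      (\<forall>x\<in>carrier V. \<forall>y\<in>carrier V. f (x \<oplus>\<^bsub>V\<^esub> y) = f x \<oplus>\<^bsub>W\<^esub> f y) \<and>
      (\<forall>a\<in>carrier R. \<forall>x\<in>carrier V. f (a \<odot>\<^bsub>V\<^esub> x) = a \<odot>\<^bsub>W\<^esub> f x)}"

text \<open>
  All values of a functor to \<open>k\<close>-modules are carried by subsets of one type \<open>'m\<close>. This is no
  restriction: \<open>'m\<close> is arbitrary, and the disjoint union of the values can serve as \<open>'m\<close>.
\<close>

record ('o, 'a, 'k, 'm) catmod =
  ob :: "'o \<Rightarrow> ('k, 'm) module"
  mor :: "'o \<Rightarrow> 'o \<Rightarrow> 'a \<Rightarrow> 'm \<Rightarrow> 'm"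

locale cat_module =
  fixes C :: "('o, 'a) cat" and k :: "'k ring" and M :: "('o, 'a, 'k, 'm) catmod"
  assumes ob_module: "a \<in> Obj C \<Longrightarrow> Module.module k (ob M a)"
    and mor_linear: "\<lbrakk>a \<in> Obj C; b \<in> Obj C; f \<in> Hom C a b\<rbrakk>
      \<Longrightarrow> mor M a b f \<in> linear_maps k (ob M a) (ob M b)"
    and mor_Id: "\<lbrakk>a \<in> Obj C; x \<in> carrier (ob M a)\<rbrakk> \<Longrightarrow> mor M a a (Id C a) x = x"
    and mor_Comp: "\<lbrakk>a \<in> Obj C; b \<in> Obj C; c \<in> Obj C; f \<in> Hom C a b; g \<in> Hom C b c;
        x \<in> carrier (ob M a)\<rbrakk>
      \<Longrightarrow> mor M a c (Comp C a b c g f) x = mor M b c g (mor M a b f x)"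

locale cat_submodule = cat_module C k M
  for C :: "('o, 'a) cat" and k :: "'k ring" and M :: "('o, 'a, 'k, 'm) catmod" +
  fixes N :: "'o \<Rightarrow> 'm set"
  assumes sub_ob: "a \<in> Obj C \<Longrightarrow> submodule (N a) k (ob M a)"
    and sub_mor: "\<lbrakk>a \<in> Obj C; b \<in> Obj C; f \<in> Hom C a b\<rbrakk> \<Longrightarrow> mor M a b f ` N a \<subseteq> N b"

definition sub_catmod ::
  "('o, 'a, 'k, 'm) catmod \<Rightarrow> ('o \<Rightarrow> 'm set) \<Rightarrow> ('o, 'a, 'k, 'm) catmod"
  where "sub_catmod M N = \<lparr>ob = (\<lambda>a. (ob M a)\<lparr>carrier := N a\<rparr>), mor = mor M\<rparr>"

definition generated_submodule ::
  "('o, 'a) cat \<Rightarrow> 'k ring \<Rightarrow> ('o, 'a, 'k, 'm) catmod \<Rightarrow> ('o \<times> 'm) set \<Rightarrow> 'o \<Rightarrow> 'm set"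
  where "generated_submodule C k M G a =
    \<Inter> {N a | N. cat_submodule C k M N \<and> (\<forall>(b, x)\<in>G. x \<in> N b)}"

definition finitely_generated ::
  "('o, 'a) cat \<Rightarrow> 'k ring \<Rightarrow> ('o, 'a, 'k, 'm) catmod \<Rightarrow> bool"
  where "finitely_generated C k M \<longleftrightarrow>
    (\<exists>G. finite G \<and> (\<forall>(b, x)\<in>G. b \<in> Obj C \<and> x \<in> carrier (ob M b)) \<and>
      (\<forall>a\<in>Obj C. generated_submodule C k M G a = carrier (ob M a)))"

definition locally_noetherian_over ::
  "'m itself \<Rightarrow> ('o, 'a) cat \<Rightarrow> 'k ring \<Rightarrow> bool"
  where "locally_noetherian_over (_ :: 'm itself) C k \<longleftrightarrow>
    (\<forall>(M :: ('o, 'a, 'k, 'm) catmod) N.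
      cat_module C k M \<longrightarrow> finitely_generated C k M \<longrightarrow> cat_submodule C k M N \<longrightarrow>
      finitely_generated C k (sub_catmod M N))"

text \<open>
  The type arguments bound the universe in which the coefficient ring and the modules live; a
  theorem with both types left as variables covers all of them.
\<close>

definition locally_noetherian :: "'k itself \<Rightarrow> 'm itself \<Rightarrow> ('o, 'a) cat \<Rightarrow> bool"
  where "locally_noetherian (_ :: 'k itself) (_ :: 'm itself) C \<longleftrightarrow>
    (\<forall>k :: 'k ring. cring k \<longrightarrow> noetherian_ring k \<longrightarrow> locally_noetherian_over TYPE('m) C k)"


section \<open>The categories VIC\<close>

definition lin_indep :: "('r, 'x) ring_scheme \<Rightarrow> ('r, 'v, 'y) module_scheme \<Rightarrow> 'v set \<Rightarrow> bool"
  where "lin_indep R V B \<longleftrightarrow>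
    (\<forall>A a. finite A \<longrightarrow> A \<subseteq> B \<longrightarrow> a \<in> A \<rightarrow> carrier R \<longrightarrow>
      (\<Oplus>\<^bsub>V\<^esub>v\<in>A. a v \<odot>\<^bsub>V\<^esub> v) = \<zero>\<^bsub>V\<^esub> \<longrightarrow> (\<forall>v\<in>A. a v = \<zero>\<^bsub>R\<^esub>))"

definition spanning :: "('r, 'x) ring_scheme \<Rightarrow> ('r, 'v, 'y) module_scheme \<Rightarrow> 'v set \<Rightarrow> bool"
  where "spanning R V B \<longleftrightarrow>
    (\<forall>x\<in>carrier V. \<exists>A a. finite A \<and> A \<subseteq> B \<and> a \<in> A \<rightarrow> carrier R \<and>
      x = (\<Oplus>\<^bsub>V\<^esub>v\<in>A. a v \<odot>\<^bsub>V\<^esub> v))"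

definition free_module :: "('r, 'x) ring_scheme \<Rightarrow> ('r, 'v, 'y) module_scheme \<Rightarrow> bool"
  where "free_module R V \<longleftrightarrow>
    Module.module R V \<and> (\<exists>B \<subseteq> carrier V. lin_indep R V B \<and> spanning R V B)"

text \<open>
  The underlying function of a morphism is taken to be extensional, i.e. \<open>undefined\<close> outside
  \<open>carrier V\<close>, so that equality of morphisms is equality of functions on \<open>V\<close>.
\<close>

definition vic_hom ::
  "('r, 'x) ring_scheme \<Rightarrow> ('r, 'v, 'y) module_scheme \<Rightarrow> ('r, 'w, 'z) module_scheme
    \<Rightarrow> (('v \<Rightarrow> 'w) \<times> 'w set) set"
  where "vic_hom R V W =
    {(f, C). f \<in> linear_maps R V W \<and> f \<in> extensional (carrier V) \<and> inj_on f (carrier V) \<and>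
      submodule C R W \<and> free_module R (W\<lparr>carrier := C\<rparr>) \<and>
      f ` carrier V <+>\<^bsub>W\<^esub> C = carrier W \<and> f ` carrier V \<inter> C = {\<zero>\<^bsub>W\<^esub>}}"

definition vic_id :: "('r, 'v, 'y) module_scheme \<Rightarrow> ('v \<Rightarrow> 'v) \<times> 'v set"
  where "vic_id V = (\<lambda>x\<in>carrier V. x, {\<zero>\<^bsub>V\<^esub>})"

definition vic_comp ::
  "('r, 'v, 'y) module_scheme \<Rightarrow> ('r, 'u, 'z) module_scheme
    \<Rightarrow> ('w \<Rightarrow> 'u) \<times> 'u set \<Rightarrow> ('v \<Rightarrow> 'w) \<times> 'w set \<Rightarrow> ('v \<Rightarrow> 'u) \<times> 'u set"
  where "vic_comp V W = (\<lambda>(g, D) (f, C). (compose (carrier V) g f, g ` C <+>\<^bsub>W\<^esub> D))"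

text \<open>
  The module \<open>R\<^sup>n\<close>. The type of module records has fields for a multiplication and a unit, which
  play no role in a module; they are filled with the pointwise ones.
\<close>

definition std_module :: "'r ring \<Rightarrow> nat \<Rightarrow> ('r, nat \<Rightarrow> 'r) module"
  where "std_module R n = \<lparr>
    carrier = {..<n} \<rightarrow>\<^sub>E carrier R,
    monoid.mult = (\<lambda>x y. \<lambda>i\<in>{..<n}. x i \<otimes>\<^bsub>R\<^esub> y i),
    one = (\<lambda>i\<in>{..<n}. \<one>\<^bsub>R\<^esub>),
    zero = (\<lambda>i\<in>{..<n}. \<zero>\<^bsub>R\<^esub>),
    add = (\<lambda>x y. \<lambda>i\<in>{..<n}. x i \<oplus>\<^bsub>R\<^esub> y i),
    smult = (\<lambda>a x. \<lambda>i\<in>{..<n}. a \<otimes>\<^bsub>R\<^esub> x i)\<rparr>"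

definition std_basis :: "'r ring \<Rightarrow> nat \<Rightarrow> nat \<Rightarrow> (nat \<Rightarrow> 'r)"
  where "std_basis R n j = (\<lambda>i\<in>{..<n}. if i = j then \<one>\<^bsub>R\<^esub> else \<zero>\<^bsub>R\<^esub>)"

text \<open>
  Leibniz formula for the matrix of \<open>f\<close>, an endomorphism of \<open>R\<^sup>n\<close>, in the standard basis: the
  entry in row \<open>i\<close> and column \<open>j\<close> is \<open>f (std_basis R n j) i\<close>.
\<close>

definition det_map :: "'r ring \<Rightarrow> nat \<Rightarrow> ((nat \<Rightarrow> 'r) \<Rightarrow> (nat \<Rightarrow> 'r)) \<Rightarrow> 'r"
  where "det_map R n f =
    (\<Oplus>\<^bsub>R\<^esub>p\<in>{p. p permutes {..<n}}.
      (if evenperm p then \<one>\<^bsub>R\<^esub> else \<ominus>\<^bsub>R\<^esub> \<one>\<^bsub>R\<^esub>) \<otimes>\<^bsub>R\<^esub>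
      (\<Otimes>\<^bsub>R\<^esub>j\<in>{..<n}. f (std_basis R n j) (p j)))"

text \<open>The object \<open>R\<^sup>n\<close> is represented by the number \<open>n\<close>.\<close>

definition VIC ::
  "'r ring \<Rightarrow> 'r set \<Rightarrow> (nat, ((nat \<Rightarrow> 'r) \<Rightarrow> (nat \<Rightarrow> 'r)) \<times> (nat \<Rightarrow> 'r) set) cat"
  where "VIC R U = \<lparr>
    Obj = UNIV,
    Hom = (\<lambda>n n'. {(f, C) \<in> vic_hom R (std_module R n) (std_module R n').
                    n = n' \<longrightarrow> det_map R n f \<in> U}),
    Id = (\<lambda>n. vic_id (std_module R n)),
    Comp = (\<lambda>n n' n''. vic_comp (std_module R n) (std_module R n''))\<rparr>"

end

theory Submission
  imports Defs "HOL-Library.Ramsey" "HOL-Library.Sublist" "HOL-Library.Fun_Lexorder"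
    "HOL-Library.Countable_Set"
begin

text \<open>
  A morphism \<open>\<phi> : R\<^sup>d \<rightarrow> R\<^sup>n\<close> of VIC is the same thing as a pair of linear maps \<open>f : R\<^sup>d \<rightarrow> R\<^sup>n\<close> and
  \<open>p : R\<^sup>n \<rightarrow> R\<^sup>d\<close> with \<open>p \<circ> f = id\<close> and free kernel of \<open>p\<close>: the map \<open>p\<close>, called the retraction below, is the
  projection along the complement. Listing for each \<open>l < n\<close> the column \<open>p(e\<^sub>l)\<close> and the row
  \<open>v \<mapsto> f(v)\<^sub>l\<close> turns \<open>\<phi>\<close> into a word of length \<open>n\<close>. Since \<open>R\<close> is finite, the alphabet is finite
  for each \<open>d\<close>.

  The heart of the proof is that certain insertions of letters are compositions. Let the word of
  \<open>\<psi> : R\<^sup>d \<rightarrow> R\<^sup>m\<close> arise from that of \<open>\<phi>\<close> by inserting letters such that every inserted column already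
  occurs further left, and such that, for every column \<open>c\<close>, the inserted rows with column \<open>c\<close> add up
  to zero. Then \<open>\<psi> = \<eta> \<circ> \<phi>\<close> for a morphism \<open>\<eta> : R\<^sup>n \<rightarrow> R\<^sup>m\<close>. The retraction of \<open>\<eta>\<close> sends the unit vector of an
  inserted position to that of the first position where its column occurs in \<open>\<phi>\<close>. The injection of
  \<open>\<eta>\<close> copies the coordinates of \<open>x\<close> to the old positions and puts the corresponding coordinate of
  \<open>g(p(x))\<close>, for \<open>g\<close> the injection of \<open>\<psi>\<close>, at an inserted position. The condition on the rows makes
  these two maps compose to the identity (locale \<open>word_insertion\<close>).

  Both conditions on the inserted letters amount to finite data: it suffices to mark the first
  occurrence of each column, and to record the set of all columns and, for every column, the sum of
  its rows. Higman's lemma over a finite alphabet and the pigeonhole principle then show that in every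
  infinite sequence of morphisms with sources from a finite set, a later one arises from an earlier
  one in this way (\<open>higman_finite_colours\<close>, \<open>word_insertion_exists\<close>).

  This yields the theorem by an argument with leading terms as in Hilbert's basis theorem. A finitely
  generated module is spanned by the images of its generators under all morphisms. These are
  compared lexicographically: first the generators, then the columns, then the rows. Composition
  with \<open>\<eta>\<close> preserves this order below \<open>\<phi>\<close> (\<open>key_mono\<close>), because an inserted column repeats
  one further left, and because the inserted rows of \<open>\<eta> \<circ> \<chi>\<close> and of \<open>\<psi>\<close> coincide as soon as \<open>\<chi>\<close> and \<open>\<phi>\<close>
  have the same columns. The locale \<open>leading_terms\<close> contains the resulting abstract criterion.

  The determinant condition concerns \<open>\<eta>\<close> only for \<open>n = m\<close>, where nothing is inserted and \<open>\<eta>\<close> can be taken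
  to be the identity. It enters otherwise in the closure of the hom-sets under composition, which rests on the
  multiplicativity of the determinant (\<open>matrix_det_mult\<close>).
\<close>

section \<open>Higman's lemma over a finite alphabet\<close>

definition bad_words :: "'a set \<Rightarrow> (nat \<Rightarrow> 'a list) \<Rightarrow> bool"
  where "bad_words A w \<longleftrightarrow>
    (\<forall>i. set (w i) \<subseteq> A) \<and> (\<forall>i j. i < j \<longrightarrow> \<not> subseq (w i) (w j))"

text \<open>
  Nash-Williams' choice: the words are fixed one after the other, each as short as possible among
  the bad sequences that begin with the words fixed so far.
\<close>

lemma minimal_bad_words:
  assumes "bad_words A w"
  obtains m where "bad_words A m"
    and "\<And>n v. \<lbrakk>bad_words A v; \<And>i. i < n \<Longrightarrow> v i = m i\<rbrakk> \<Longrightarrow> length (m n) \<le> length (v n)"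
proof -
  let ?min = "\<lambda>s j. \<forall>v. bad_words A v \<and> (\<forall>i<j. v i = s i) \<longrightarrow> length (s j) \<le> length (v j)"
  let ?P = "\<lambda>n s. bad_words A s \<and> (\<forall>j<n. ?min s j)"
  have step: "\<exists>s'. ?P (Suc n) s' \<and> (\<forall>i<n. s' i = s i)" if s: "?P n s" for n s
  proof -
    let ?B = "\<lambda>v. bad_words A v \<and> (\<forall>i<n. v i = s i)"
    have "?B s" using s by simp
    then obtain s' where s': "?B s'" "\<And>v. ?B v \<Longrightarrow> length (s' n) \<le> length (v n)"
      using arg_min_natI[of ?B s "\<lambda>v. length (v n)"] arg_min_nat_le[of ?B _ "\<lambda>v. length (v n)"]
      by blast
    have "?min s' j" if "j < Suc n" for j
    proof (intro allI impI)
      fix v assume v: "bad_words A v \<and> (\<forall>i<j. v i = s' i)"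
      show "length (s' j) \<le> length (v j)"
      proof (cases "j < n")
        case True
        then have "\<forall>i<j. v i = s i" using v s'(1) by simp
        then show ?thesis using s s'(1) v True by auto
      next
        case False
        then have "j = n" using that by simp
        then show ?thesis using v s' by auto
      qed
    qed
    then show ?thesis using s'(1) by blast
  qed
  have "\<exists>s. \<forall>n. ?P n (s n) \<and> (\<forall>i<n. s (Suc n) i = s n i)"
  proof (rule dependent_nat_choice)
    show "\<exists>s. ?P 0 s" using assms by blast
  next
    fix s n assume "?P n s"
    then show "\<exists>s'. ?P (Suc n) s' \<and> (\<forall>i<n. s' i = s i)" by (rule step)
  qed
  then obtain s where sP: "\<forall>n. ?P n (s n) \<and> (\<forall>i<n. s (Suc n) i = s n i)" ..
  have s: "?P n (s n)" "\<forall>i<n. s (Suc n) i = s n i" for n using sP by blast+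
  have agree: "s n i = s (Suc i) i" if "i < n" for i n
    using that
  proof (induction n)
    case (Suc n)
    then show ?case using s(2)[of n] by (cases "i = n") auto
  qed simp
  define m where "m n = s (Suc n) n" for n
  have bad: "bad_words A m"
    unfolding bad_words_def
  proof (intro conjI allI impI)
    show "set (m i) \<subseteq> A" for i
      using s(1)[of "Suc i"] by (simp add: m_def bad_words_def)
    show "\<not> subseq (m i) (m j)" if "i < j" for i j
    proof -
      have "bad_words A (s (Suc j))" using s(1) by blast
      then have "\<not> subseq (s (Suc j) i) (s (Suc j) j)" using that by (simp add: bad_words_def)
      then show ?thesis using agree[of i "Suc j"] that by (simp add: m_def)
    qed
  qed
  show thesis
  proof (rule that[OF bad])
    fix n v assume v: "bad_words A v" "\<And>i. i < n \<Longrightarrow> v i = m i"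
    have "\<forall>i<n. v i = s (Suc n) i"
      using v(2) agree[of _ "Suc n"] by (simp add: m_def)
    then show "length (m n) \<le> length (v n)"
      using s(1)[of "Suc n"] v(1) by (simp add: m_def)
  qed
qed

lemma infinite_fibre:
  assumes "finite B" and "\<And>i::nat. c i \<in> B"
  obtains b where "b \<in> B" "infinite {i. c i = b}"
proof -
  have "(\<Union>b\<in>B. {i. c i = b}) = UNIV" using assms(2) by auto
  then have "infinite (\<Union>b\<in>B. {i. c i = b})" by simp
  then show thesis using that assms(1) by blast
qed

text \<open>
  No word of a minimal bad sequence is empty, so infinitely many of them begin with the same letter.
  Removing this letter from those words, and discarding all other words after the first of them,
  gives a bad sequence that contradicts minimality.
\<close>

theorem higman_finite_alphabet:
  fixes w :: "nat \<Rightarrow> 'a list"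
  assumes fin: "finite A" and w: "\<And>i. set (w i) \<subseteq> A"
  shows "\<exists>i j. i < j \<and> subseq (w i) (w j)"
proof (rule ccontr)
  assume "\<not> ?thesis"
  then have "bad_words A w" using w by (auto simp: bad_words_def)
  then obtain m where bad: "bad_words A m"
    and min: "\<And>n v. \<lbrakk>bad_words A v; \<And>i. i < n \<Longrightarrow> v i = m i\<rbrakk> \<Longrightarrow> length (m n) \<le> length (v n)"
    by (rule minimal_bad_words) blast
  have ne: "m n \<noteq> []" for n
  proof
    assume "m n = []"
    moreover have "\<not> subseq (m n) (m (Suc n))" using bad by (simp add: bad_words_def)
    ultimately show False by simp
  qed
  have "hd (m n) \<in> A" for n
    using bad ne[of n] unfolding bad_words_def by (meson hd_in_set subsetD)
  then obtain a where inf: "infinite {n. hd (m n) = a}"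
    using infinite_fibre[OF fin, of "\<lambda>n. hd (m n)"] by blast
  define r where "r = enumerate {n. hd (m n) = a}"
  have r: "hd (m (r i)) = a" "i < j \<Longrightarrow> r i < r j" for i j
    using enumerate_in_set[OF inf, of i] enumerate_mono[OF _ inf] by (auto simp: r_def)
  have cons: "m (r i) = a # tl (m (r i))" for i
    using r(1)[of i] ne[of "r i"] by (metis list.collapse)
  \<comment> \<open>up to the first word starting with \<open>a\<close> the sequence is kept; then come the shortened words\<close>
  define v where "v i = (if i < r 0 then m i else tl (m (r (i - r 0))))" for i
  have "bad_words A v"
    unfolding bad_words_def
  proof (intro conjI allI impI)
    fix i
    show "set (v i) \<subseteq> A"
      using bad ne unfolding bad_words_def v_def by (auto dest: list.set_sel(2))
  next
    fix i j :: nat assume ij: "i < j"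
    show "\<not> subseq (v i) (v j)"
    proof (cases "j < r 0")
      case True
      then show ?thesis using ij bad by (simp add: v_def bad_words_def)
    next
      case j: False
      let ?j = "r (j - r 0)"
      have rj: "r 0 \<le> ?j" using r(2)[of 0 "j - r 0"] by (cases "j - r 0 = 0") auto
      show ?thesis
      proof (cases "i < r 0")
        case True
        then have "\<not> subseq (m i) (m ?j)" using rj bad by (simp add: bad_words_def)
        then show ?thesis using True j cons[of "j - r 0"] by (metis list_emb_Cons v_def)
      next
        case False
        then have "\<not> subseq (m (r (i - r 0))) (m ?j)"
          using bad r(2)[of "i - r 0" "j - r 0"] ij j by (simp add: bad_words_def)
        then show ?thesis
          using False j cons[of "i - r 0"] cons[of "j - r 0"] by (metis subseq_Cons2 v_def)
      qed
    qed
  qed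
  moreover have "v i = m i" if "i < r 0" for i using that by (simp add: v_def)
  ultimately have "length (m (r 0)) \<le> length (v (r 0))" by (rule min)
  moreover have "length (v (r 0)) < length (m (r 0))"
    using ne[of "r 0"] by (cases "m (r 0)") (simp_all add: v_def)
  ultimately show False by simp
qed

text \<open>
  Ramsey's theorem, with pairs of indices coloured by whether the terms are related: a homogeneous
  set of the other colour would be a subsequence without related terms.
\<close>

lemma ascending_subsequence:
  fixes x :: "nat \<Rightarrow> 'a"
  assumes good: "\<And>r :: nat \<Rightarrow> nat. strict_mono r \<Longrightarrow> \<exists>i j. i < j \<and> P (x (r i)) (x (r j))"
  obtains r :: "nat \<Rightarrow> nat" where "strict_mono r" "\<And>i j. i < j \<Longrightarrow> P (x (r i)) (x (r j))"
proof -
  define col where "col S = (if P (x (Min S)) (x (Max S)) then 0 else 1::nat)" for S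
  have "\<forall>x\<in>UNIV. \<forall>y\<in>UNIV. x \<noteq> y \<longrightarrow> col {x, y} < 2" by (auto simp: col_def)
  then obtain Y t where Y: "infinite Y" "\<forall>x\<in>Y. \<forall>y\<in>Y. x \<noteq> y \<longrightarrow> col {x, y} = t"
    using Ramsey2[of UNIV col 2] by auto
  define r where "r = enumerate Y"
  have r: "strict_mono r" unfolding r_def using Y(1) by (rule strict_mono_enumerate)
  have rY: "r i \<in> Y" for i unfolding r_def using enumerate_in_set[OF Y(1)] .
  have col: "col {r i, r j} = t" if "i < j" for i j
    using Y(2) rY[of i] rY[of j] strict_monoD[OF r that] by simp
  have P: "P (x (r i)) (x (r j)) \<longleftrightarrow> t = 0" if "i < j" for i j
  proof -
    have "Min {r i, r j} = r i" "Max {r i, r j} = r j"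
      using strict_monoD[OF r that] by auto
    then show ?thesis using col[OF that] by (auto simp: col_def split: if_splits)
  qed
  have "t = 0" using good[OF r] P by blast
  then show thesis using that[OF r] P by blast
qed

lemma higman_finite_colours:
  fixes x :: "nat \<Rightarrow> 'a"
  assumes "finite A" "finite B" "\<And>i. set (word (x i)) \<subseteq> A" "\<And>i. colour (x i) \<in> B"
  shows "\<exists>i j. i < j \<and> colour (x i) = colour (x j) \<and> subseq (word (x i)) (word (x j))"
proof -
  obtain b where inf: "infinite {i. colour (x i) = b}"
    using infinite_fibre[OF assms(2), of "\<lambda>i. colour (x i)"] assms(4) by blast
  define r where "r = enumerate {i. colour (x i) = b}"
  have col: "colour (x (r i)) = b" for i
    unfolding r_def using enumerate_in_set[OF inf, of i] by simp
  obtain i j where "i < j" "subseq (word (x (r i))) (word (x (r j)))"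
    using higman_finite_alphabet[OF assms(1), of "\<lambda>i. word (x (r i))"] assms(3) by auto
  moreover have "r i < r j" unfolding r_def using enumerate_mono[OF \<open>i < j\<close> inf] .
  ultimately show ?thesis using col by metis
qed

lemma subseq_positions:
  assumes "subseq xs ys"
  obtains \<iota> where "strict_mono_on {..<length xs} \<iota>"
    and "\<And>l. l < length xs \<Longrightarrow> \<iota> l < length ys \<and> ys ! \<iota> l = xs ! l"
proof -
  from assms have "\<exists>\<iota>. strict_mono_on {..<length xs} \<iota> \<and>
    (\<forall>l < length xs. \<iota> l < length ys \<and> ys ! \<iota> l = xs ! l)"
  proof (induction rule: list_emb.induct)
    case (list_emb_Nil ys)
    then show ?case by (auto simp: strict_mono_on_def)
  next
    case (list_emb_Cons xs ys y)
    then obtain \<iota> where "strict_mono_on {..<length xs} \<iota>"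
      "\<forall>l < length xs. \<iota> l < length ys \<and> ys ! \<iota> l = xs ! l" by blast
    then show ?case
      by (intro exI[of _ "\<lambda>l. Suc (\<iota> l)"]) (auto simp: strict_mono_on_def)
  next
    case (list_emb_Cons2 x y xs ys)
    then obtain \<iota> where "strict_mono_on {..<length xs} \<iota>"
      "\<forall>l < length xs. \<iota> l < length ys \<and> ys ! \<iota> l = xs ! l" by blast
    then show ?case using list_emb_Cons2(1)
      by (intro exI[of _ "\<lambda>l. case l of 0 \<Rightarrow> 0 | Suc l \<Rightarrow> Suc (\<iota> l)"])
        (auto simp: strict_mono_on_def split: nat.splits)
  qed
  then show thesis using that by blast
qed

section \<open>A leading-term criterion for finite generation\<close>

text \<open>
  An inductive description of linear spans, which turns statements about finite linear combinations
  into rule inductions.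
\<close>

inductive_set lin_span ::
  "('k, 'x) ring_scheme \<Rightarrow> ('k, 'm, 'y) module_scheme \<Rightarrow> 'm set \<Rightarrow> 'm set"
  for k :: "('k, 'x) ring_scheme" and V :: "('k, 'm, 'y) module_scheme" and A :: "'m set"
  where
    zero: "\<zero>\<^bsub>V\<^esub> \<in> lin_span k V A"
  | step: "\<lbrakk>c \<in> carrier k; a \<in> A; s \<in> lin_span k V A\<rbrakk> \<Longrightarrow> c \<odot>\<^bsub>V\<^esub> a \<oplus>\<^bsub>V\<^esub> s \<in> lin_span k V A"

context Module.module
begin

lemma submodule_closed:
  assumes "submodule H R M"
  shows "H \<subseteq> carrier M" "\<zero>\<^bsub>M\<^esub> \<in> H"
    "\<And>x y. \<lbrakk>x \<in> H; y \<in> H\<rbrakk> \<Longrightarrow> x \<oplus>\<^bsub>M\<^esub> y \<in> H"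
    "\<And>c x. \<lbrakk>c \<in> carrier R; x \<in> H\<rbrakk> \<Longrightarrow> c \<odot>\<^bsub>M\<^esub> x \<in> H"
    "\<And>x. x \<in> H \<Longrightarrow> \<ominus>\<^bsub>M\<^esub> x \<in> H"
    "\<And>x y. \<lbrakk>x \<in> H; y \<in> H\<rbrakk> \<Longrightarrow> x \<ominus>\<^bsub>M\<^esub> y \<in> H"
  using submoduleE[OF assms] subgroup.one_closed[OF submodule.axioms(1)[OF assms]]
  by (auto simp: a_minus_def)

lemma submoduleI':
  assumes "H \<subseteq> carrier M" "\<zero>\<^bsub>M\<^esub> \<in> H" "\<And>x y. \<lbrakk>x \<in> H; y \<in> H\<rbrakk> \<Longrightarrow> x \<oplus>\<^bsub>M\<^esub> y \<in> H"
    "\<And>c x. \<lbrakk>c \<in> carrier R; x \<in> H\<rbrakk> \<Longrightarrow> c \<odot>\<^bsub>M\<^esub> x \<in> H"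
  shows "submodule H R M"
proof (rule submoduleI)
  fix x assume "x \<in> H"
  then show "\<ominus>\<^bsub>M\<^esub> x \<in> H"
    using assms(1) assms(4)[of "\<ominus>\<^bsub>R\<^esub> \<one>\<^bsub>R\<^esub>" x] smult_l_minus[of "\<one>\<^bsub>R\<^esub>" x] by auto
qed (use assms in auto)

lemma lin_span_closed: "A \<subseteq> carrier M \<Longrightarrow> lin_span R M A \<subseteq> carrier M"
proof
  fix x assume A: "A \<subseteq> carrier M" and "x \<in> lin_span R M A"
  from this(2) show "x \<in> carrier M" by induction (use A in auto)
qed

lemma lin_span_submodule:
  assumes A: "A \<subseteq> carrier M"
  shows "submodule (lin_span R M A) R M"
proof (rule submoduleI')
  note closed = lin_span_closed[OF A, THEN subsetD]
  show "lin_span R M A \<subseteq> carrier M" by (rule lin_span_closed[OF A])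
  show "\<zero>\<^bsub>M\<^esub> \<in> lin_span R M A" by (rule lin_span.zero)
  show "x \<oplus>\<^bsub>M\<^esub> y \<in> lin_span R M A" if "x \<in> lin_span R M A" "y \<in> lin_span R M A" for x y
    using that(1)
  proof induction
    case zero
    then show ?case using closed[OF that(2)] that(2) by simp
  next
    case (step c a s)
    have "(c \<odot>\<^bsub>M\<^esub> a \<oplus>\<^bsub>M\<^esub> s) \<oplus>\<^bsub>M\<^esub> y = c \<odot>\<^bsub>M\<^esub> a \<oplus>\<^bsub>M\<^esub> (s \<oplus>\<^bsub>M\<^esub> y)"
      using step A closed[OF that(2)] closed[OF step(3)] by (intro M.a_assoc) auto
    then show ?case using lin_span.step[OF step(1,2,4)] by simp
  qed
  show "c \<odot>\<^bsub>M\<^esub> x \<in> lin_span R M A" if c: "c \<in> carrier R" and "x \<in> lin_span R M A" for c x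
    using that(2)
  proof induction
    case zero
    then show ?case using c by (simp add: lin_span.zero)
  next
    case (step d a s)
    have "c \<odot>\<^bsub>M\<^esub> (d \<odot>\<^bsub>M\<^esub> a \<oplus>\<^bsub>M\<^esub> s) = (c \<otimes>\<^bsub>R\<^esub> d) \<odot>\<^bsub>M\<^esub> a \<oplus>\<^bsub>M\<^esub> c \<odot>\<^bsub>M\<^esub> s"
      using step A c closed[OF step(3)] by (subst smult_r_distr) (auto simp: smult_assoc1)
    then show ?case using lin_span.step[OF _ step(2,4)] step(1) c by simp
  qed
qed

lemma lin_span_base: "\<lbrakk>A \<subseteq> carrier M; a \<in> A\<rbrakk> \<Longrightarrow> a \<in> lin_span R M A"
  using lin_span.step[OF R.one_closed _ lin_span.zero, of a A M] by (simp add: subsetD)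

lemma lin_span_minimal:
  assumes "submodule H R M" "A \<subseteq> H"
  shows "lin_span R M A \<subseteq> H"
proof
  fix x assume "x \<in> lin_span R M A"
  then show "x \<in> H" by induction (use assms submodule_closed[OF assms(1)] in auto)
qed

lemma lin_span_mono: "A \<subseteq> B \<Longrightarrow> lin_span R M A \<subseteq> lin_span R M B"
proof
  fix x assume A: "A \<subseteq> B" and "x \<in> lin_span R M A"
  from this(2) show "x \<in> lin_span R M B"
    by induction (use A in \<open>auto intro: lin_span.intros\<close>)
qed

lemma lin_span_insert:
  assumes A: "insert a A \<subseteq> carrier M" and "x \<in> lin_span R M (insert a A)"
  shows "\<exists>c\<in>carrier R. \<exists>s\<in>lin_span R M A. x = c \<odot>\<^bsub>M\<^esub> a \<oplus>\<^bsub>M\<^esub> s"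
  using assms(2)
proof induction
  case zero
  then show ?case using A by (intro bexI[of _ "\<zero>\<^bsub>R\<^esub>"] bexI[OF _ lin_span.zero]) auto
next
  case (step d b t)
  then obtain c s where cs: "c \<in> carrier R" "s \<in> lin_span R M A" "t = c \<odot>\<^bsub>M\<^esub> a \<oplus>\<^bsub>M\<^esub> s" by blast
  have s: "s \<in> carrier M" using cs(2) lin_span_closed[of A] A by auto
  have da: "d \<odot>\<^bsub>M\<^esub> b \<in> carrier M" using step A by auto
  show ?case
  proof (cases "b = a")
    case True
    have "d \<odot>\<^bsub>M\<^esub> b \<oplus>\<^bsub>M\<^esub> t = (d \<oplus>\<^bsub>R\<^esub> c) \<odot>\<^bsub>M\<^esub> a \<oplus>\<^bsub>M\<^esub> s"
      using cs(1,3) s step(1) A True by (simp add: smult_l_distr M.a_assoc)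
    then show ?thesis using cs step(1) by blast
  next
    case False
    have "d \<odot>\<^bsub>M\<^esub> b \<oplus>\<^bsub>M\<^esub> t = c \<odot>\<^bsub>M\<^esub> a \<oplus>\<^bsub>M\<^esub> (d \<odot>\<^bsub>M\<^esub> b \<oplus>\<^bsub>M\<^esub> s)"
      using cs(1,3) s da A by (simp add: M.a_lcomm)
    moreover have "d \<odot>\<^bsub>M\<^esub> b \<oplus>\<^bsub>M\<^esub> s \<in> lin_span R M A"
      using False step by (intro lin_span.step cs(2)) auto
    ultimately show ?thesis using cs(1) by blast
  qed
qed

lemma linear_mapsD:
  assumes "f \<in> linear_maps R M W"
  shows "x \<in> carrier M \<Longrightarrow> f x \<in> carrier W"
    "\<lbrakk>x \<in> carrier M; y \<in> carrier M\<rbrakk> \<Longrightarrow> f (x \<oplus>\<^bsub>M\<^esub> y) = f x \<oplus>\<^bsub>W\<^esub> f y"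
    "\<lbrakk>c \<in> carrier R; x \<in> carrier M\<rbrakk> \<Longrightarrow> f (c \<odot>\<^bsub>M\<^esub> x) = c \<odot>\<^bsub>W\<^esub> f x"
  using assms by (auto simp: linear_maps_def)

lemma linear_maps_zero:
  assumes "f \<in> linear_maps R M W" "Module.module R W"
  shows "f \<zero>\<^bsub>M\<^esub> = \<zero>\<^bsub>W\<^esub>"
proof -
  interpret W: Module.module R W by fact
  have "f (\<zero>\<^bsub>R\<^esub> \<odot>\<^bsub>M\<^esub> \<zero>\<^bsub>M\<^esub>) = \<zero>\<^bsub>R\<^esub> \<odot>\<^bsub>W\<^esub> f \<zero>\<^bsub>M\<^esub>"
    using linear_mapsD(3)[OF assms(1), of "\<zero>\<^bsub>R\<^esub>" "\<zero>\<^bsub>M\<^esub>"] by simp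
  then show ?thesis using linear_mapsD(1)[OF assms(1)] by simp
qed

lemma linear_maps_lin_span:
  assumes f: "f \<in> linear_maps R M W" and W: "Module.module R W" and A: "A \<subseteq> carrier M"
    and "f ` A \<subseteq> B" and "x \<in> lin_span R M A"
  shows "f x \<in> lin_span R W B"
  using assms(5)
proof induction
  case zero
  then show ?case using linear_maps_zero[OF f W] by (simp add: lin_span.zero)
next
  case (step c a s)
  have s: "s \<in> carrier M" using step(3) lin_span_closed[OF A] by auto
  have a: "a \<in> carrier M" "f a \<in> B" using step(2) A assms(4) by auto
  have "f (c \<odot>\<^bsub>M\<^esub> a \<oplus>\<^bsub>M\<^esub> s) = c \<odot>\<^bsub>W\<^esub> f a \<oplus>\<^bsub>W\<^esub> f s"
    using linear_mapsD[OF f] step(1) s a by simp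
  then show ?case using lin_span.step[OF step(1) a(2) step(4)] by simp
qed

end

text \<open>
  The ideals generated by the initial segments of the sequence form a chain, and in a Noetherian ring
  such a chain contains its union.
\<close>

lemma (in noetherian_ring) sequence_in_earlier_ideal:
  assumes c: "\<And>i::nat. c i \<in> carrier R"
  shows "\<exists>m. c m \<in> Idl (c ` {..<m})"
proof -
  let ?I = "\<lambda>m. Idl (c ` {..<m})"
  have ideal: "ideal (?I m) R" for m using c by (intro genideal_ideal) auto
  have self: "c ` {..<m} \<subseteq> ?I m" for m using c by (intro genideal_self) auto
  have mono: "?I m \<subseteq> ?I n" if "m \<le> n" for m n
    using self[of n] that by (intro genideal_minimal[OF ideal]) auto
  have "subset.chain {I. ideal I R} (range ?I)"
    unfolding subset.chain_def using ideal mono by (auto simp: subset_iff) (meson linear)+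
  then have "\<Union>(range ?I) \<in> range ?I" by (intro ideal_chain_is_trivial) auto
  then obtain m where m: "\<Union>(range ?I) = ?I m" by blast
  have "c m \<in> ?I (Suc m)" using self[of "Suc m"] by blast
  then have "c m \<in> ?I m" using m by blast
  then show ?thesis ..
qed

lemma cat_module_sub_catmod:
  assumes "cat_submodule C k M N"
  shows "cat_module C k (sub_catmod M N)"
proof -
  interpret cat_submodule C k M N by fact
  show ?thesis
  proof (rule cat_module.intro)
    fix a assume a: "a \<in> Obj C"
    show "Module.module k (ob (sub_catmod M N) a)"
      using submodule.submodule_is_module[OF sub_ob[OF a] ob_module[OF a]]
      by (simp add: sub_catmod_def)
    fix x assume x: "x \<in> carrier (ob (sub_catmod M N) a)"
    then have "x \<in> carrier (ob M a)"
      using module.submodule_closed(1)[OF ob_module[OF a] sub_ob[OF a]]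
      by (auto simp: sub_catmod_def)
    then show "mor (sub_catmod M N) a a (Id C a) x = x"
      using mor_Id[OF a] by (simp add: sub_catmod_def)
  next
    fix a b c f g x
    assume a: "a \<in> Obj C" and bc: "b \<in> Obj C" "c \<in> Obj C" "f \<in> Hom C a b" "g \<in> Hom C b c"
      and x: "x \<in> carrier (ob (sub_catmod M N) a)"
    then have "x \<in> carrier (ob M a)"
      using module.submodule_closed(1)[OF ob_module[OF a] sub_ob[OF a]]
      by (auto simp: sub_catmod_def)
    then show "mor (sub_catmod M N) a c (Comp C a b c g f) x =
        mor (sub_catmod M N) b c g (mor (sub_catmod M N) a b f x)"
      using mor_Comp[OF a bc] by (simp add: sub_catmod_def)
  next
    fix a b f assume ab: "a \<in> Obj C" "b \<in> Obj C" "f \<in> Hom C a b"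
    have "x \<in> carrier (ob M a)" if "x \<in> N a" for x
      using module.submodule_closed(1)[OF ob_module[OF ab(1)] sub_ob[OF ab(1)]] that by blast
    then show "mor (sub_catmod M N) a b f
      \<in> linear_maps k (ob (sub_catmod M N) a) (ob (sub_catmod M N) b)"
      using mor_linear[OF ab] sub_mor[OF ab]
      by (auto simp: sub_catmod_def linear_maps_def)
  qed
qed

lemma cat_submodule_sub_catmod:
  assumes "cat_submodule C k M N"
  shows "cat_submodule C k (sub_catmod M N) N"
proof -
  interpret cat_submodule C k M N by fact
  interpret sub: cat_module C k "sub_catmod M N" by (rule cat_module_sub_catmod[OF assms])
  show ?thesis
  proof (rule cat_submodule.intro[OF sub.cat_module_axioms cat_submodule_axioms.intro])
    fix a assume a: "a \<in> Obj C"
    show "submodule (N a) k (ob (sub_catmod M N) a)"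
      using module.carrier_is_submodule[OF sub.ob_module[OF a]] by (simp add: sub_catmod_def)
  qed (use sub_mor in \<open>auto simp: sub_catmod_def\<close>)
qed

text \<open>
  The submodule generated by \<open>G\<close> inside \<open>N\<close> is defined through submodules of \<open>N\<close>. As the operations
  of \<open>N\<close> are those of \<open>M\<close>, it can be treated as a submodule of \<open>M\<close> contained in \<open>N\<close>.
\<close>

lemma generated_in_sub_catmod:
  assumes N: "cat_submodule C k M N" and G: "\<forall>(b, x)\<in>G. x \<in> N b"
  defines "gen \<equiv> generated_submodule C k (sub_catmod M N) G"
  shows "a \<in> Obj C \<Longrightarrow> gen a \<subseteq> N a"
    and "a \<in> Obj C \<Longrightarrow> submodule (gen a) k (ob M a)"
    and "(a, x) \<in> G \<Longrightarrow> x \<in> gen a"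
    and "\<lbrakk>a \<in> Obj C; b \<in> Obj C; f \<in> Hom C a b; x \<in> gen a\<rbrakk> \<Longrightarrow> mor M a b f x \<in> gen b"
proof -
  interpret cat_submodule C k M N by fact
  interpret sub: cat_module C k "sub_catmod M N" by (rule cat_module_sub_catmod[OF N])
  let ?F = "{N'. cat_submodule C k (sub_catmod M N) N' \<and> (\<forall>(b, x)\<in>G. x \<in> N' b)}"
  have gen: "gen a = (\<Inter>N'\<in>?F. N' a)" for a
    unfolding gen_def generated_submodule_def by auto
  have NF: "N \<in> ?F" using cat_submodule_sub_catmod[OF N] G by simp
  show sub: "gen a \<subseteq> N a" for a using gen NF by blast
  show "x \<in> gen a" if "(a, x) \<in> G" using that by (auto simp: gen)
  show "submodule (gen a) k (ob M a)" if a: "a \<in> Obj C"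
  proof -
    have closed: "\<zero>\<^bsub>ob M a\<^esub> \<in> N' a" "\<lbrakk>x \<in> N' a; y \<in> N' a\<rbrakk> \<Longrightarrow> x \<oplus>\<^bsub>ob M a\<^esub> y \<in> N' a"
      "\<lbrakk>c \<in> carrier k; x \<in> N' a\<rbrakk> \<Longrightarrow> c \<odot>\<^bsub>ob M a\<^esub> x \<in> N' a" if "N' \<in> ?F" for N' c x y
    proof -
      have "submodule (N' a) k (ob (sub_catmod M N) a)"
        using that cat_submodule.sub_ob[OF _ a] by blast
      from module.submodule_closed[OF sub.ob_module[OF a] this]
      show "\<zero>\<^bsub>ob M a\<^esub> \<in> N' a" "\<lbrakk>x \<in> N' a; y \<in> N' a\<rbrakk> \<Longrightarrow> x \<oplus>\<^bsub>ob M a\<^esub> y \<in> N' a"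
        "\<lbrakk>c \<in> carrier k; x \<in> N' a\<rbrakk> \<Longrightarrow> c \<odot>\<^bsub>ob M a\<^esub> x \<in> N' a"
        by (auto simp: sub_catmod_def)
    qed
    show ?thesis
      using sub[of a] module.submodule_closed(1)[OF ob_module[OF a] sub_ob[OF a]] closed
      by (intro module.submoduleI'[OF ob_module[OF a]]) (auto simp: gen)
  qed
  show "mor M a b f x \<in> gen b" if "a \<in> Obj C" "b \<in> Obj C" "f \<in> Hom C a b" "x \<in> gen a"
  proof -
    have "mor M a b f x \<in> N' b" if N': "N' \<in> ?F" for N'
      using cat_submodule.sub_mor[of C k "sub_catmod M N" N' a b f] N' \<open>a \<in> Obj C\<close> \<open>b \<in> Obj C\<close>
        \<open>f \<in> Hom C a b\<close> \<open>x \<in> gen a\<close> by (auto simp: gen sub_catmod_def)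
    then show ?thesis by (simp add: gen)
  qed
qed

text \<open>
  The elements \<open>e a x\<close> play the role of the monomials of a polynomial ring, \<open>lt\<close> that of a monomial
  order, and \<open>le\<close> that of divisibility: if \<open>x\<close> divides \<open>y\<close>, some morphism sends the monomial \<open>x\<close> to
  \<open>y\<close> and smaller monomials to smaller ones. The assumption \<open>le_good\<close> is the analogue of Dickson's
  lemma.
\<close>

locale leading_terms = cat_module C k M
  for C :: "('o, 'a) cat" and k :: "'k ring" and M :: "('o, 'a, 'k, 'm) catmod" +
  fixes X :: "'o \<Rightarrow> 'i set" and e :: "'o \<Rightarrow> 'i \<Rightarrow> 'm"
    and lt :: "'o \<Rightarrow> 'i \<Rightarrow> 'i \<Rightarrow> bool" and le :: "'o \<times> 'i \<Rightarrow> 'o \<times> 'i \<Rightarrow> bool"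
  assumes noetherian: "noetherian_ring k"
    and fin: "a \<in> Obj C \<Longrightarrow> finite (X a)"
    and e_closed: "\<lbrakk>a \<in> Obj C; x \<in> X a\<rbrakk> \<Longrightarrow> e a x \<in> carrier (ob M a)"
    and e_spans: "a \<in> Obj C \<Longrightarrow> carrier (ob M a) \<subseteq> lin_span k (ob M a) (e a ` X a)"
    and lt_irrefl: "\<not> lt a x x"
    and lt_trans: "\<lbrakk>lt a x y; lt a y z\<rbrakk> \<Longrightarrow> lt a x z"
    and lt_total: "\<lbrakk>a \<in> Obj C; x \<in> X a; y \<in> X a\<rbrakk> \<Longrightarrow> lt a x y \<or> x = y \<or> lt a y x"
    and le_mor: "\<lbrakk>a \<in> Obj C; b \<in> Obj C; x \<in> X a; y \<in> X b; le (a, x) (b, y)\<rbrakk> \<Longrightarrow>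
      \<exists>g\<in>Hom C a b. mor M a b g (e a x) = e b y \<and>
        (\<forall>z\<in>X a. lt a z x \<longrightarrow> (\<exists>z'\<in>X b. lt b z' y \<and> mor M a b g (e a z) = e b z'))"
    and le_good: "(\<And>i::nat. s i \<in> Sigma (Obj C) X) \<Longrightarrow> \<exists>i j. i < j \<and> le (s i) (s j)"
begin

definition below :: "'o \<Rightarrow> 'i \<Rightarrow> 'm set"
  where "below a x = lin_span k (ob M a) (e a ` {z \<in> X a. lt a z x})"

lemma below_submodule: "a \<in> Obj C \<Longrightarrow> submodule (below a x) k (ob M a)"
  unfolding below_def using e_closed
  by (intro module.lin_span_submodule ob_module) auto

definition rank :: "'o \<Rightarrow> 'i \<Rightarrow> nat"
  where "rank a x = card {z \<in> X a. lt a z x}"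

lemma rank_less: "\<lbrakk>a \<in> Obj C; x \<in> X a; lt a x y\<rbrakk> \<Longrightarrow> rank a x < rank a y"
  unfolding rank_def using fin lt_irrefl[of a x] lt_trans[of a _ x y]
  by (intro psubset_card_mono) auto

lemma exists_leading_term:
  assumes a: "a \<in> Obj C" and Y: "Y \<subseteq> X a"
    and f: "f \<in> lin_span k (ob M a) (e a ` Y)" "f \<noteq> \<zero>\<^bsub>ob M a\<^esub>"
  shows "\<exists>x\<in>Y. \<exists>c\<in>carrier k. \<exists>s\<in>below a x. f = c \<odot>\<^bsub>ob M a\<^esub> e a x \<oplus>\<^bsub>ob M a\<^esub> s"
proof -
  interpret V: Module.module k "ob M a" by (rule ob_module[OF a])
  note rank = rank_less[OF a]
  have finY: "finite Y" using finite_subset[OF Y fin[OF a]] .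
  have "Y \<noteq> {}"
  proof
    assume "Y = {}"
    with f(1) have "f \<in> lin_span k (ob M a) {}" by simp
    then show False using f(2) by cases auto
  qed
  with finY have "Max (rank a ` Y) \<in> rank a ` Y" by (intro Max_in) auto
  then obtain x where "x \<in> Y" "Max (rank a ` Y) = rank a x" by blast
  then have x: "x \<in> Y" "\<And>y. y \<in> Y \<Longrightarrow> rank a y \<le> rank a x"
    using finY by (metis Max_ge finite_imageI imageI)+
  have "Y \<subseteq> insert x {z \<in> X a. lt a z x}"
  proof
    fix z assume z: "z \<in> Y"
    have "\<not> lt a x z"
    proof
      assume "lt a x z"
      with rank[of x z] x(1) Y have "rank a x < rank a z" by blast
      with x(2)[OF z] show False by simp
    qed
    with lt_total[OF a, of z x] x(1) z Y show "z \<in> insert x {z \<in> X a. lt a z x}" by blast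
  qed
  then have "e a ` Y \<subseteq> insert (e a x) (e a ` {z \<in> X a. lt a z x})" by blast
  with V.lin_span_mono f(1)
  have "f \<in> lin_span k (ob M a) (insert (e a x) (e a ` {z \<in> X a. lt a z x}))" by blast
  then show ?thesis
    using V.lin_span_insert[of "e a x" "e a ` {z \<in> X a. lt a z x}" f] e_closed[OF a] x(1) Y
    unfolding below_def by blast
qed

text \<open>
  An element of \<open>D\<close> whose leading monomial \<open>x\<close> is least possible. Elements of \<open>D\<close> that involve only
  monomials below \<open>x\<close> would have a smaller leading monomial.
\<close>

lemma minimal_leading_term:
  assumes a: "a \<in> Obj C" and f: "f \<in> carrier (ob M a)" "f \<in> D" and D: "\<zero>\<^bsub>ob M a\<^esub> \<notin> D"
  shows "\<exists>x\<in>X a. \<exists>f\<in>D. \<exists>c\<in>carrier k. \<exists>s\<in>below a x.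
    f = c \<odot>\<^bsub>ob M a\<^esub> e a x \<oplus>\<^bsub>ob M a\<^esub> s \<and> D \<inter> below a x = {}"
proof -
  let ?Q = "\<lambda>x. x \<in> X a \<and>
    (\<exists>f\<in>D. \<exists>c\<in>carrier k. \<exists>s\<in>below a x. f = c \<odot>\<^bsub>ob M a\<^esub> e a x \<oplus>\<^bsub>ob M a\<^esub> s)"
  note rank = rank_less[OF a]
  have "f \<in> lin_span k (ob M a) (e a ` X a)" "f \<noteq> \<zero>\<^bsub>ob M a\<^esub>"
    using e_spans[OF a] f D by auto
  then obtain x0 where "?Q x0"
    using exists_leading_term[OF a order_refl] f(2) by blast
  then obtain x where x: "?Q x" "\<And>y. ?Q y \<Longrightarrow> rank a x \<le> rank a y"
    using arg_min_natI[of ?Q x0 "rank a"] arg_min_nat_le[of ?Q _ "rank a"] by blast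
  have "g \<notin> below a x" if g: "g \<in> D" for g
  proof
    assume "g \<in> below a x"
    moreover have "g \<noteq> \<zero>\<^bsub>ob M a\<^esub>" using g D by auto
    ultimately obtain y where y: "y \<in> X a" "lt a y x" "?Q y"
      using exists_leading_term[OF a, of "{z \<in> X a. lt a z x}" g] g unfolding below_def by blast
    then show False using rank[of y x] x(2)[of y] by simp
  qed
  then show ?thesis using x(1) by blast
qed

text \<open>
  If \<open>N\<close> is not finitely generated, there are elements \<open>f\<^sub>0, f\<^sub>1, \<dots>\<close> of \<open>N\<close> such that \<open>f\<^sub>n\<close> has the
  least possible leading monomial among the elements over the same object that lie outside of the
  submodule generated by \<open>f\<^sub>0, \<dots>, f\<^sub>n\<^sub>-\<^sub>1\<close>. Along a subsequence the leading monomials divide each other, and as the coefficient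
  ring is Noetherian, some leading coefficient lies in the ideal generated by the earlier ones. Hence
  a combination of translates of earlier elements has the same leading term as \<open>f\<^sub>n\<close>, and subtracting
  it contradicts the choice of \<open>f\<^sub>n\<close>.
\<close>

theorem submodule_finitely_generated:
  assumes N: "cat_submodule C k M N"
  shows "finitely_generated C k (sub_catmod M N)"
proof (rule ccontr)
  assume not_fg: "\<not> ?thesis"
  interpret cat_submodule C k M N by fact
  interpret k: noetherian_ring k by (rule noetherian)
  let ?gen = "generated_submodule C k (sub_catmod M N)"
  let ?ok = "\<lambda>G. finite G \<and> (\<forall>(b, x)\<in>G. b \<in> Obj C \<and> x \<in> N b)"
  let ?lead = "\<lambda>a x c f. \<exists>s\<in>below a x. f = c \<odot>\<^bsub>ob M a\<^esub> e a x \<oplus>\<^bsub>ob M a\<^esub> s"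
  let ?P = "\<lambda>G (a, x, c, f). a \<in> Obj C \<and> x \<in> X a \<and> c \<in> carrier k \<and> f \<in> N a - ?gen G a \<and>
    ?lead a x c f \<and> (N a - ?gen G a) \<inter> below a x = {}"
  have gens: "\<forall>(b, x)\<in>G. x \<in> N b" if "?ok G" for G using that by auto
  have new: "\<exists>t. ?P G t" if G: "?ok G" for G
  proof -
    have "\<not> (\<forall>a\<in>Obj C. ?gen G a = N a)"
      using not_fg G unfolding finitely_generated_def by (auto simp: sub_catmod_def)
    then obtain a where a: "a \<in> Obj C" "?gen G a \<noteq> N a" by blast
    note gen = generated_in_sub_catmod[OF N gens[OF G]]
    obtain f where f: "f \<in> N a - ?gen G a" using gen(1)[OF a(1)] a(2) by blast
    have "f \<in> carrier (ob M a)"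
      using f module.submodule_closed(1)[OF ob_module sub_ob, OF a(1) a(1)] by blast
    moreover have "\<zero>\<^bsub>ob M a\<^esub> \<notin> N a - ?gen G a"
      using module.submodule_closed(2)[OF ob_module gen(2), OF a(1) a(1)] by blast
    ultimately obtain x g c s where "x \<in> X a" "g \<in> N a - ?gen G a" "c \<in> carrier k"
      "s \<in> below a x" "g = c \<odot>\<^bsub>ob M a\<^esub> e a x \<oplus>\<^bsub>ob M a\<^esub> s" "(N a - ?gen G a) \<inter> below a x = {}"
      using minimal_leading_term[OF a(1) _ f] by blast
    then have "?P G (a, x, c, g)" using a(1) by blast
    then show ?thesis by blast
  qed
  define pick where "pick G = (SOME t. ?P G t)" for G
  have pick: "?P G (pick G)" if "?ok G" for G unfolding pick_def using someI_ex[OF new[OF that]] .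
  define add where "add G = (case pick G of (a, x, c, f) \<Rightarrow> insert (a, f) G)" for G
  define Gs where "Gs n = (add ^^ n) {}" for n
  have Gs_Suc: "Gs (Suc n) = add (Gs n)" for n by (simp add: Gs_def)
  have ok: "?ok (Gs n)" for n
  proof (induction n)
    case (Suc n)
    obtain a x c f where t: "pick (Gs n) = (a, x, c, f)" by (metis prod_cases4)
    show ?case using pick[OF Suc] Suc unfolding Gs_Suc add_def t by auto
  qed (simp add: Gs_def)
  define a x c f where "a n = fst (pick (Gs n))" and "x n = fst (snd (pick (Gs n)))"
    and "c n = fst (snd (snd (pick (Gs n))))" and "f n = snd (snd (snd (pick (Gs n))))" for n
  have t: "pick (Gs n) = (a n, x n, c n, f n)" for n by (simp add: a_def x_def c_def f_def)
  have P: "?P (Gs n) (a n, x n, c n, f n)" for n using pick[OF ok[of n]] unfolding t .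
  have in_Gs: "(a i, f i) \<in> Gs n" if "i < n" for i n
    using that
  proof (induction n)
    case (Suc n)
    then show ?case unfolding Gs_Suc add_def t by (auto simp: less_Suc_eq)
  qed simp
  have good: "\<exists>i j. i < j \<and> le (a (r i), x (r i)) (a (r j), x (r j))" for r :: "nat \<Rightarrow> nat"
    using P by (intro le_good) auto
  obtain r :: "nat \<Rightarrow> nat" where r: "strict_mono r"
      "\<And>i j. i < j \<Longrightarrow> le (a (r i), x (r i)) (a (r j), x (r j))"
    using ascending_subsequence[of le "\<lambda>i. (a i, x i)"] good by blast
  have c: "c n \<in> carrier k" for n using P[of n] by simp
  obtain m where m: "c (r m) \<in> Idl\<^bsub>k\<^esub> ((\<lambda>i. c (r i)) ` {..<m})"
    using k.sequence_in_earlier_ideal[of "\<lambda>i. c (r i)"] c by blast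
  define b y G where "b = a (r m)" and "y = x (r m)" and "G = Gs (r m)"
  have Pm: "b \<in> Obj C" "y \<in> X b" "f (r m) \<in> N b - ?gen G b" "?lead b y (c (r m)) (f (r m))"
    "(N b - ?gen G b) \<inter> below b y = {}"
    using P[of "r m"] unfolding b_def y_def G_def by simp_all
  interpret V: Module.module k "ob M b" by (rule ob_module[OF Pm(1)])
  note gen = generated_in_sub_catmod[OF N gens[OF ok[of "r m"], folded G_def]]
  note gen_b = V.submodule_closed[OF gen(2)[OF Pm(1)]]
  note below_b = V.submodule_closed[OF below_submodule[OF Pm(1), of y]]
  have ey: "e b y \<in> carrier (ob M b)" using e_closed[OF Pm(1,2)] .
  \<comment> \<open>the leading coefficients at \<open>y\<close> of elements generated by the predecessors of \<open>f (r m)\<close>\<close>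
  define L where "L = {d \<in> carrier k. \<exists>g\<in>?gen G b. ?lead b y d g}"
  have L_add: "d \<oplus>\<^bsub>k\<^esub> d' \<in> L" if "d \<in> L" "d' \<in> L" for d d'
  proof -
    from that obtain g g' s s' where g: "g \<in> ?gen G b" "g' \<in> ?gen G b" "s \<in> below b y" "s' \<in> below b y"
      "g = d \<odot>\<^bsub>ob M b\<^esub> e b y \<oplus>\<^bsub>ob M b\<^esub> s" "g' = d' \<odot>\<^bsub>ob M b\<^esub> e b y \<oplus>\<^bsub>ob M b\<^esub> s'"
      and d: "d \<in> carrier k" "d' \<in> carrier k" unfolding L_def by blast
    have s: "s \<in> carrier (ob M b)" "s' \<in> carrier (ob M b)" using g(3,4) below_b(1) by auto
    have "g \<oplus>\<^bsub>ob M b\<^esub> g' = (d \<oplus>\<^bsub>k\<^esub> d') \<odot>\<^bsub>ob M b\<^esub> e b y \<oplus>\<^bsub>ob M b\<^esub> (s \<oplus>\<^bsub>ob M b\<^esub> s')"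
      unfolding g(5,6) using s ey d by (simp add: V.smult_l_distr V.M.a_ac)
    then show ?thesis
      unfolding L_def using gen_b(3)[OF g(1,2)] below_b(3)[OF g(3,4)] d by auto
  qed
  have L_mult: "d' \<otimes>\<^bsub>k\<^esub> d \<in> L" if "d \<in> L" and d': "d' \<in> carrier k" for d d'
  proof -
    from that obtain g s where g: "g \<in> ?gen G b" "s \<in> below b y"
      "g = d \<odot>\<^bsub>ob M b\<^esub> e b y \<oplus>\<^bsub>ob M b\<^esub> s" and d: "d \<in> carrier k" unfolding L_def by blast
    have s: "s \<in> carrier (ob M b)" using g(2) below_b(1) by auto
    have "d' \<odot>\<^bsub>ob M b\<^esub> g = (d' \<otimes>\<^bsub>k\<^esub> d) \<odot>\<^bsub>ob M b\<^esub> e b y \<oplus>\<^bsub>ob M b\<^esub> (d' \<odot>\<^bsub>ob M b\<^esub> s)"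
      unfolding g(3) using s ey d d' by (simp add: V.smult_r_distr V.smult_assoc1)
    then show ?thesis
      unfolding L_def using gen_b(4)[OF d' g(1)] below_b(4)[OF d' g(2)] d d' by auto
  qed
  have L_zero: "\<zero>\<^bsub>k\<^esub> \<in> L"
    unfolding L_def using gen_b(2) below_b(2) ey by force
  have L_ideal: "ideal L k"
  proof (rule idealI)
    show "ring k" by (rule k.ring_axioms)
    show "subgroup L (add_monoid k)"
    proof (rule k.add.subgroupI)
      show "L \<subseteq> carrier k" by (auto simp: L_def)
      show "L \<noteq> {}" using L_zero by blast
      show "\<ominus>\<^bsub>k\<^esub> d \<in> L" if "d \<in> L" for d
        using L_mult[OF that, of "\<ominus>\<^bsub>k\<^esub> \<one>\<^bsub>k\<^esub>"] that by (simp add: L_def k.l_minus)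
    qed (use L_add in auto)
    fix d d' assume "d \<in> L" "d' \<in> carrier k"
    then show "d' \<otimes>\<^bsub>k\<^esub> d \<in> L" "d \<otimes>\<^bsub>k\<^esub> d' \<in> L"
      using L_mult[of d d'] V.R.m_comm[of d d'] by (auto simp: L_def)
  qed
  have "c (r i) \<in> L" if i: "i < m" for i
  proof -
    let ?a = "a (r i)" and ?x = "x (r i)"
    obtain s where Pi: "?a \<in> Obj C" "?x \<in> X ?a" "s \<in> below ?a ?x"
      "f (r i) = c (r i) \<odot>\<^bsub>ob M ?a\<^esub> e ?a ?x \<oplus>\<^bsub>ob M ?a\<^esub> s"
      using P[of "r i"] by auto
    obtain g where g: "g \<in> Hom C ?a b" "mor M ?a b g (e ?a ?x) = e b y"
      "\<And>z. \<lbrakk>z \<in> X ?a; lt ?a z ?x\<rbrakk> \<Longrightarrow> \<exists>z'\<in>X b. lt b z' y \<and> mor M ?a b g (e ?a z) = e b z'"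
      using le_mor[OF Pi(1) Pm(1) Pi(2) Pm(2)] r(2)[OF i] unfolding b_def y_def by blast
    interpret A: Module.module k "ob M ?a" by (rule ob_module[OF Pi(1)])
    note lin = mor_linear[OF Pi(1) Pm(1) g(1)]
    have s: "s \<in> carrier (ob M ?a)"
      using A.submodule_closed(1)[OF below_submodule[OF Pi(1)]] Pi(3) by blast
    have "mor M ?a b g (f (r i)) = c (r i) \<odot>\<^bsub>ob M b\<^esub> e b y \<oplus>\<^bsub>ob M b\<^esub> mor M ?a b g s"
      unfolding Pi(4) using A.linear_mapsD[OF lin] s e_closed[OF Pi(1,2)] c g(2) by simp
    moreover have "mor M ?a b g s \<in> below b y"
      unfolding below_def
    proof (rule A.linear_maps_lin_span[OF lin V.module_axioms])
      show "e ?a ` {z \<in> X ?a. lt ?a z ?x} \<subseteq> carrier (ob M ?a)" using e_closed[OF Pi(1)] by auto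
      show "mor M ?a b g ` (e ?a ` {z \<in> X ?a. lt ?a z ?x}) \<subseteq> e b ` {z \<in> X b. lt b z y}"
      proof (intro subsetI, elim imageE)
        fix w v z assume "w = mor M ?a b g v" "v = e ?a z" "z \<in> {z \<in> X ?a. lt ?a z ?x}"
        then show "w \<in> e b ` {z \<in> X b. lt b z y}" using g(3)[of z] by auto
      qed
      show "s \<in> lin_span k (ob M ?a) (e ?a ` {z \<in> X ?a. lt ?a z ?x})"
        using Pi(3) unfolding below_def .
    qed
    moreover have "mor M ?a b g (f (r i)) \<in> ?gen G b"
      using gen(4)[OF Pi(1) Pm(1) g(1)] gen(3) in_Gs[OF strict_monoD[OF r(1) i]]
      unfolding G_def by blast
    ultimately show ?thesis unfolding L_def using c by blast
  qed
  then have "(\<lambda>i. c (r i)) ` {..<m} \<subseteq> L" by auto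
  then have "c (r m) \<in> L" using k.genideal_minimal[OF L_ideal] m by blast
  then obtain g s where g: "g \<in> ?gen G b" "s \<in> below b y"
      "g = c (r m) \<odot>\<^bsub>ob M b\<^esub> e b y \<oplus>\<^bsub>ob M b\<^esub> s"
    unfolding L_def by blast
  obtain s' where g': "s' \<in> below b y" "f (r m) = c (r m) \<odot>\<^bsub>ob M b\<^esub> e b y \<oplus>\<^bsub>ob M b\<^esub> s'"
    using Pm(4) by blast
  have s: "s \<in> carrier (ob M b)" "s' \<in> carrier (ob M b)" using g(2) g'(1) below_b(1) by auto
  have gN: "g \<in> N b" "g \<in> carrier (ob M b)" using g(1) gen(1)[OF Pm(1)] gen_b(1) by auto
  have fN: "f (r m) \<in> N b" "f (r m) \<in> carrier (ob M b)"
    using Pm(3) V.submodule_closed(1)[OF sub_ob[OF Pm(1)]] by auto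
  have diff: "f (r m) = g \<oplus>\<^bsub>ob M b\<^esub> (s' \<ominus>\<^bsub>ob M b\<^esub> s)"
    unfolding g(3) g'(2) a_minus_def using s ey c[of "r m"]
    by (simp add: V.M.a_ac V.M.r_neg1 V.M.r_neg2)
  have "d = (g \<oplus>\<^bsub>ob M b\<^esub> d) \<ominus>\<^bsub>ob M b\<^esub> g" if "d \<in> carrier (ob M b)" for d
    using that gN(2) by (simp add: a_minus_def V.M.a_comm[of g d] V.M.a_assoc V.M.r_neg)
  from this[of "s' \<ominus>\<^bsub>ob M b\<^esub> s"]
  have "s' \<ominus>\<^bsub>ob M b\<^esub> s = f (r m) \<ominus>\<^bsub>ob M b\<^esub> g" using s diff by simp
  then have "s' \<ominus>\<^bsub>ob M b\<^esub> s \<in> N b"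
    using V.submodule_closed(6)[OF sub_ob[OF Pm(1)] fN(1) gN(1)] by simp
  moreover have "s' \<ominus>\<^bsub>ob M b\<^esub> s \<notin> ?gen G b"
  proof
    assume "s' \<ominus>\<^bsub>ob M b\<^esub> s \<in> ?gen G b"
    from gen_b(3)[OF g(1) this] show False using diff Pm(3) by simp
  qed
  ultimately show False using Pm(5) below_b(6)[OF g'(1) g(2)] by blast
qed

end

section \<open>Free complements and retractions\<close>

context Module.module
begin

lemma smult_finsum:
  assumes "finite A" "a \<in> A \<rightarrow> carrier R" "A \<subseteq> carrier M"
  shows "(\<Oplus>\<^bsub>M\<^esub>v\<in>A. a v \<odot>\<^bsub>M\<^esub> v) \<in> lin_span R M A"
  using assms
proof (induction A)
  case empty
  then show ?case by (simp add: lin_span.zero)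
next
  case (insert b A)
  have "(\<Oplus>\<^bsub>M\<^esub>v\<in>insert b A. a v \<odot>\<^bsub>M\<^esub> v) = a b \<odot>\<^bsub>M\<^esub> b \<oplus>\<^bsub>M\<^esub> (\<Oplus>\<^bsub>M\<^esub>v\<in>A. a v \<odot>\<^bsub>M\<^esub> v)"
    using insert by (intro M.finsum_insert) (auto simp: Pi_iff)
  moreover have "(\<Oplus>\<^bsub>M\<^esub>v\<in>A. a v \<odot>\<^bsub>M\<^esub> v) \<in> lin_span R M (insert b A)"
    using insert lin_span_mono[of A "insert b A"] by auto
  ultimately show ?case using insert.prems by (auto intro: lin_span.step)
qed

lemma lin_span_as_finsum:
  assumes B: "B \<subseteq> carrier M" and "x \<in> lin_span R M B"
  shows "\<exists>A a. finite A \<and> A \<subseteq> B \<and> a \<in> A \<rightarrow> carrier R \<and> x = (\<Oplus>\<^bsub>M\<^esub>v\<in>A. a v \<odot>\<^bsub>M\<^esub> v)"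
  using assms(2)
proof induction
  case zero
  then show ?case by (intro exI[of _ "{}"]) auto
next
  case (step c b s)
  then obtain A a where A: "finite A" "A \<subseteq> B" "a \<in> A \<rightarrow> carrier R"
    "s = (\<Oplus>\<^bsub>M\<^esub>v\<in>A. a v \<odot>\<^bsub>M\<^esub> v)" by blast
  define d where "d = (if b \<in> A then a b else \<zero>\<^bsub>R\<^esub>)"
  let ?a = "a(b := c \<oplus>\<^bsub>R\<^esub> d)"
  have d: "d \<in> carrier R" using A(3) by (auto simp: d_def)
  have b: "b \<in> carrier M" using step B by auto
  have cl: "a v \<odot>\<^bsub>M\<^esub> v \<in> carrier M" if "v \<in> A" for v using that A B by auto
  let ?rest = "\<Oplus>\<^bsub>M\<^esub>v\<in>A - {b}. a v \<odot>\<^bsub>M\<^esub> v"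
  have rest: "?rest \<in> carrier M" using cl by auto
  have "s = d \<odot>\<^bsub>M\<^esub> b \<oplus>\<^bsub>M\<^esub> ?rest"
  proof (cases "b \<in> A")
    case True
    then have "A = insert b (A - {b})" by auto
    then have "s = (\<Oplus>\<^bsub>M\<^esub>v\<in>insert b (A - {b}). a v \<odot>\<^bsub>M\<^esub> v)" using A(4) by simp
    also have "\<dots> = a b \<odot>\<^bsub>M\<^esub> b \<oplus>\<^bsub>M\<^esub> ?rest"
      using A(1) cl True by (intro M.finsum_insert) auto
    finally show ?thesis using True by (simp add: d_def)
  next
    case False
    then show ?thesis using A(4) b rest by (simp add: d_def)
  qed
  then have "c \<odot>\<^bsub>M\<^esub> b \<oplus>\<^bsub>M\<^esub> s = (c \<oplus>\<^bsub>R\<^esub> d) \<odot>\<^bsub>M\<^esub> b \<oplus>\<^bsub>M\<^esub> ?rest"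
    using step(1) d b rest by (simp add: smult_l_distr M.a_assoc)
  also have "?rest = (\<Oplus>\<^bsub>M\<^esub>v\<in>A - {b}. ?a v \<odot>\<^bsub>M\<^esub> v)"
    using cl by (intro M.finsum_cong') auto
  also have "(c \<oplus>\<^bsub>R\<^esub> d) \<odot>\<^bsub>M\<^esub> b \<oplus>\<^bsub>M\<^esub> \<dots> = (\<Oplus>\<^bsub>M\<^esub>v\<in>insert b (A - {b}). ?a v \<odot>\<^bsub>M\<^esub> v)"
    using A(1) cl step(1) d b by (subst M.finsum_insert) auto
  finally have "c \<odot>\<^bsub>M\<^esub> b \<oplus>\<^bsub>M\<^esub> s = (\<Oplus>\<^bsub>M\<^esub>v\<in>insert b A. ?a v \<odot>\<^bsub>M\<^esub> v)" by simp
  then show ?case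
    using A step(1,2) d by (intro exI[of _ "insert b A"] exI[of _ ?a]) auto
qed

lemma finsum_in_submodule:
  assumes C: "submodule C R M" and f: "f \<in> A \<rightarrow> C"
  shows "(\<Oplus>\<^bsub>M\<lparr>carrier := C\<rparr>\<^esub>v\<in>A. f v) = (\<Oplus>\<^bsub>M\<^esub>v\<in>A. f v)"
proof -
  interpret C: Module.module R "M\<lparr>carrier := C\<rparr>"
    using submodule.submodule_is_module[OF C module_axioms] .
  show ?thesis
    using f
  proof (induction A rule: infinite_finite_induct)
    case (insert b A)
    have "(\<Oplus>\<^bsub>M\<lparr>carrier := C\<rparr>\<^esub>v\<in>insert b A. f v) = f b \<oplus>\<^bsub>M\<^esub> (\<Oplus>\<^bsub>M\<lparr>carrier := C\<rparr>\<^esub>v\<in>A. f v)"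
      using C.M.finsum_insert[OF insert(1,2), of f] insert(4) by auto
    moreover have "(\<Oplus>\<^bsub>M\<^esub>v\<in>insert b A. f v) = f b \<oplus>\<^bsub>M\<^esub> (\<Oplus>\<^bsub>M\<^esub>v\<in>A. f v)"
      using insert submodule_closed(1)[OF C] by (intro M.finsum_insert) auto
    ultimately show ?case using insert by auto
  next
    case (infinite A)
    then show ?case by (simp add: finsum_def finprod_def)
  next
    case empty
    show ?case using C.M.finsum_empty[of f] M.finsum_empty[of f] by simp
  qed
qed

text \<open>
  Sums in a submodule agree with sums in \<open>M\<close>, so a basis of a submodule can be recognised in \<open>M\<close>.
\<close>

lemma free_submodule_iff:
  assumes C: "submodule C R M"
  shows "free_module R (M\<lparr>carrier := C\<rparr>) \<longleftrightarrow>
    (\<exists>B\<subseteq>C. lin_indep R M B \<and> C \<subseteq> lin_span R M B)"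
proof -
  note C' = submodule_closed[OF C]
  have sum: "(\<Oplus>\<^bsub>M\<lparr>carrier := C\<rparr>\<^esub>v\<in>A. a v \<odot>\<^bsub>M\<^esub> v) = (\<Oplus>\<^bsub>M\<^esub>v\<in>A. a v \<odot>\<^bsub>M\<^esub> v)"
    if "A \<subseteq> C" "a \<in> A \<rightarrow> carrier R" for A a
  proof (rule finsum_in_submodule[OF C], rule Pi_I)
    fix v assume "v \<in> A"
    then have "a v \<in> carrier R" "v \<in> C" using that by auto
    then show "a v \<odot>\<^bsub>M\<^esub> v \<in> C" by (rule C'(4))
  qed
  have "lin_indep R (M\<lparr>carrier := C\<rparr>) B \<longleftrightarrow> lin_indep R M B" if "B \<subseteq> C" for B
    unfolding lin_indep_def using sum that by (auto 0 3 simp: subset_trans)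
  moreover have "spanning R (M\<lparr>carrier := C\<rparr>) B \<longleftrightarrow> C \<subseteq> lin_span R M B" if B: "B \<subseteq> C" for B
  proof
    assume sp: "spanning R (M\<lparr>carrier := C\<rparr>) B"
    show "C \<subseteq> lin_span R M B"
    proof
      fix x assume "x \<in> C"
      then obtain A a where A: "finite A" "A \<subseteq> B" "a \<in> A \<rightarrow> carrier R"
        "x = (\<Oplus>\<^bsub>M\<lparr>carrier := C\<rparr>\<^esub>v\<in>A. a v \<odot>\<^bsub>M\<^esub> v)"
        using sp unfolding spanning_def by auto
      then show "x \<in> lin_span R M B"
        using sum[of A a] smult_finsum[of A a] lin_span_mono[of A B] B C'(1) by auto
    qed
  next
    assume sp: "C \<subseteq> lin_span R M B"
    show "spanning R (M\<lparr>carrier := C\<rparr>) B"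
      unfolding spanning_def
    proof
      fix x assume "x \<in> carrier (M\<lparr>carrier := C\<rparr>)"
      then obtain A a where A: "finite A" "A \<subseteq> B" "a \<in> A \<rightarrow> carrier R"
        "x = (\<Oplus>\<^bsub>M\<^esub>v\<in>A. a v \<odot>\<^bsub>M\<^esub> v)"
        using lin_span_as_finsum[OF subset_trans[OF B C'(1)], of x] sp by auto
      then show "\<exists>A a. finite A \<and> A \<subseteq> B \<and> a \<in> A \<rightarrow> carrier R \<and>
          x = (\<Oplus>\<^bsub>M\<lparr>carrier := C\<rparr>\<^esub>v\<in>A. a v \<odot>\<^bsub>M\<lparr>carrier := C\<rparr>\<^esub> v)"
        using sum[of A a] B by (intro exI[of _ A] exI[of _ a]) auto
    qed
  qed
  ultimately show ?thesis
    using submodule.submodule_is_module[OF C module_axioms]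
    unfolding free_module_def by auto
qed

lemma linear_maps_finsum:
  assumes T: "T \<in> linear_maps R M W" and W: "Module.module R W" and f: "f \<in> A \<rightarrow> carrier M"
  shows "T (\<Oplus>\<^bsub>M\<^esub>v\<in>A. f v) = (\<Oplus>\<^bsub>W\<^esub>v\<in>A. T (f v))"
proof -
  interpret W: Module.module R W by fact
  show ?thesis
    using f
  proof (induction A rule: infinite_finite_induct)
    case (insert b A)
    have "T (\<Oplus>\<^bsub>M\<^esub>v\<in>insert b A. f v) = T (f b \<oplus>\<^bsub>M\<^esub> (\<Oplus>\<^bsub>M\<^esub>v\<in>A. f v))"
      using insert by (subst M.finsum_insert) auto
    also have "\<dots> = T (f b) \<oplus>\<^bsub>W\<^esub> (\<Oplus>\<^bsub>W\<^esub>v\<in>A. T (f v))"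
      using insert linear_mapsD[OF T] by auto
    also have "\<dots> = (\<Oplus>\<^bsub>W\<^esub>v\<in>insert b A. T (f v))"
      using insert linear_mapsD(1)[OF T] by (subst W.M.finsum_insert) (auto simp: Pi_iff)
    finally show ?case .
  qed (use linear_maps_zero[OF T W] in auto)
qed

end

text \<open>
  The projection onto the source of a morphism along its complement. The complement is the kernel of
  the retraction, and retractions compose contravariantly, so pairs of an injection and a retraction
  describe the category VIC without sums of subsets.
\<close>

definition retraction ::
  "('r, 'v, 'y) module_scheme \<Rightarrow> ('r, 'w, 'z) module_scheme \<Rightarrow> ('v \<Rightarrow> 'w) \<times> 'w set \<Rightarrow> 'w \<Rightarrow> 'v"
  where "retraction V W \<phi> x = (THE v. v \<in> carrier V \<and> x \<ominus>\<^bsub>W\<^esub> fst \<phi> v \<in> snd \<phi>)"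

locale module_pair = V: Module.module R V + W: Module.module R W
  for R :: "('r, 'x) ring_scheme" and V :: "('r, 'v, 'y) module_scheme"
    and W :: "('r, 'w, 'z) module_scheme"
begin

lemma vic_homD:
  assumes "(f, C) \<in> vic_hom R V W"
  shows "f \<in> linear_maps R V W" "f \<in> extensional (carrier V)" "inj_on f (carrier V)"
    "submodule C R W" "free_module R (W\<lparr>carrier := C\<rparr>)"
    "x \<in> carrier W \<Longrightarrow> \<exists>v\<in>carrier V. \<exists>c\<in>C. x = f v \<oplus>\<^bsub>W\<^esub> c"
    "\<lbrakk>v \<in> carrier V; f v \<in> C\<rbrakk> \<Longrightarrow> f v = \<zero>\<^bsub>W\<^esub>"
proof -
  show "\<exists>v\<in>carrier V. \<exists>c\<in>C. x = f v \<oplus>\<^bsub>W\<^esub> c" if "x \<in> carrier W"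
  proof -
    have "x \<in> f ` carrier V <+>\<^bsub>W\<^esub> C" using assms that unfolding vic_hom_def by auto
    then show ?thesis unfolding set_add_def' by blast
  qed
qed (use assms in \<open>auto simp: vic_hom_def\<close>)

lemma W_cancel:
  assumes "u \<in> carrier W" "c \<in> carrier W"
  shows "(u \<oplus>\<^bsub>W\<^esub> c) \<ominus>\<^bsub>W\<^esub> u = c" "u \<oplus>\<^bsub>W\<^esub> (c \<ominus>\<^bsub>W\<^esub> u) = c"
  using assms by (simp_all add: a_minus_def W.M.a_comm[of u] W.M.a_assoc W.M.r_neg W.M.l_neg)

lemma retraction_unique:
  assumes \<phi>: "(f, C) \<in> vic_hom R V W" and v: "v \<in> carrier V" and c: "c \<in> C"
  shows "retraction V W (f, C) (f v \<oplus>\<^bsub>W\<^esub> c) = v"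
proof -
  note \<phi>' = vic_homD[OF \<phi>]
  note C = W.submodule_closed[OF \<phi>'(4)]
  note f = V.linear_mapsD[OF \<phi>'(1)]
  have fv: "f v \<in> carrier W" and cW: "c \<in> carrier W" using f v c C by auto
  show ?thesis
    unfolding retraction_def fst_conv snd_conv
  proof (rule the_equality)
    show "v \<in> carrier V \<and> (f v \<oplus>\<^bsub>W\<^esub> c) \<ominus>\<^bsub>W\<^esub> f v \<in> C"
      using W_cancel[OF fv cW] c v by simp
    fix u assume u: "u \<in> carrier V \<and> (f v \<oplus>\<^bsub>W\<^esub> c) \<ominus>\<^bsub>W\<^esub> f u \<in> C"
    have fu: "f u \<in> carrier W" using u f by auto
    let ?d = "(f v \<oplus>\<^bsub>W\<^esub> c) \<ominus>\<^bsub>W\<^esub> f u"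
    have "?d \<ominus>\<^bsub>W\<^esub> c \<in> C" using u c C(6) by blast
    also have "?d \<ominus>\<^bsub>W\<^esub> c = f v \<ominus>\<^bsub>W\<^esub> f u"
    proof -
      have "?d \<ominus>\<^bsub>W\<^esub> c = (c \<oplus>\<^bsub>W\<^esub> (f v \<ominus>\<^bsub>W\<^esub> f u)) \<ominus>\<^bsub>W\<^esub> c"
        using fv fu cW by (simp add: a_minus_def W.M.a_ac)
      also have "\<dots> = f v \<ominus>\<^bsub>W\<^esub> f u" using W_cancel(1)[OF cW] fv fu by simp
      finally show ?thesis .
    qed
    also have "f v \<ominus>\<^bsub>W\<^esub> f u = f (v \<ominus>\<^bsub>V\<^esub> u)"
    proof -
      have "f (\<ominus>\<^bsub>V\<^esub> u) = \<ominus>\<^bsub>W\<^esub> f u"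
        using f(3)[of "\<ominus>\<^bsub>R\<^esub> \<one>\<^bsub>R\<^esub>" u] u fu V.smult_l_minus[of "\<one>\<^bsub>R\<^esub>" u] W.smult_l_minus[of "\<one>\<^bsub>R\<^esub>" "f u"]
        by simp
      then show ?thesis using f(2)[of v "\<ominus>\<^bsub>V\<^esub> u"] u v by (simp add: a_minus_def)
    qed
    finally have "f (v \<ominus>\<^bsub>V\<^esub> u) \<in> C" .
    then have "f (v \<ominus>\<^bsub>V\<^esub> u) = f \<zero>\<^bsub>V\<^esub>"
      using \<phi>'(7)[of "v \<ominus>\<^bsub>V\<^esub> u"] v u V.linear_maps_zero[OF \<phi>'(1) W.module_axioms] by simp
    then have "v \<ominus>\<^bsub>V\<^esub> u = \<zero>\<^bsub>V\<^esub>" using inj_onD[OF \<phi>'(3)] v u by simp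
    moreover have "u \<oplus>\<^bsub>V\<^esub> (v \<ominus>\<^bsub>V\<^esub> u) = v"
      using u v by (simp add: a_minus_def V.M.a_comm[of u] V.M.a_assoc V.M.l_neg)
    ultimately show "u = v" using u by simp
  qed
qed

lemma retraction:
  assumes \<phi>: "(f, C) \<in> vic_hom R V W"
  shows "retraction V W (f, C) \<in> linear_maps R W V"
    and "v \<in> carrier V \<Longrightarrow> retraction V W (f, C) (f v) = v"
    and "x \<in> carrier W \<Longrightarrow> retraction V W (f, C) x = \<zero>\<^bsub>V\<^esub> \<longleftrightarrow> x \<in> C"
proof -
  note \<phi>' = vic_homD[OF \<phi>]
  note C = W.submodule_closed[OF \<phi>'(4)]
  note f = V.linear_mapsD[OF \<phi>'(1)]
  note u = retraction_unique[OF \<phi>]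
  show "retraction V W (f, C) \<in> linear_maps R W V"
    unfolding linear_maps_def
  proof (intro CollectI conjI ballI Pi_I)
    fix x assume "x \<in> carrier W"
    then obtain v c where x: "v \<in> carrier V" "c \<in> C" "x = f v \<oplus>\<^bsub>W\<^esub> c" using \<phi>'(6) by blast
    then show "retraction V W (f, C) x \<in> carrier V" using u by simp
    fix a assume a: "a \<in> carrier R"
    have "a \<odot>\<^bsub>W\<^esub> x = f (a \<odot>\<^bsub>V\<^esub> v) \<oplus>\<^bsub>W\<^esub> a \<odot>\<^bsub>W\<^esub> c"
      using x f a C(1) by (simp add: W.smult_r_distr subset_iff)
    then show "retraction V W (f, C) (a \<odot>\<^bsub>W\<^esub> x) = a \<odot>\<^bsub>V\<^esub> retraction V W (f, C) x"
      using u x C(4) a by simp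
  next
    fix x y assume "x \<in> carrier W" "y \<in> carrier W"
    then obtain v c w d where x: "v \<in> carrier V" "c \<in> C" "x = f v \<oplus>\<^bsub>W\<^esub> c"
      and y: "w \<in> carrier V" "d \<in> C" "y = f w \<oplus>\<^bsub>W\<^esub> d" using \<phi>'(6) by meson
    have "f v \<in> carrier W" "f w \<in> carrier W" "c \<in> carrier W" "d \<in> carrier W" using x y f C by auto
    then have "x \<oplus>\<^bsub>W\<^esub> y = f (v \<oplus>\<^bsub>V\<^esub> w) \<oplus>\<^bsub>W\<^esub> (c \<oplus>\<^bsub>W\<^esub> d)"
      using x y f by (simp add: W.M.a_ac)
    then show "retraction V W (f, C) (x \<oplus>\<^bsub>W\<^esub> y) =
        retraction V W (f, C) x \<oplus>\<^bsub>V\<^esub> retraction V W (f, C) y"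
      using u x y C(3) by simp
  qed
  show "retraction V W (f, C) (f v) = v" if "v \<in> carrier V"
    using u[OF that C(2)] f(1)[OF that] by simp
  show "retraction V W (f, C) x = \<zero>\<^bsub>V\<^esub> \<longleftrightarrow> x \<in> C" if xW: "x \<in> carrier W"
  proof -
    obtain v c where x: "v \<in> carrier V" "c \<in> C" "x = f v \<oplus>\<^bsub>W\<^esub> c"
      using \<phi>'(6)[OF xW] by blast
    note f0 = V.linear_maps_zero[OF \<phi>'(1) W.module_axioms]
    show ?thesis
    proof
      assume "retraction V W (f, C) x = \<zero>\<^bsub>V\<^esub>"
      then show "x \<in> C" using u x f0 C by auto
    next
      assume "x \<in> C"
      then show "retraction V W (f, C) x = \<zero>\<^bsub>V\<^esub>"
        using u[of "\<zero>\<^bsub>V\<^esub>" x] f0 xW by simp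
    qed
  qed
qed

lemma retraction_eqI:
  assumes \<phi>: "(f, C) \<in> vic_hom R V W" and p: "p \<in> linear_maps R W V"
    and "\<And>v. v \<in> carrier V \<Longrightarrow> p (f v) = v" and "\<And>c. c \<in> C \<Longrightarrow> p c = \<zero>\<^bsub>V\<^esub>"
    and x: "x \<in> carrier W"
  shows "retraction V W (f, C) x = p x"
proof -
  obtain v c where v: "v \<in> carrier V" "c \<in> C" "x = f v \<oplus>\<^bsub>W\<^esub> c"
    using vic_homD(6)[OF \<phi> x] by blast
  have "c \<in> carrier W" "f v \<in> carrier W"
    using v W.submodule_closed(1)[OF vic_homD(4)[OF \<phi>]] V.linear_mapsD(1)[OF vic_homD(1)[OF \<phi>]]
    by auto
  then have "p x = v" using v assms(3,4) W.linear_mapsD(2)[OF p] by simp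
  then show ?thesis using retraction_unique[OF \<phi> v(1,2)] v(3) by simp
qed

lemma kernel_submodule:
  assumes "p \<in> linear_maps R W V"
  shows "submodule {x \<in> carrier W. p x = \<zero>\<^bsub>V\<^esub>} R W"
  using W.linear_mapsD[OF assms] W.linear_maps_zero[OF assms V.module_axioms]
  by (intro W.submoduleI') auto

lemma vic_homI:
  assumes f: "f \<in> linear_maps R V W" "f \<in> extensional (carrier V)"
    and p: "p \<in> linear_maps R W V" and pf: "\<And>v. v \<in> carrier V \<Longrightarrow> p (f v) = v"
    and free: "free_module R (W\<lparr>carrier := {x \<in> carrier W. p x = \<zero>\<^bsub>V\<^esub>}\<rparr>)"
  shows "(f, {x \<in> carrier W. p x = \<zero>\<^bsub>V\<^esub>}) \<in> vic_hom R V W"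
proof -
  let ?C = "{x \<in> carrier W. p x = \<zero>\<^bsub>V\<^esub>}"
  note fD = V.linear_mapsD[OF f(1)] and pD = W.linear_mapsD[OF p]
  have f0: "f \<zero>\<^bsub>V\<^esub> = \<zero>\<^bsub>W\<^esub>" by (rule V.linear_maps_zero[OF f(1) W.module_axioms])
  have sub: "submodule ?C R W" by (rule kernel_submodule[OF p])
  have "f ` carrier V <+>\<^bsub>W\<^esub> ?C = carrier W"
  proof
    show "f ` carrier V <+>\<^bsub>W\<^esub> ?C \<subseteq> carrier W" unfolding set_add_def' using fD by auto
    show "carrier W \<subseteq> f ` carrier V <+>\<^bsub>W\<^esub> ?C"
    proof
      fix x assume x: "x \<in> carrier W"
      let ?u = "f (p x)"
      have u: "?u \<in> carrier W" using x fD pD by auto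
      have "p x = p (?u \<oplus>\<^bsub>W\<^esub> (x \<ominus>\<^bsub>W\<^esub> ?u))" using W_cancel(2)[OF u x] by simp
      also have "\<dots> = p ?u \<oplus>\<^bsub>V\<^esub> p (x \<ominus>\<^bsub>W\<^esub> ?u)" using pD u x by auto
      also have "p ?u = p x" using pf pD x by simp
      finally have "p (x \<ominus>\<^bsub>W\<^esub> ?u) = \<zero>\<^bsub>V\<^esub>"
        using pD(1) x u V.M.add.l_cancel_one'[of "p x" "p (x \<ominus>\<^bsub>W\<^esub> ?u)"] by simp
      then have "x \<ominus>\<^bsub>W\<^esub> ?u \<in> ?C" using x u by simp
      moreover have "?u \<in> f ` carrier V" using x pD by auto
      ultimately have "?u \<oplus>\<^bsub>W\<^esub> (x \<ominus>\<^bsub>W\<^esub> ?u) \<in> f ` carrier V <+>\<^bsub>W\<^esub> ?C"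
        unfolding set_add_def' by blast
      then show "x \<in> f ` carrier V <+>\<^bsub>W\<^esub> ?C" unfolding W_cancel(2)[OF u x] .
    qed
  qed
  moreover have "f ` carrier V \<inter> ?C = {\<zero>\<^bsub>W\<^esub>}"
  proof
    show "f ` carrier V \<inter> ?C \<subseteq> {\<zero>\<^bsub>W\<^esub>}" using pf f0 by auto
    show "{\<zero>\<^bsub>W\<^esub>} \<subseteq> f ` carrier V \<inter> ?C"
      using imageI[OF V.M.zero_closed, of f] W.submodule_closed(2)[OF sub] unfolding f0 by blast
  qed
  moreover have "inj_on f (carrier V)" using pf by (intro inj_on_inverseI)
  ultimately show ?thesis unfolding vic_hom_def using f sub free by simp
qed

end

locale module_triple = VW: module_pair R V W + WU: module_pair R W U
  for R :: "('r, 'x) ring_scheme" and V :: "('r, 'v, 'y) module_scheme"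
    and W :: "('r, 'w, 'z) module_scheme" and U :: "('r, 'u, 's) module_scheme"
begin

sublocale VU: module_pair R V U ..

text \<open>
  A basis of the complement is the union of the image of a basis of \<open>C\<close> and a basis of \<open>D\<close>: a
  relation splits into a relation in \<open>g ` C\<close> and one in \<open>D\<close>, since \<open>D\<close> meets the range of \<open>g\<close> only
  in zero.
\<close>

lemma free_complement_comp:
  assumes \<phi>: "(f, C) \<in> vic_hom R V W" and \<psi>: "(g, D) \<in> vic_hom R W U"
    and sub: "submodule (g ` C <+>\<^bsub>U\<^esub> D) R U"
  shows "free_module R (U\<lparr>carrier := g ` C <+>\<^bsub>U\<^esub> D\<rparr>)"
proof -
  note \<phi>' = VW.vic_homD[OF \<phi>] and \<psi>' = WU.vic_homD[OF \<psi>]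
  note C = VW.W.submodule_closed[OF \<phi>'(4)] and D = WU.W.submodule_closed[OF \<psi>'(4)]
  note gD = VW.W.linear_mapsD[OF \<psi>'(1)]
  note g0 = VW.W.linear_maps_zero[OF \<psi>'(1) WU.W.module_axioms]
  obtain B1 where B1: "B1 \<subseteq> C" "lin_indep R W B1" "C \<subseteq> lin_span R W B1"
    using \<phi>'(5) VW.W.free_submodule_iff[OF \<phi>'(4)] by blast
  obtain B2 where B2: "B2 \<subseteq> D" "lin_indep R U B2" "D \<subseteq> lin_span R U B2"
    using \<psi>'(5) WU.W.free_submodule_iff[OF \<psi>'(4)] by blast
  let ?B = "g ` B1 \<union> B2"
  have BU: "?B \<subseteq> carrier U" using B1(1) C(1) gD(1) B2(1) D(1) by blast
  note span = WU.W.submodule_closed[OF WU.W.lin_span_submodule[OF BU]]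
  have "?B \<subseteq> g ` C <+>\<^bsub>U\<^esub> D"
  proof
    fix b assume "b \<in> ?B"
    then consider c where "c \<in> C" "b = g c \<oplus>\<^bsub>U\<^esub> \<zero>\<^bsub>U\<^esub>" | "b \<in> D" "b = g \<zero>\<^bsub>W\<^esub> \<oplus>\<^bsub>U\<^esub> b"
      using B1(1) B2(1) C(1) gD(1) D(1) g0 by (auto simp: subset_iff)
    then show "b \<in> g ` C <+>\<^bsub>U\<^esub> D"
      unfolding set_add_def' using C(2) D(2) by cases blast+
  qed
  moreover have "g ` C <+>\<^bsub>U\<^esub> D \<subseteq> lin_span R U ?B"
  proof
    fix x assume "x \<in> g ` C <+>\<^bsub>U\<^esub> D"
    then obtain c d where x: "c \<in> C" "d \<in> D" "x = g c \<oplus>\<^bsub>U\<^esub> d" unfolding set_add_def' by blast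
    have "B1 \<subseteq> carrier W" using B1(1) C(1) by blast
    then have "g c \<in> lin_span R U ?B"
      using VW.W.linear_maps_lin_span[OF \<psi>'(1) WU.W.module_axioms, of B1 ?B c] x(1) B1(3) by blast
    moreover have "d \<in> lin_span R U ?B"
      using WU.W.lin_span_mono[of B2 ?B] B2(3) x(2) by blast
    ultimately show "x \<in> lin_span R U ?B" unfolding x(3) by (rule span(3))
  qed
  moreover have "lin_indep R U ?B"
    unfolding lin_indep_def
  proof (intro allI impI)
    fix A a assume A: "finite A" "A \<subseteq> ?B" and a: "a \<in> A \<rightarrow> carrier R"
      and sum0: "(\<Oplus>\<^bsub>U\<^esub>v\<in>A. a v \<odot>\<^bsub>U\<^esub> v) = \<zero>\<^bsub>U\<^esub>"
    define A1 where "A1 = {w \<in> B1. g w \<in> A}"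
    \<comment> \<open>a vector that lies in both \<open>g ` B1\<close> and \<open>B2\<close> is counted with the former\<close>
    define A2 where "A2 = A - g ` B1"
    have inj: "inj_on g B1" using \<psi>'(3) by (rule inj_on_subset) (use B1(1) C(1) in blast)
    have gA1: "g ` A1 = A \<inter> g ` B1" by (auto simp: A1_def)
    have finA1: "finite A1"
      using A(1) gA1 finite_imageD[of g A1] inj_on_subset[OF inj, of A1] by (auto simp: A1_def)
    have A1W: "A1 \<subseteq> carrier W" using B1(1) C(1) by (auto simp: A1_def)
    have A2D: "A2 \<subseteq> D" using A(2) B2(1) by (auto simp: A2_def)
    have aA1: "(\<lambda>w. a (g w)) \<in> A1 \<rightarrow> carrier R" using a by (auto simp: A1_def)
    have cl: "a v \<odot>\<^bsub>U\<^esub> v \<in> carrier U" if "v \<in> A" for v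
    proof -
      have "v \<in> carrier U" "a v \<in> carrier R" using that a A(2) BU by blast+
      then show ?thesis by simp
    qed
    let ?s1 = "\<Oplus>\<^bsub>W\<^esub>w\<in>A1. a (g w) \<odot>\<^bsub>W\<^esub> w" and ?s2 = "\<Oplus>\<^bsub>U\<^esub>v\<in>A2. a v \<odot>\<^bsub>U\<^esub> v"
    have s1W: "?s1 \<in> carrier W" using aA1 A1W by (intro VW.W.M.finsum_closed) auto
    have "g ?s1 = (\<Oplus>\<^bsub>U\<^esub>w\<in>A1. g (a (g w) \<odot>\<^bsub>W\<^esub> w))"
      using aA1 A1W by (intro VW.W.linear_maps_finsum[OF \<psi>'(1) WU.W.module_axioms]) auto
    also have "\<dots> = (\<Oplus>\<^bsub>U\<^esub>w\<in>A1. a (g w) \<odot>\<^bsub>U\<^esub> g w)"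
    proof (rule WU.W.M.finsum_cong'[OF refl])
      show "(\<lambda>w. a (g w) \<odot>\<^bsub>U\<^esub> g w) \<in> A1 \<rightarrow> carrier U" using cl by (auto simp: A1_def)
      fix w assume "w \<in> A1"
      then have "a (g w) \<in> carrier R" "w \<in> carrier W" using aA1 A1W by auto
      then show "g (a (g w) \<odot>\<^bsub>W\<^esub> w) = a (g w) \<odot>\<^bsub>U\<^esub> g w" by (rule gD(3))
    qed
    also have "\<dots> = (\<Oplus>\<^bsub>U\<^esub>v\<in>g ` A1. a v \<odot>\<^bsub>U\<^esub> v)"
      using inj_on_subset[OF inj, of A1] cl
      by (subst WU.W.M.finsum_reindex[of "\<lambda>v. a v \<odot>\<^bsub>U\<^esub> v" g A1]) (auto simp: A1_def)
    finally have "g ?s1 \<oplus>\<^bsub>U\<^esub> ?s2 = (\<Oplus>\<^bsub>U\<^esub>v\<in>g ` A1 \<union> A2. a v \<odot>\<^bsub>U\<^esub> v)"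
      using A(1) finA1 cl gA1 by (subst WU.W.M.finsum_Un_disjoint) (auto simp: A2_def)
    also have "g ` A1 \<union> A2 = A" using gA1 by (auto simp: A2_def)
    finally have sum: "g ?s1 \<oplus>\<^bsub>U\<^esub> ?s2 = \<zero>\<^bsub>U\<^esub>" using sum0 by simp
    have s2D: "?s2 \<in> D"
    proof -
      have "?s2 \<in> lin_span R U A2"
        using A(1) a A2D D(1) by (intro WU.W.smult_finsum) (auto simp: A2_def)
      then show ?thesis using WU.W.lin_span_minimal[OF \<psi>'(4) A2D] by blast
    qed
    have s2U: "?s2 \<in> carrier U" using s2D D(1) by blast
    have "g ?s1 = \<ominus>\<^bsub>U\<^esub> ?s2" using sum gD(1)[OF s1W] s2U by (simp add: WU.W.M.minus_equality)
    then have "g ?s1 \<in> D" using D(5)[OF s2D] by simp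
    then have g0': "g ?s1 = \<zero>\<^bsub>U\<^esub>" using \<psi>'(7)[OF s1W] by simp
    then have "g ?s1 = g \<zero>\<^bsub>W\<^esub>" using g0 by simp
    then have "?s1 = \<zero>\<^bsub>W\<^esub>" using inj_onD[OF \<psi>'(3)] s1W by simp
    then have zero1: "\<forall>w\<in>A1. a (g w) = \<zero>\<^bsub>R\<^esub>"
      using B1(2) finA1 aA1 unfolding lin_indep_def by (auto simp: A1_def)
    have "?s2 = \<zero>\<^bsub>U\<^esub>" using sum g0' s2U by simp
    moreover have "finite A2" "A2 \<subseteq> B2" "a \<in> A2 \<rightarrow> carrier R" using A a by (auto simp: A2_def)
    ultimately have zero2: "\<forall>v\<in>A2. a v = \<zero>\<^bsub>R\<^esub>" using B2(2) unfolding lin_indep_def by blast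
    show "\<forall>v\<in>A. a v = \<zero>\<^bsub>R\<^esub>" using zero1 zero2 by (auto simp: A1_def A2_def)
  qed
  ultimately show ?thesis using WU.W.free_submodule_iff[OF sub] by blast
qed

lemma vic_comp_closed:
  assumes \<phi>: "(f, C) \<in> vic_hom R V W" and \<psi>: "(g, D) \<in> vic_hom R W U"
  shows "vic_comp V U (g, D) (f, C) \<in> vic_hom R V U"
    and "x \<in> carrier U \<Longrightarrow> retraction V U (vic_comp V U (g, D) (f, C)) x =
      retraction V W (f, C) (retraction W U (g, D) x)"
    and "vic_comp V U (g, D) (f, C) = (compose (carrier V) g f,
      {x \<in> carrier U. retraction V W (f, C) (retraction W U (g, D) x) = \<zero>\<^bsub>V\<^esub>})"
proof -
  note \<phi>' = VW.vic_homD[OF \<phi>] and \<psi>' = WU.vic_homD[OF \<psi>]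
  note C = VW.W.submodule_closed[OF \<phi>'(4)] and D = WU.W.submodule_closed[OF \<psi>'(4)]
  note fD = VW.V.linear_mapsD[OF \<phi>'(1)] and gD = VW.W.linear_mapsD[OF \<psi>'(1)]
  let ?p = "retraction V W (f, C)" and ?q = "retraction W U (g, D)"
  note p = VW.retraction[OF \<phi>] and q = WU.retraction[OF \<psi>]
  note pD = VW.W.linear_mapsD[OF p(1)] and qD = WU.W.linear_mapsD[OF q(1)]
  let ?h = "compose (carrier V) g f" and ?pq = "\<lambda>x. ?p (?q x)"
  let ?K = "{x \<in> carrier U. ?pq x = \<zero>\<^bsub>V\<^esub>}"
  have pq: "?pq \<in> linear_maps R U V" using pD qD by (auto simp: linear_maps_def)
  have h: "?h \<in> linear_maps R V U" using fD gD by (auto simp: linear_maps_def compose_def)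
  have pqh: "?pq (?h v) = v" if "v \<in> carrier V" for v
    using that p(2) q(2) fD(1) by (simp add: compose_def)
  have K: "g ` C <+>\<^bsub>U\<^esub> D = ?K"
  proof
    show "g ` C <+>\<^bsub>U\<^esub> D \<subseteq> ?K"
    proof
      fix x assume "x \<in> g ` C <+>\<^bsub>U\<^esub> D"
      then obtain c d where x: "c \<in> C" "d \<in> D" "x = g c \<oplus>\<^bsub>U\<^esub> d" unfolding set_add_def' by blast
      have cl: "c \<in> carrier W" "d \<in> carrier U" using x C D by auto
      have "?q x = ?q (g c) \<oplus>\<^bsub>W\<^esub> ?q d" unfolding x(3) using qD(2) gD(1) cl by simp
      also have "\<dots> = c" using q(2)[OF cl(1)] q(3)[OF cl(2)] x(2) cl by simp
      finally show "x \<in> ?K" using p(3)[OF cl(1)] x cl gD(1) by simp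
    qed
    show "?K \<subseteq> g ` C <+>\<^bsub>U\<^esub> D"
    proof
      fix x assume x: "x \<in> ?K"
      then have qx: "?q x \<in> C" using p(3)[of "?q x"] qD(1)[of x] by blast
      obtain w d where w: "w \<in> carrier W" "d \<in> D" "x = g w \<oplus>\<^bsub>U\<^esub> d"
        using \<psi>'(6) x by blast
      then have "?q x = w" using WU.retraction_unique[OF \<psi>] by simp
      then show "x \<in> g ` C <+>\<^bsub>U\<^esub> D" unfolding set_add_def' using w qx by blast
    qed
  qed
  have eq: "vic_comp V U (g, D) (f, C) = (?h, ?K)" by (simp add: vic_comp_def K)
  have "free_module R (U\<lparr>carrier := ?K\<rparr>)"
    using free_complement_comp[OF \<phi> \<psi>] VU.kernel_submodule[OF pq] unfolding K by blast
  then have mem: "(?h, ?K) \<in> vic_hom R V U"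
    by (intro VU.vic_homI[OF h compose_extensional pq pqh])
  then show "vic_comp V U (g, D) (f, C) \<in> vic_hom R V U" unfolding eq .
  show "vic_comp V U (g, D) (f, C) = (?h, ?K)" by (rule eq)
  show "retraction V U (vic_comp V U (g, D) (f, C)) x = ?pq x" if "x \<in> carrier U"
    unfolding eq using VU.retraction_eqI[OF mem pq pqh _ that] by simp
qed

end

lemma vic_id_closed:
  assumes "Module.module R V"
  shows "vic_id V \<in> vic_hom R V V"
proof -
  interpret V: Module.module R V by fact
  interpret module_pair R V V ..
  let ?i = "\<lambda>x\<in>carrier V. x"
  have i: "?i \<in> linear_maps R V V" by (auto simp: linear_maps_def)
  have K: "{x \<in> carrier V. ?i x = \<zero>\<^bsub>V\<^esub>} = {\<zero>\<^bsub>V\<^esub>}" by auto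
  have "submodule {\<zero>\<^bsub>V\<^esub>} R V" using kernel_submodule[OF i] unfolding K .
  moreover have "lin_indep R V {}" by (auto simp: lin_indep_def)
  ultimately have "free_module R (V\<lparr>carrier := {\<zero>\<^bsub>V\<^esub>}\<rparr>)"
    using V.free_submodule_iff[of "{\<zero>\<^bsub>V\<^esub>}"] lin_span.zero[of V R] by blast
  then show ?thesis
    using vic_homI[OF i _ i] unfolding K vic_id_def by auto
qed

section \<open>Multiplicativity of the determinant\<close>

context abelian_monoid
begin

lemma finsum_swap:
  assumes A: "finite A" and B: "finite B" and f: "\<And>x y. \<lbrakk>x \<in> A; y \<in> B\<rbrakk> \<Longrightarrow> f x y \<in> carrier G"
  shows "(\<Oplus>x\<in>A. \<Oplus>y\<in>B. f x y) = (\<Oplus>y\<in>B. \<Oplus>x\<in>A. f x y)"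
  using A f
proof (induction A)
  case empty
  then show ?case by (simp add: finsum_zero)
next
  case (insert a A)
  have cl: "(\<Oplus>x\<in>A. f x y) \<in> carrier G" if "y \<in> B" for y
    using insert.prems that by (intro finsum_closed) auto
  have cl': "(\<Oplus>y\<in>B. f x y) \<in> carrier G" if "x \<in> insert a A" for x
    using insert.prems that by (intro finsum_closed) auto
  have "(\<Oplus>x\<in>insert a A. \<Oplus>y\<in>B. f x y) = (\<Oplus>y\<in>B. f a y) \<oplus> (\<Oplus>x\<in>A. \<Oplus>y\<in>B. f x y)"
    using insert.hyps cl' by (intro finsum_insert) auto
  also have "\<dots> = (\<Oplus>y\<in>B. f a y) \<oplus> (\<Oplus>y\<in>B. \<Oplus>x\<in>A. f x y)"
    using insert by simp
  also have "\<dots> = (\<Oplus>y\<in>B. f a y \<oplus> (\<Oplus>x\<in>A. f x y))"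
    using insert.prems cl by (intro finsum_addf[symmetric]) auto
  also have "\<dots> = (\<Oplus>y\<in>B. \<Oplus>x\<in>insert a A. f x y)"
    using insert cl by (intro finsum_cong'[OF refl]) (auto simp: Pi_iff)
  finally show ?case .
qed

lemma finsum_Times:
  assumes A: "finite A" and B: "finite B" and f: "\<And>x y. \<lbrakk>x \<in> A; y \<in> B\<rbrakk> \<Longrightarrow> f x y \<in> carrier G"
  shows "(\<Oplus>z\<in>A \<times> B. f (fst z) (snd z)) = (\<Oplus>x\<in>A. \<Oplus>y\<in>B. f x y)"
  using A f
proof (induction A)
  case empty
  then show ?case by simp
next
  case (insert a A)
  have eq: "insert a A \<times> B = Pair a ` B \<union> A \<times> B" by auto
  have "(\<Oplus>z\<in>insert a A \<times> B. f (fst z) (snd z)) = (\<Oplus>z\<in>Pair a ` B. f (fst z) (snd z)) \<oplus> (\<Oplus>z\<in>A \<times> B. f (fst z) (snd z))"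
    unfolding eq using insert B by (intro finsum_Un_disjoint) auto
  also have "(\<Oplus>z\<in>Pair a ` B. f (fst z) (snd z)) = (\<Oplus>y\<in>B. f a y)"
    using insert.prems by (subst finsum_reindex) (auto simp: inj_on_def)
  also have "(\<Oplus>z\<in>A \<times> B. f (fst z) (snd z)) = (\<Oplus>x\<in>A. \<Oplus>y\<in>B. f x y)"
    using insert by simp
  also have "(\<Oplus>y\<in>B. f a y) \<oplus> (\<Oplus>x\<in>A. \<Oplus>y\<in>B. f x y) = (\<Oplus>x\<in>insert a A. \<Oplus>y\<in>B. f x y)"
    using insert.hyps insert.prems by (intro finsum_insert[symmetric]) (auto intro!: finsum_closed)
  finally show ?case .
qed

end

context cring
begin

lemma finprod_finsum_distrib:
  assumes J: "finite J" and K: "finite K" and F: "\<And>j k. \<lbrakk>j \<in> J; k \<in> K\<rbrakk> \<Longrightarrow> F j k \<in> carrier R"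
  shows "(\<Otimes>j\<in>J. \<Oplus>k\<in>K. F j k) = (\<Oplus>\<kappa>\<in>J \<rightarrow>\<^sub>E K. \<Otimes>j\<in>J. F j (\<kappa> j))"
  using J F
proof (induction J)
  case empty
  then show ?case by simp
next
  case (insert j J)
  have finE: "finite (J \<rightarrow>\<^sub>E K)" using insert.hyps K by (intro finite_PiE) auto
  have prod_cl: "(\<Otimes>i\<in>J. F i (\<kappa> i)) \<in> carrier R" if "\<kappa> \<in> J \<rightarrow>\<^sub>E K" for \<kappa>
    using that insert.prems by (intro finprod_closed) (auto simp: PiE_iff)
  have "(\<Otimes>i\<in>insert j J. \<Oplus>k\<in>K. F i k) = (\<Oplus>k\<in>K. F j k) \<otimes> (\<Otimes>i\<in>J. \<Oplus>k\<in>K. F i k)"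
    using insert.hyps insert.prems by (intro finprod_insert) (auto intro!: finsum_closed)
  also have "\<dots> = (\<Oplus>k\<in>K. F j k) \<otimes> (\<Oplus>\<kappa>\<in>J \<rightarrow>\<^sub>E K. \<Otimes>i\<in>J. F i (\<kappa> i))"
    using insert by simp
  also have "\<dots> = (\<Oplus>k\<in>K. F j k \<otimes> (\<Oplus>\<kappa>\<in>J \<rightarrow>\<^sub>E K. \<Otimes>i\<in>J. F i (\<kappa> i)))"
    using K insert.prems prod_cl by (intro finsum_ldistr) (auto intro!: finsum_closed)
  also have "\<dots> = (\<Oplus>k\<in>K. \<Oplus>\<kappa>\<in>J \<rightarrow>\<^sub>E K. F j k \<otimes> (\<Otimes>i\<in>J. F i (\<kappa> i)))"
    using finE insert.prems prod_cl
    by (intro finsum_cong'[OF refl] finsum_rdistr) (auto intro!: finsum_closed)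
  also have "\<dots> = (\<Oplus>z\<in>K \<times> (J \<rightarrow>\<^sub>E K). F j (fst z) \<otimes> (\<Otimes>i\<in>J. F i (snd z i)))"
    using K finE insert.prems prod_cl by (intro finsum_Times[symmetric]) auto
  also have "\<dots> = (\<Oplus>z\<in>K \<times> (J \<rightarrow>\<^sub>E K). \<Otimes>i\<in>insert j J. F i (((snd z)(j := fst z)) i))"
  proof (rule finsum_cong'[OF refl], goal_cases)
    case 1
    show ?case using insert.prems by (auto intro!: finprod_closed simp: PiE_iff)
  next
    case (2 z)
    then obtain k \<kappa> where z: "z = (k, \<kappa>)" "k \<in> K" "\<kappa> \<in> J \<rightarrow>\<^sub>E K" by blast
    have "(\<Otimes>i\<in>insert j J. F i ((\<kappa>(j := k)) i)) =
        F j ((\<kappa>(j := k)) j) \<otimes> (\<Otimes>i\<in>J. F i ((\<kappa>(j := k)) i))"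
      using insert z by (intro finprod_insert) (auto simp: PiE_iff)
    also have "(\<Otimes>i\<in>J. F i ((\<kappa>(j := k)) i)) = (\<Otimes>i\<in>J. F i (\<kappa> i))"
      using insert z by (intro finprod_cong'[OF refl]) (auto simp: PiE_iff)
    finally show ?case by (simp add: z(1))
  qed
  also have "\<dots> = (\<Oplus>\<kappa>\<in>(\<lambda>(k, \<kappa>). \<kappa>(j := k)) ` (K \<times> (J \<rightarrow>\<^sub>E K)). \<Otimes>i\<in>insert j J. F i (\<kappa> i))"
  proof (subst finsum_reindex, goal_cases)
    case 1
    show ?case using insert.prems by (auto intro!: finprod_closed simp: PiE_iff)
  next
    case 2
    show ?case using inj_combinator[OF insert.hyps(2), of "\<lambda>_. K"] .
  next
    case 3
    show ?case by (simp add: case_prod_unfold)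
  qed
  also have "(\<lambda>(k, \<kappa>). \<kappa>(j := k)) ` (K \<times> (J \<rightarrow>\<^sub>E K)) = insert j J \<rightarrow>\<^sub>E K"
    by (simp add: PiE_insert_eq)
  finally show ?case .
qed

definition perm_sign :: "(nat \<Rightarrow> nat) \<Rightarrow> 'a"
  where "perm_sign p = (if evenperm p then \<one> else \<ominus> \<one>)"

definition matrix_det :: "nat \<Rightarrow> (nat \<Rightarrow> nat \<Rightarrow> 'a) \<Rightarrow> 'a"
  where "matrix_det n a = (\<Oplus>p\<in>{p. p permutes {..<n}}. perm_sign p \<otimes> (\<Otimes>j\<in>{..<n}. a (p j) j))"

lemma perm_sign_closed [simp]: "perm_sign p \<in> carrier R"
  by (simp add: perm_sign_def)

lemma perm_sign_comp:
  assumes "p permutes {..<n}" "q permutes {..<n::nat}"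
  shows "perm_sign (p \<circ> q) = perm_sign p \<otimes> perm_sign q"
proof -
  have "permutation p" "permutation q"
    using assms permutation_permutes by blast+
  then show ?thesis by (auto simp: perm_sign_def evenperm_comp l_minus r_minus)
qed

lemma finite_perms: "finite {p. p permutes {..<n::nat}}"
  by (rule finite_permutations) simp

lemma perm_less: "\<lbrakk>p permutes {..<n}; j < n\<rbrakk> \<Longrightarrow> p j < (n::nat)"
  using permutes_in_image[of p "{..<n}" j] by simp

lemma perm_product_closed:
  assumes "\<And>i j. \<lbrakk>i < n; j < n\<rbrakk> \<Longrightarrow> a i j \<in> carrier R" "p permutes {..<n}"
  shows "(\<Otimes>j\<in>{..<n}. a (p j) j) \<in> carrier R"
  using assms permutes_in_image[OF assms(2)] by (intro finprod_closed) auto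

lemma matrix_det_closed:
  assumes "\<And>i j. \<lbrakk>i < n; j < n\<rbrakk> \<Longrightarrow> a i j \<in> carrier R"
  shows "matrix_det n a \<in> carrier R"
  unfolding matrix_det_def using perm_product_closed[of n a, OF assms] by (intro finsum_closed) auto

lemma matrix_det_cong:
  assumes eq: "\<And>i j. \<lbrakk>i < n; j < n\<rbrakk> \<Longrightarrow> c i j = d i j"
    and d: "\<And>i j. \<lbrakk>i < n; j < n\<rbrakk> \<Longrightarrow> d i j \<in> carrier R"
  shows "matrix_det n c = matrix_det n d"
proof -
  have "(\<Otimes>j\<in>{..<n}. c (p j) j) = (\<Otimes>j\<in>{..<n}. d (p j) j)" if "p permutes {..<n}" for p
    using that eq d perm_less[of p n] by (intro finprod_cong'[OF refl]) auto
  then show ?thesis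
    unfolding matrix_det_def using perm_product_closed[of n d, OF d]
    by (intro finsum_cong'[OF refl]) auto
qed

text \<open>
  Composition with the transposition of \<open>r\<close> and \<open>s\<close> is a bijection from the even to the odd
  permutations under which corresponding products agree and the signs are opposite. This cancellation
  is valid in every characteristic.
\<close>

lemma matrix_det_equal_columns:
  assumes a: "\<And>i j. \<lbrakk>i < n; j < n\<rbrakk> \<Longrightarrow> a i j \<in> carrier R"
    and rs: "r < n" "s < n" "r \<noteq> s" and eq: "\<And>i. i < n \<Longrightarrow> a i r = a i s"
  shows "matrix_det n a = \<zero>"
proof -
  let ?t = "transpose r s"
  let ?E = "{p. p permutes {..<n} \<and> evenperm p}" and ?O = "{p. p permutes {..<n} \<and> \<not> evenperm p}"
  let ?term = "\<lambda>p. perm_sign p \<otimes> (\<Otimes>j\<in>{..<n}. a (p j) j)"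
  note cl = perm_product_closed[of n a, OF a]
  have t: "?t permutes {..<n}" using rs by (intro permutes_swap_id) auto
  have sign: "evenperm (p \<circ> ?t) \<longleftrightarrow> \<not> evenperm p" if "p permutes {..<n}" for p
  proof -
    have "permutation p" "permutation ?t"
      using that t permutation_permutes by blast+
    then show ?thesis using rs(3) by (simp add: evenperm_comp evenperm_swap)
  qed
  have comp: "p \<circ> ?t permutes {..<n}" if "p permutes {..<n}" for p
    using permutes_compose[OF t that] .
  have tt: "(p \<circ> ?t) \<circ> ?t = p" for p :: "nat \<Rightarrow> nat" by (simp add: comp_assoc)
  have O: "?O = (\<lambda>p. p \<circ> ?t) ` ?E"
  proof
    show "?O \<subseteq> (\<lambda>p. p \<circ> ?t) ` ?E"
    proof
      fix p assume p: "p \<in> ?O"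
      then have "p \<circ> ?t \<in> ?E" using comp sign by blast
      then show "p \<in> (\<lambda>p. p \<circ> ?t) ` ?E" by (intro image_eqI[where x = "p \<circ> ?t"]) (simp_all add: tt)
    qed
  qed (use comp sign in blast)
  have inj: "inj_on (\<lambda>p. p \<circ> ?t) ?E" by (rule inj_on_inverseI[where g = "\<lambda>p. p \<circ> ?t"]) (rule tt)
  have fin: "finite ?E" "finite ?O"
    by (rule finite_subset[OF _ finite_perms[of n]]; blast)+
  have neg: "?term (p \<circ> ?t) = \<ominus> ?term p" if p: "p \<in> ?E" for p
  proof -
    have "(\<Otimes>j\<in>{..<n}. a (p j) j) = (\<Otimes>j\<in>?t ` {..<n}. a (p j) j)"
      using permutes_image[OF t] by simp
    also have "\<dots> = (\<Otimes>j\<in>{..<n}. a (p (?t j)) (?t j))"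
      using a permutes_in_image[of p] p permutes_image[OF t] permutes_inj_on[OF t]
      by (intro finprod_reindex) auto
    also have "\<dots> = (\<Otimes>j\<in>{..<n}. a ((p \<circ> ?t) j) j)"
    proof (rule finprod_cong'[OF refl])
      show "(\<lambda>j. a ((p \<circ> ?t) j) j) \<in> {..<n} \<rightarrow> carrier R"
        using a permutes_in_image[OF comp, of p] p by auto
      fix j assume "j \<in> {..<n}"
      then have "p (?t j) < n" using permutes_in_image[OF comp, of p j] p by simp
      then show "a (p (?t j)) (?t j) = a ((p \<circ> ?t) j) j"
        using eq by (auto simp: transpose_def)
    qed
    finally have "(\<Otimes>j\<in>{..<n}. a (p j) j) = (\<Otimes>j\<in>{..<n}. a ((p \<circ> ?t) j) j)" .
    moreover have "perm_sign (p \<circ> ?t) = \<ominus> \<one>" "perm_sign p = \<one>"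
      using sign p by (auto simp: perm_sign_def)
    ultimately show ?thesis using cl[of p] p by (simp add: l_minus)
  qed
  have "matrix_det n a = (\<Oplus>p\<in>?E \<union> ?O. ?term p)"
    unfolding matrix_det_def by (rule arg_cong[of _ _ "finsum R ?term"]) blast
  also have "\<dots> = (\<Oplus>p\<in>?E. ?term p) \<oplus> (\<Oplus>p\<in>?O. ?term p)"
    using fin cl by (intro finsum_Un_disjoint) auto
  also have "(\<Oplus>p\<in>?O. ?term p) = (\<Oplus>p\<in>?E. ?term (p \<circ> ?t))"
  proof -
    have "?term \<in> ?O \<rightarrow> carrier R" using cl by auto
    then show ?thesis unfolding O by (rule finsum_reindex[OF _ inj])
  qed
  also have "\<dots> = (\<Oplus>p\<in>?E. \<ominus> ?term p)"
    using neg cl by (intro finsum_cong'[OF refl]) auto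
  also have "(\<Oplus>p\<in>?E. ?term p) \<oplus> \<dots> = (\<Oplus>p\<in>?E. ?term p \<oplus> \<ominus> ?term p)"
    using cl by (intro finsum_addf[symmetric]) auto
  also have "\<dots> = \<zero>" using cl by (intro add.finprod_one_eqI) (auto simp: r_neg)
  finally show ?thesis .
qed

lemma matrix_det_permute_columns:
  assumes a: "\<And>i j. \<lbrakk>i < n; j < n\<rbrakk> \<Longrightarrow> a i j \<in> carrier R" and q: "q permutes {..<n}"
  shows "matrix_det n (\<lambda>i j. a i (q j)) = matrix_det n a \<otimes> perm_sign q"
proof -
  let ?S = "{p. p permutes {..<n}}"
  let ?term = "\<lambda>p. perm_sign p \<otimes> (\<Otimes>j\<in>{..<n}. a (p j) (q j))"
  note cl = perm_product_closed[of n a, OF a]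
  have cl': "?term p \<in> carrier R" if "p \<in> ?S" for p
    using that a perm_less[of p n] perm_less[OF q]
    by (intro m_closed perm_sign_closed finprod_closed) auto
  have S: "?S = (\<lambda>p. p \<circ> q) ` ?S"
  proof
    show "?S \<subseteq> (\<lambda>p. p \<circ> q) ` ?S"
    proof
      fix p assume "p \<in> ?S"
      then have "p \<circ> inv_into UNIV q \<in> ?S" using permutes_compose[OF permutes_inv[OF q], of p] by simp
      moreover have "p = (p \<circ> inv_into UNIV q) \<circ> q" using permutes_inv_o(2)[OF q] by (simp add: comp_assoc)
      ultimately show "p \<in> (\<lambda>p. p \<circ> q) ` ?S" by blast
    qed
  qed (use permutes_compose[OF q] in blast)
  have inj: "inj_on (\<lambda>p. p \<circ> q) ?S"
    using permutes_inv_o(1)[OF q]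
    by (intro inj_on_inverseI[where g = "\<lambda>p. p \<circ> inv_into UNIV q"]) (simp add: comp_assoc)
  have "matrix_det n (\<lambda>i j. a i (q j)) = (\<Oplus>p\<in>(\<lambda>p. p \<circ> q) ` ?S. ?term p)"
    unfolding matrix_det_def S[symmetric] ..
  also have "\<dots> = (\<Oplus>p\<in>?S. ?term (p \<circ> q))"
    using inj cl' permutes_compose[OF q] by (intro finsum_reindex) auto
  also have "\<dots> = (\<Oplus>p\<in>?S. (perm_sign p \<otimes> (\<Otimes>j\<in>{..<n}. a (p j) j)) \<otimes> perm_sign q)"
  proof (rule finsum_cong'[OF refl])
    show "(\<lambda>p. (perm_sign p \<otimes> (\<Otimes>j\<in>{..<n}. a (p j) j)) \<otimes> perm_sign q) \<in> ?S \<rightarrow> carrier R"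
      using cl by auto
    fix p assume p: "p \<in> ?S"
    have "(\<Otimes>j\<in>{..<n}. a (p j) j) = (\<Otimes>j\<in>q ` {..<n}. a (p j) j)"
      using permutes_image[OF q] by simp
    also have "\<dots> = (\<Otimes>j\<in>{..<n}. a (p (q j)) (q j))"
      using a permutes_in_image[of p] p permutes_image[OF q] permutes_inj_on[OF q]
      by (intro finprod_reindex) auto
    finally show "?term (p \<circ> q) = (perm_sign p \<otimes> (\<Otimes>j\<in>{..<n}. a (p j) j)) \<otimes> perm_sign q"
      using p cl[of p] perm_sign_comp[of p n q] q by (simp add: m_ac)
  qed
  also have "\<dots> = matrix_det n a \<otimes> perm_sign q"
    unfolding matrix_det_def using finite_perms cl by (intro finsum_ldistr[symmetric]) auto
  finally show ?thesis .
qed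

text \<open>
  Multilinear expansion of the product matrix gives one term for each map \<open>\<kappa>\<close> from columns to
  columns. Terms with \<open>\<kappa>\<close> not injective vanish because two columns coincide; for a permutation \<open>\<kappa>\<close>
  the term is the determinant of \<open>a\<close> times a summand of the determinant of \<open>b\<close>.
\<close>

theorem matrix_det_mult:
  assumes a: "\<And>i j. \<lbrakk>i < n; j < n\<rbrakk> \<Longrightarrow> a i j \<in> carrier R"
    and b: "\<And>i j. \<lbrakk>i < n; j < n\<rbrakk> \<Longrightarrow> b i j \<in> carrier R"
  shows "matrix_det n (\<lambda>i j. \<Oplus>k\<in>{..<n}. a i k \<otimes> b k j) = matrix_det n a \<otimes> matrix_det n b"
proof -
  let ?S = "{p. p permutes {..<n}}" and ?F = "{..<n} \<rightarrow>\<^sub>E {..<n}"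
  let ?A = "\<lambda>p \<kappa>. \<Otimes>j\<in>{..<n}. a (p j) (\<kappa> j)" and ?B = "\<lambda>\<kappa>. \<Otimes>j\<in>{..<n}. b (\<kappa> j) j"
  have finF: "finite ?F" by (intro finite_PiE) auto
  have acl: "a (p j) (\<kappa> j) \<in> carrier R" if "p \<in> ?S" "\<kappa> \<in> ?F" "j < n" for p \<kappa> j
    using that permutes_in_image[of p "{..<n}" j] by (intro a) (auto simp: PiE_iff)
  have bcl: "b (\<kappa> j) j \<in> carrier R" if "\<kappa> \<in> ?F" "j < n" for \<kappa> j
    using that by (intro b) (auto simp: PiE_iff)
  have Acl: "?A p \<kappa> \<in> carrier R" if "p \<in> ?S" "\<kappa> \<in> ?F" for p \<kappa>
    using acl[OF that] by (intro finprod_closed) auto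
  have Bcl: "?B \<kappa> \<in> carrier R" if "\<kappa> \<in> ?F" for \<kappa>
    using bcl[OF that] by (intro finprod_closed) auto
  have expand: "(\<Otimes>j\<in>{..<n}. \<Oplus>k\<in>{..<n}. a (p j) k \<otimes> b k j) = (\<Oplus>\<kappa>\<in>?F. ?A p \<kappa> \<otimes> ?B \<kappa>)"
    if p: "p \<in> ?S" for p
  proof -
    have pj: "p j < n" if "j < n" for j using permutes_in_image[of p "{..<n}" j] p that by simp
    have "(\<Otimes>j\<in>{..<n}. \<Oplus>k\<in>{..<n}. a (p j) k \<otimes> b k j) =
        (\<Oplus>\<kappa>\<in>?F. \<Otimes>j\<in>{..<n}. a (p j) (\<kappa> j) \<otimes> b (\<kappa> j) j)"
      using a b pj by (intro finprod_finsum_distrib) auto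
    also have "\<dots> = (\<Oplus>\<kappa>\<in>?F. ?A p \<kappa> \<otimes> ?B \<kappa>)"
      using acl[OF p] bcl Acl[OF p] Bcl by (intro finsum_cong'[OF refl] finprod_multf) auto
    finally show ?thesis .
  qed
  have "matrix_det n (\<lambda>i j. \<Oplus>k\<in>{..<n}. a i k \<otimes> b k j) =
      (\<Oplus>p\<in>?S. perm_sign p \<otimes> (\<Oplus>\<kappa>\<in>?F. ?A p \<kappa> \<otimes> ?B \<kappa>))"
    unfolding matrix_det_def using expand Acl Bcl
    by (intro finsum_cong'[OF refl]) (auto intro!: finsum_closed)
  also have "\<dots> = (\<Oplus>p\<in>?S. \<Oplus>\<kappa>\<in>?F. perm_sign p \<otimes> (?A p \<kappa> \<otimes> ?B \<kappa>))"
    using finF Acl Bcl by (intro finsum_cong'[OF refl] finsum_rdistr) (auto intro!: finsum_closed)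
  also have "\<dots> = (\<Oplus>\<kappa>\<in>?F. \<Oplus>p\<in>?S. perm_sign p \<otimes> (?A p \<kappa> \<otimes> ?B \<kappa>))"
    using finF finite_perms Acl Bcl by (intro finsum_swap) auto
  also have "\<dots> = (\<Oplus>\<kappa>\<in>?F. matrix_det n (\<lambda>i j. a i (\<kappa> j)) \<otimes> ?B \<kappa>)"
  proof (rule finsum_cong'[OF refl])
    show "(\<lambda>\<kappa>. matrix_det n (\<lambda>i j. a i (\<kappa> j)) \<otimes> ?B \<kappa>) \<in> ?F \<rightarrow> carrier R"
      using Bcl a by (auto intro!: m_closed matrix_det_closed simp: PiE_iff)
    fix \<kappa> assume \<kappa>: "\<kappa> \<in> ?F"
    have "(\<Oplus>p\<in>?S. perm_sign p \<otimes> (?A p \<kappa> \<otimes> ?B \<kappa>)) = (\<Oplus>p\<in>?S. (perm_sign p \<otimes> ?A p \<kappa>) \<otimes> ?B \<kappa>)"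
      using Acl Bcl \<kappa> by (intro finsum_cong'[OF refl]) (auto simp: m_assoc)
    also have "\<dots> = (\<Oplus>p\<in>?S. perm_sign p \<otimes> ?A p \<kappa>) \<otimes> ?B \<kappa>"
      using finite_perms Acl Bcl \<kappa> by (intro finsum_ldistr[symmetric]) auto
    finally show "(\<Oplus>p\<in>?S. perm_sign p \<otimes> (?A p \<kappa> \<otimes> ?B \<kappa>)) =
        matrix_det n (\<lambda>i j. a i (\<kappa> j)) \<otimes> ?B \<kappa>"
      by (simp add: matrix_det_def)
  qed
  also have "\<dots> = (\<Oplus>\<kappa>\<in>(\<lambda>q. restrict q {..<n}) ` ?S. matrix_det n (\<lambda>i j. a i (\<kappa> j)) \<otimes> ?B \<kappa>)"
  proof (rule add.finprod_mono_neutral_cong_right[OF finF])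
    show "(\<lambda>q. restrict q {..<n}) ` ?S \<subseteq> ?F"
      by (intro image_subsetI) (simp add: restrict_PiE_iff perm_less)
    show "(\<lambda>\<kappa>. matrix_det n (\<lambda>i j. a i (\<kappa> j)) \<otimes> ?B \<kappa>) \<in> ?F \<rightarrow> carrier R"
      using Bcl a by (auto intro!: m_closed matrix_det_closed simp: PiE_iff)
    fix \<kappa> assume \<kappa>: "\<kappa> \<in> ?F - (\<lambda>q. restrict q {..<n}) ` ?S"
    have "\<not> inj_on \<kappa> {..<n}"
    proof
      assume inj: "inj_on \<kappa> {..<n}"
      let ?q = "\<lambda>j. if j < n then \<kappa> j else j"
      have "\<kappa> ` {..<n} \<subseteq> {..<n}" using \<kappa> by auto
      then have "\<kappa> ` {..<n} = {..<n}" using inj by (intro endo_inj_surj) auto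
      then have "bij_betw \<kappa> {..<n} {..<n}" using inj by (simp add: bij_betw_def)
      then have "bij_betw ?q {..<n} {..<n}" by (subst bij_betw_cong[of _ _ \<kappa>]) auto
      then have "?q permutes {..<n}" by (rule bij_imp_permutes) simp
      moreover have "\<kappa> = restrict ?q {..<n}"
        using \<kappa> by (intro extensionalityI[of _ "{..<n}"]) (auto simp: PiE_iff)
      ultimately show False using \<kappa> by blast
    qed
    then obtain r s where rs: "r < n" "s < n" "r \<noteq> s" "\<kappa> r = \<kappa> s" by (auto simp: inj_on_def)
    have "matrix_det n (\<lambda>i j. a i (\<kappa> j)) = \<zero>"
      using \<kappa> rs a by (intro matrix_det_equal_columns[OF _ rs(1-3)]) (auto simp: PiE_iff)
    then show "matrix_det n (\<lambda>i j. a i (\<kappa> j)) \<otimes> ?B \<kappa> = \<zero>" using Bcl \<kappa> by simp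
  qed simp
  also have "\<dots> = (\<Oplus>q\<in>?S. matrix_det n (\<lambda>i j. a i (restrict q {..<n} j)) \<otimes> ?B (restrict q {..<n}))"
  proof (rule finsum_reindex)
    show "(\<lambda>\<kappa>. matrix_det n (\<lambda>i j. a i (\<kappa> j)) \<otimes> ?B \<kappa>)
        \<in> (\<lambda>q. restrict q {..<n}) ` ?S \<rightarrow> carrier R"
      using b a perm_less by (auto intro!: m_closed matrix_det_closed finprod_closed)
    show "inj_on (\<lambda>q. restrict q {..<n}) ?S"
    proof (rule inj_onI, rule ext)
      fix p q j assume pq: "p \<in> ?S" "q \<in> ?S" "restrict p {..<n} = restrict q {..<n}"
      show "p j = q j"
        using fun_cong[OF pq(3), of j] permutes_not_in[of p "{..<n}" j] permutes_not_in[of q "{..<n}" j]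
          pq(1,2) by (cases "j < n") auto
    qed
  qed
  also have "\<dots> = (\<Oplus>q\<in>?S. matrix_det n a \<otimes> (perm_sign q \<otimes> (\<Otimes>j\<in>{..<n}. b (q j) j)))"
  proof (rule finsum_cong'[OF refl])
    show "(\<lambda>q. matrix_det n a \<otimes> (perm_sign q \<otimes> (\<Otimes>j\<in>{..<n}. b (q j) j))) \<in> ?S \<rightarrow> carrier R"
      using matrix_det_closed[of n a, OF a] perm_product_closed[of n b, OF b] by auto
    fix q assume q: "q \<in> ?S"
    have "matrix_det n (\<lambda>i j. a i (restrict q {..<n} j)) = matrix_det n (\<lambda>i j. a i (q j))"
      using q permutes_in_image[of q "{..<n}"] a by (intro matrix_det_cong) auto
    also have "\<dots> = matrix_det n a \<otimes> perm_sign q"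
      using q by (intro matrix_det_permute_columns a) auto
    finally have "matrix_det n (\<lambda>i j. a i (restrict q {..<n} j)) = matrix_det n a \<otimes> perm_sign q" .
    moreover have "?B (restrict q {..<n}) = (\<Otimes>j\<in>{..<n}. b (q j) j)"
      using q permutes_in_image[of q "{..<n}"] b by (intro finprod_cong'[OF refl]) auto
    ultimately show "matrix_det n (\<lambda>i j. a i (restrict q {..<n} j)) \<otimes> ?B (restrict q {..<n}) =
        matrix_det n a \<otimes> (perm_sign q \<otimes> (\<Otimes>j\<in>{..<n}. b (q j) j))"
      using q matrix_det_closed[of n a, OF a] perm_product_closed[of n b, OF b, of q] by (simp add: m_assoc)
  qed
  also have "\<dots> = matrix_det n a \<otimes> matrix_det n b"
    unfolding matrix_det_def[of n b] using finite_perms matrix_det_closed[of n a, OF a] perm_product_closed[of n b, OF b]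
    by (intro finsum_rdistr[symmetric]) auto
  finally show ?thesis .
qed

end

section \<open>Standard free modules and their linear maps\<close>

locale std_modules = R?: cring R for R :: "'r ring" (structure)
begin

abbreviation V :: "nat \<Rightarrow> ('r, nat \<Rightarrow> 'r) module" where "V \<equiv> std_module R"

abbreviation unit_vec :: "nat \<Rightarrow> nat \<Rightarrow> nat \<Rightarrow> 'r" where "unit_vec \<equiv> std_basis R"

lemma carrier_std: "carrier (V n) = {..<n} \<rightarrow>\<^sub>E carrier R"
  and add_std: "x \<oplus>\<^bsub>V n\<^esub> y = (\<lambda>i\<in>{..<n}. x i \<oplus> y i)"
  and smult_std: "c \<odot>\<^bsub>V n\<^esub> x = (\<lambda>i\<in>{..<n}. c \<otimes> x i)"
  and zero_std: "\<zero>\<^bsub>V n\<^esub> = (\<lambda>i\<in>{..<n}. \<zero>)"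
  by (simp_all add: std_module_def)

lemma add_coord: "i < n \<Longrightarrow> (x \<oplus>\<^bsub>V n\<^esub> y) i = x i \<oplus> y i"
  and smult_coord: "i < n \<Longrightarrow> (c \<odot>\<^bsub>V n\<^esub> x) i = c \<otimes> x i"
  and zero_coord: "i < n \<Longrightarrow> \<zero>\<^bsub>V n\<^esub> i = \<zero>"
  and unit_vec_coord: "i < n \<Longrightarrow> unit_vec n j i = (if i = j then \<one> else \<zero>)"
  by (simp_all add: add_std smult_std zero_std std_basis_def)

lemma std_coord_closed: "\<lbrakk>x \<in> carrier (V n); i < n\<rbrakk> \<Longrightarrow> x i \<in> carrier R"
  by (auto simp: carrier_std PiE_iff)

lemma std_eqI:
  "\<lbrakk>x \<in> carrier (V n); y \<in> carrier (V n); \<And>i. i < n \<Longrightarrow> x i = y i\<rbrakk> \<Longrightarrow> x = y"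
  unfolding carrier_std by (rule PiE_ext) auto

lemma std_carrierI:
  "\<lbrakk>\<And>i. i < n \<Longrightarrow> f i \<in> carrier R\<rbrakk> \<Longrightarrow> (\<lambda>i\<in>{..<n}. f i) \<in> carrier (V n)"
  unfolding carrier_std by auto

lemma std_module_is_module: "Module.module R (V n)"
proof (rule moduleI)
  show "cring R" by (rule R.is_cring)
  note closed = std_coord_closed
  have add: "x \<oplus>\<^bsub>V n\<^esub> y \<in> carrier (V n)" if "x \<in> carrier (V n)" "y \<in> carrier (V n)" for x y
    unfolding add_std using that closed by (intro std_carrierI) auto
  have zero: "\<zero>\<^bsub>V n\<^esub> \<in> carrier (V n)" unfolding zero_std by (intro std_carrierI) auto
  show "abelian_group (V n)"
  proof (rule abelian_groupI)
    fix x y z assume xyz: "x \<in> carrier (V n)" "y \<in> carrier (V n)" "z \<in> carrier (V n)"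
    show "(x \<oplus>\<^bsub>V n\<^esub> y) \<oplus>\<^bsub>V n\<^esub> z = x \<oplus>\<^bsub>V n\<^esub> (y \<oplus>\<^bsub>V n\<^esub> z)"
      using xyz add closed by (intro std_eqI[of _ n]) (auto simp: add_coord R.a_assoc)
  next
    fix x y assume xy: "x \<in> carrier (V n)" "y \<in> carrier (V n)"
    show "x \<oplus>\<^bsub>V n\<^esub> y = y \<oplus>\<^bsub>V n\<^esub> x"
      using xy add closed by (intro std_eqI[of _ n]) (auto simp: add_coord R.a_comm)
    show "x \<oplus>\<^bsub>V n\<^esub> y \<in> carrier (V n)" using add xy .
  next
    fix x assume x: "x \<in> carrier (V n)"
    show "\<zero>\<^bsub>V n\<^esub> \<oplus>\<^bsub>V n\<^esub> x = x"
      using x add zero closed by (intro std_eqI[of _ n]) (auto simp: add_coord zero_coord)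
    have m: "(\<lambda>i\<in>{..<n}. \<ominus> x i) \<in> carrier (V n)" using x closed by (intro std_carrierI) auto
    have "(\<lambda>i\<in>{..<n}. \<ominus> x i) \<oplus>\<^bsub>V n\<^esub> x = \<zero>\<^bsub>V n\<^esub>"
      using x add[OF m x] zero closed
      by (intro std_eqI[of _ n]) (auto simp: add_coord zero_coord R.l_neg)
    with m show "\<exists>y\<in>carrier (V n). y \<oplus>\<^bsub>V n\<^esub> x = \<zero>\<^bsub>V n\<^esub>" by blast
  qed (rule zero)
  show smult: "c \<odot>\<^bsub>V n\<^esub> x \<in> carrier (V n)" if "c \<in> carrier R" "x \<in> carrier (V n)" for c x
    unfolding smult_std using that closed by (intro std_carrierI) auto
  fix c d x assume c: "c \<in> carrier R" "d \<in> carrier R" and x: "x \<in> carrier (V n)"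
  show "(c \<oplus> d) \<odot>\<^bsub>V n\<^esub> x = c \<odot>\<^bsub>V n\<^esub> x \<oplus>\<^bsub>V n\<^esub> d \<odot>\<^bsub>V n\<^esub> x"
    using c x add smult closed by (intro std_eqI[of _ n]) (auto simp: add_coord smult_coord R.l_distr)
  show "(c \<otimes> d) \<odot>\<^bsub>V n\<^esub> x = c \<odot>\<^bsub>V n\<^esub> (d \<odot>\<^bsub>V n\<^esub> x)"
    using c x add smult closed by (intro std_eqI[of _ n]) (auto simp: add_coord smult_coord R.m_assoc)
next
  fix c x y assume c: "c \<in> carrier R" and x: "x \<in> carrier (V n)" "y \<in> carrier (V n)"
  show "c \<odot>\<^bsub>V n\<^esub> (x \<oplus>\<^bsub>V n\<^esub> y) = c \<odot>\<^bsub>V n\<^esub> x \<oplus>\<^bsub>V n\<^esub> c \<odot>\<^bsub>V n\<^esub> y"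
    unfolding add_std smult_std using c x std_coord_closed
    by (intro restrict_ext) (auto simp: R.r_distr)
next
  fix x assume x: "x \<in> carrier (V n)"
  show "\<one> \<odot>\<^bsub>V n\<^esub> x = x"
    unfolding smult_std using x std_coord_closed
    by (intro std_eqI[OF std_carrierI x]) auto
qed

sublocale V: Module.module R "V n" for n by (rule std_module_is_module)

sublocale VV: module_pair R "V n" "V m" for n m by unfold_locales

sublocale VVV: module_triple R "V n" "V m" "V l" for n m l by unfold_locales

lemma unit_vec_closed: "unit_vec n j \<in> carrier (V n)"
  unfolding std_basis_def by (intro std_carrierI) auto

lemma std_spanned: "carrier (V n) \<subseteq> lin_span R (V n) (unit_vec n ` {..<n})"
proof
  fix x assume x: "x \<in> carrier (V n)"
  have "x \<in> lin_span R (V n) (unit_vec n ` {..<n})"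
    if "k \<le> n" "x \<in> carrier (V n)" "\<And>i. \<lbrakk>k \<le> i; i < n\<rbrakk> \<Longrightarrow> x i = \<zero>" for k x
    using that
  proof (induction k arbitrary: x)
    case 0
    then have "x = \<zero>\<^bsub>V n\<^esub>" by (intro std_eqI[of _ n]) (auto simp: zero_coord)
    then show ?case by (simp add: lin_span.zero)
  next
    case (Suc k)
    let ?y = "\<lambda>i\<in>{..<n}. if i = k then \<zero> else x i"
    have y: "?y \<in> carrier (V n)" using Suc.prems std_coord_closed by (intro std_carrierI) auto
    have xk: "x k \<in> carrier R" using Suc.prems std_coord_closed by auto
    have "?y \<in> lin_span R (V n) (unit_vec n ` {..<n})"
    proof (rule Suc.IH[OF _ y])
      show "?y i = \<zero>" if "k \<le> i" "i < n" for i
        using that Suc.prems(3)[of i] by (cases "i = k") auto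
    qed (use Suc.prems in simp)
    then have "x k \<odot>\<^bsub>V n\<^esub> unit_vec n k \<oplus>\<^bsub>V n\<^esub> ?y \<in> lin_span R (V n) (unit_vec n ` {..<n})"
      using Suc.prems xk by (intro lin_span.step) auto
    also have "x k \<odot>\<^bsub>V n\<^esub> unit_vec n k \<oplus>\<^bsub>V n\<^esub> ?y = x"
      using Suc.prems xk y unit_vec_closed std_coord_closed[OF Suc.prems(2)]
      by (intro std_eqI[of _ n]) (auto simp: add_coord smult_coord unit_vec_coord)
    finally show ?case .
  qed
  from this[of n x] x show "x \<in> lin_span R (V n) (unit_vec n ` {..<n})" by simp
qed

lemma finite_std: "finite (carrier R) \<Longrightarrow> finite (carrier (V n))"
  unfolding carrier_std by (intro finite_PiE) auto

lemma finite_functionals: "finite (carrier R) \<Longrightarrow> finite (carrier (V n) \<rightarrow>\<^sub>E carrier R)"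
  using finite_std by (intro finite_PiE) auto

lemma linear_eq_on_basis:
  assumes f: "f \<in> linear_maps R (V n) W" and g: "g \<in> linear_maps R (V n) W"
    and W: "Module.module R W" and eq: "\<And>j. j < n \<Longrightarrow> f (unit_vec n j) = g (unit_vec n j)"
    and x: "x \<in> carrier (V n)"
  shows "f x = g x"
proof -
  note fD = V.linear_mapsD[OF f] and gD = V.linear_mapsD[OF g]
  have "submodule {x \<in> carrier (V n). f x = g x} R (V n)"
    using fD gD V.linear_maps_zero[OF f W] V.linear_maps_zero[OF g W] by (intro V.submoduleI') auto
  then have "lin_span R (V n) (unit_vec n ` {..<n}) \<subseteq> {x \<in> carrier (V n). f x = g x}"
    using eq unit_vec_closed by (intro V.lin_span_minimal) auto
  then show ?thesis using std_spanned x by blast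
qed

lemma std_linear_mapsI:
  assumes "\<And>x i. \<lbrakk>x \<in> carrier (V n); i < m\<rbrakk> \<Longrightarrow> f x i \<in> carrier R"
    and "\<And>x y i. \<lbrakk>x \<in> carrier (V n); y \<in> carrier (V n); i < m\<rbrakk> \<Longrightarrow>
      f (x \<oplus>\<^bsub>V n\<^esub> y) i = f x i \<oplus> f y i"
    and "\<And>c x i. \<lbrakk>c \<in> carrier R; x \<in> carrier (V n); i < m\<rbrakk> \<Longrightarrow> f (c \<odot>\<^bsub>V n\<^esub> x) i = c \<otimes> f x i"
  shows "(\<lambda>x. \<lambda>i\<in>{..<m}. f x i) \<in> linear_maps R (V n) (V m)"
  unfolding linear_maps_def using assms
  by (auto intro!: std_carrierI simp: add_std[where n = m] smult_std[where n = m] intro: restrict_ext)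

lemma matrix_linear:
  assumes a: "\<And>i j. \<lbrakk>i < m; j < n\<rbrakk> \<Longrightarrow> a i j \<in> carrier R"
  shows "(\<lambda>x. \<lambda>i\<in>{..<m}. \<Oplus>j\<in>{..<n}. a i j \<otimes> x j) \<in> linear_maps R (V n) (V m)"
proof (rule std_linear_mapsI)
  note closed = std_coord_closed
  show "(\<Oplus>j\<in>{..<n}. a i j \<otimes> x j) \<in> carrier R" if "x \<in> carrier (V n)" "i < m" for x i
    using that a closed by (intro R.finsum_closed) auto
  show "(\<Oplus>j\<in>{..<n}. a i j \<otimes> (x \<oplus>\<^bsub>V n\<^esub> y) j) =
      (\<Oplus>j\<in>{..<n}. a i j \<otimes> x j) \<oplus> (\<Oplus>j\<in>{..<n}. a i j \<otimes> y j)"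
    if "x \<in> carrier (V n)" "y \<in> carrier (V n)" "i < m" for x y i
  proof -
    have "(\<Oplus>j\<in>{..<n}. a i j \<otimes> (x \<oplus>\<^bsub>V n\<^esub> y) j) = (\<Oplus>j\<in>{..<n}. a i j \<otimes> x j \<oplus> a i j \<otimes> y j)"
      using that a closed by (intro R.finsum_cong'[OF refl]) (auto simp: add_coord R.r_distr)
    also have "\<dots> = (\<Oplus>j\<in>{..<n}. a i j \<otimes> x j) \<oplus> (\<Oplus>j\<in>{..<n}. a i j \<otimes> y j)"
      using that a closed by (intro R.finsum_addf) auto
    finally show ?thesis .
  qed
  show "(\<Oplus>j\<in>{..<n}. a i j \<otimes> (c \<odot>\<^bsub>V n\<^esub> x) j) = c \<otimes> (\<Oplus>j\<in>{..<n}. a i j \<otimes> x j)"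
    if "c \<in> carrier R" "x \<in> carrier (V n)" "i < m" for c x i
  proof -
    have "c \<otimes> (\<Oplus>j\<in>{..<n}. a i j \<otimes> x j) = (\<Oplus>j\<in>{..<n}. c \<otimes> (a i j \<otimes> x j))"
      using that a closed by (intro R.finsum_rdistr) auto
    also have "\<dots> = (\<Oplus>j\<in>{..<n}. a i j \<otimes> (c \<odot>\<^bsub>V n\<^esub> x) j)"
      using that a closed by (intro R.finsum_cong'[OF refl]) (auto simp: smult_coord R.m_lcomm)
    finally show ?thesis ..
  qed
qed

lemma matrix_unit_vec:
  assumes "\<And>i j. \<lbrakk>i < m; j < n\<rbrakk> \<Longrightarrow> a i j \<in> carrier R" and ij: "i < m" "j < n"
  shows "(\<Oplus>l\<in>{..<n}. a i l \<otimes> unit_vec n j l) = a i j"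
proof -
  have "(\<Oplus>l\<in>{..<n}. a i l \<otimes> unit_vec n j l) = (\<Oplus>l\<in>{..<n}. if j = l then a i l else \<zero>)"
    using assms by (intro R.finsum_cong'[OF refl]) (auto simp: unit_vec_coord)
  also have "\<dots> = a i j" using assms by (intro R.add.finprod_singleton) auto
  finally show ?thesis .
qed

lemma linear_coord:
  assumes f: "f \<in> linear_maps R (V n) (V m)" and x: "x \<in> carrier (V n)" and i: "i < m"
  shows "f x i = (\<Oplus>j\<in>{..<n}. f (unit_vec n j) i \<otimes> x j)"
proof -
  let ?a = "\<lambda>i j. f (unit_vec n j) i"
  have a: "?a i j \<in> carrier R" if "i < m" for i j
    using V.linear_mapsD(1)[OF f unit_vec_closed] that by (rule std_coord_closed)
  have "f x = (\<lambda>i\<in>{..<m}. \<Oplus>j\<in>{..<n}. ?a i j \<otimes> x j)"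
  proof (rule linear_eq_on_basis[OF f matrix_linear std_module_is_module _ x])
    fix j assume j: "j < n"
    show "f (unit_vec n j) = (\<lambda>i\<in>{..<m}. \<Oplus>l\<in>{..<n}. ?a i l \<otimes> unit_vec n j l)"
    proof (rule std_eqI[of _ m])
      show "f (unit_vec n j) \<in> carrier (V m)" by (rule V.linear_mapsD(1)[OF f unit_vec_closed])
      show "(\<lambda>i\<in>{..<m}. \<Oplus>l\<in>{..<n}. ?a i l \<otimes> unit_vec n j l) \<in> carrier (V m)"
        using a std_coord_closed[OF unit_vec_closed] by (intro std_carrierI R.finsum_closed) auto
      fix i assume "i < m"
      then show "f (unit_vec n j) i = (\<lambda>i\<in>{..<m}. \<Oplus>l\<in>{..<n}. ?a i l \<otimes> unit_vec n j l) i"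
        using matrix_unit_vec[of m n ?a i j] a j by simp
    qed
  qed (use a in auto)
  then show ?thesis using i by simp
qed

lemma det_map_matrix: "det_map R n f = matrix_det n (\<lambda>i j. f (unit_vec n j) i)"
  by (simp add: det_map_def matrix_det_def perm_sign_def)

lemma det_map_cong:
  assumes "\<And>j. j < n \<Longrightarrow> f (unit_vec n j) = g (unit_vec n j)"
    and "\<And>j. j < n \<Longrightarrow> g (unit_vec n j) \<in> carrier (V n)"
  shows "det_map R n f = det_map R n g"
  unfolding det_map_matrix by (rule matrix_det_cong) (use assms(1) std_coord_closed[OF assms(2)] in auto)

lemma det_map_comp:
  assumes f: "f \<in> linear_maps R (V n) (V n)" and g: "g \<in> linear_maps R (V n) (V n)"
  shows "det_map R n (compose (carrier (V n)) g f) = det_map R n g \<otimes> det_map R n f"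
proof -
  let ?a = "\<lambda>i j. g (unit_vec n j) i" and ?b = "\<lambda>i j. f (unit_vec n j) i"
  have a: "?a i j \<in> carrier R" "?b i j \<in> carrier R" if "i < n" for i j
    using std_coord_closed[OF V.linear_mapsD(1)[OF g unit_vec_closed] that]
      std_coord_closed[OF V.linear_mapsD(1)[OF f unit_vec_closed] that] by auto
  have "det_map R n (compose (carrier (V n)) g f) =
      matrix_det n (\<lambda>i j. \<Oplus>k\<in>{..<n}. ?a i k \<otimes> ?b k j)"
    unfolding det_map_matrix
  proof (rule matrix_det_cong)
    fix i j assume "i < n" "j < n"
    then show "compose (carrier (V n)) g f (unit_vec n j) i = (\<Oplus>k\<in>{..<n}. ?a i k \<otimes> ?b k j)"
      using linear_coord[OF g V.linear_mapsD(1)[OF f unit_vec_closed]]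
      by (simp add: compose_def unit_vec_closed)
    show "(\<Oplus>k\<in>{..<n}. ?a i k \<otimes> ?b k j) \<in> carrier R"
      using a \<open>i < n\<close> by (intro R.finsum_closed) auto
  qed
  also have "\<dots> = det_map R n g \<otimes> det_map R n f"
    unfolding det_map_matrix using a by (intro matrix_det_mult) auto
  finally show ?thesis .
qed

lemma det_map_identity:
  assumes f: "\<And>j. j < n \<Longrightarrow> f (unit_vec n j) = unit_vec n j"
  shows "det_map R n f = \<one>"
proof -
  let ?term = "\<lambda>p. perm_sign p \<otimes> (\<Otimes>j\<in>{..<n}. unit_vec n j (p j))"
  let ?S = "{p. p permutes {..<n}}"
  have cl: "unit_vec n j (p j) \<in> carrier R" if "p \<in> ?S" "j < n" for p j
    using that perm_less[of p n j] by (simp add: unit_vec_coord)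
  have "det_map R n f = det_map R n (\<lambda>x. x)" using f unit_vec_closed by (intro det_map_cong) auto
  also have "\<dots> = (\<Oplus>p\<in>?S. ?term p)" unfolding det_map_matrix matrix_det_def ..
  also have "\<dots> = (\<Oplus>p\<in>{id}. ?term p)"
  proof (rule R.add.finprod_mono_neutral_cong_right[OF finite_perms])
    show "{id} \<subseteq> ?S" by (simp add: permutes_id)
    show "?term \<in> ?S \<rightarrow> carrier R" using cl by (auto intro!: m_closed finprod_closed)
    fix p assume p: "p \<in> ?S - {id}"
    then obtain j where j: "p j \<noteq> j" by (metis DiffE ext id_apply singletonI)
    then have jn: "j < n" using p permutes_not_in[of p "{..<n}" j] by auto
    have split: "{..<n} = insert j ({..<n} - {j})" using jn by auto
    have "(\<Otimes>i\<in>{..<n}. unit_vec n i (p i)) =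
        unit_vec n j (p j) \<otimes> (\<Otimes>i\<in>{..<n} - {j}. unit_vec n i (p i))"
      by (subst split, rule finprod_insert) (use cl p jn in auto)
    also have "\<dots> = \<zero>"
      using j jn p perm_less[of p n j] cl
      by (simp add: unit_vec_coord)
    finally show "?term p = \<zero>" by simp
  qed simp
  also have "\<dots> = \<one>"
  proof -
    have "(\<Otimes>j\<in>{..<n}. unit_vec n j j) = \<one>"
      by (intro R.finprod_one_eqI) (auto simp: unit_vec_coord)
    then show ?thesis by (simp add: perm_sign_def evenperm_id)
  qed
  finally show ?thesis .
qed

end

section \<open>The category VIC\<close>

locale vic_category = std_modules R for R :: "'r ring" (structure) +
  fixes U :: "'r set"
  assumes finite_R: "finite (carrier R)" and U: "subgroup U (units_of R)"
begin

lemma U_one: "\<one> \<in> U" and U_mult: "\<lbrakk>u \<in> U; v \<in> U\<rbrakk> \<Longrightarrow> u \<otimes> v \<in> U"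
  using subgroup.one_closed[OF U] subgroup.m_closed[OF U] by (auto simp: units_of_def)

lemma Hom_VIC: "Hom (VIC R U) n m = {(f, C) \<in> vic_hom R (V n) (V m). n = m \<longrightarrow> det_map R n f \<in> U}"
  and Obj_VIC: "Obj (VIC R U) = UNIV"
  and Id_VIC: "Id (VIC R U) n = vic_id (V n)"
  and Comp_VIC: "Comp (VIC R U) n m l \<psi> \<phi> = vic_comp (V n) (V l) \<psi> \<phi>"
  by (simp_all add: VIC_def)

lemma finite_Hom: "finite (Hom (VIC R U) n m)"
proof (rule finite_subset)
  show "Hom (VIC R U) n m \<subseteq> (carrier (V n) \<rightarrow>\<^sub>E carrier (V m)) \<times> Pow (carrier (V m))"
  proof (rule subsetI)
    fix \<phi> assume "\<phi> \<in> Hom (VIC R U) n m"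
    then obtain f C where \<phi>: "\<phi> = (f, C)" "(f, C) \<in> vic_hom R (V n) (V m)" by (auto simp: Hom_VIC)
    note fC = VV.vic_homD[OF \<phi>(2)]
    show "\<phi> \<in> (carrier (V n) \<rightarrow>\<^sub>E carrier (V m)) \<times> Pow (carrier (V m))"
      using V.submodule_closed(1)[OF fC(4)] V.linear_mapsD(1)[OF fC(1)] fC(2)
      by (auto simp: \<phi>(1) PiE_def)
  qed
  show "finite ((carrier (V n) \<rightarrow>\<^sub>E carrier (V m)) \<times> Pow (carrier (V m)))"
    using finite_std[OF finite_R] by (intro finite_cartesian_product finite_PiE) auto
qed

lemma Id_closed: "Id (VIC R U) n \<in> Hom (VIC R U) n n"
proof -
  have "det_map R n (fst (vic_id (V n))) = \<one>"
    by (rule det_map_identity) (simp add: vic_id_def unit_vec_closed)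
  then show ?thesis
    using vic_id_closed[OF std_module_is_module, of n] U_one
    by (auto simp: Hom_VIC Id_VIC split: prod.splits)
qed

text \<open>
  As \<open>R\<close> is finite, ranks can be compared by counting elements, unless \<open>R\<close> is the zero ring.
\<close>

lemma vic_hom_rank_le:
  assumes "(f, C) \<in> vic_hom R (V n) (V m)" and "\<one> \<noteq> \<zero>"
  shows "n \<le> m"
proof -
  have "{\<zero>, \<one>} \<subseteq> carrier R" by auto
  then have "card {\<zero>, \<one>} \<le> card (carrier R)" using finite_R by (intro card_mono)
  then have card: "2 \<le> card (carrier R)" using assms(2) by simp
  have "f ` carrier (V n) \<subseteq> carrier (V m)"
    using V.linear_mapsD(1)[OF VV.vic_homD(1)[OF assms(1)]] by auto
  then have "card (carrier (V n)) \<le> card (carrier (V m))"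
    using card_inj_on_le[OF VV.vic_homD(3)[OF assms(1)] _ finite_std[OF finite_R]] by blast
  then have "card (carrier R) ^ n \<le> card (carrier R) ^ m"
    by (simp add: carrier_std card_funcsetE)
  then show ?thesis using card by (simp add: power_increasing_iff)
qed

lemma Comp_closed:
  assumes \<phi>: "\<phi> \<in> Hom (VIC R U) n m" and \<psi>: "\<psi> \<in> Hom (VIC R U) m l"
  shows "Comp (VIC R U) n m l \<psi> \<phi> \<in> Hom (VIC R U) n l"
proof -
  obtain f C g D where eq: "\<phi> = (f, C)" "\<psi> = (g, D)" by fastforce
  have h: "(f, C) \<in> vic_hom R (V n) (V m)" "(g, D) \<in> vic_hom R (V m) (V l)"
    "n = m \<Longrightarrow> det_map R n f \<in> U" "m = l \<Longrightarrow> det_map R m g \<in> U"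
    using assms by (auto simp: Hom_VIC eq)
  let ?c = "compose (carrier (V n)) g f"
  \<comment> \<open>over the zero ring the rank of \<open>V m\<close> is not determined, but all determinants are \<open>\<one>\<close>\<close>
  have "det_map R n ?c \<in> U" if nl: "n = l"
  proof (cases "\<one> = \<zero>")
    case True
    then have "carrier R = {\<zero>}" using one_zeroD by blast
    moreover have "det_map R n ?c \<in> carrier R"
      unfolding det_map_matrix nl
      using V.linear_mapsD(1)[OF VV.vic_homD(1)] h nl unit_vec_closed
      by (intro matrix_det_closed std_coord_closed[of _ l]) (auto simp: compose_def)
    ultimately show ?thesis using U_one True by simp
  next
    case False
    then have "m = n" using vic_hom_rank_le[OF h(1)] vic_hom_rank_le[OF h(2)] nl by simp
    then show ?thesis
      using det_map_comp[of f n g] h VV.vic_homD(1)[OF h(1)] VV.vic_homD(1)[OF h(2)] nl U_mult by simp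
  qed
  moreover have "vic_comp (V n) (V l) (g, D) (f, C) \<in> vic_hom R (V n) (V l)"
    by (rule VVV.vic_comp_closed(1)[OF h(1,2)])
  ultimately show ?thesis
    using VVV.vic_comp_closed(3)[OF h(1,2)] by (auto simp: Hom_VIC Comp_VIC eq)
qed

end

section \<open>Morphisms of VIC as words\<close>

context std_modules
begin

text \<open>
  The columns are those of the matrix of the retraction. The rows are those of the matrix of the
  injection, written as functionals on \<open>R\<^sup>d\<close>.
\<close>

definition column :: "nat \<Rightarrow> nat \<Rightarrow> ((nat \<Rightarrow> 'r) \<Rightarrow> nat \<Rightarrow> 'r) \<times> (nat \<Rightarrow> 'r) set \<Rightarrow> nat \<Rightarrow> nat \<Rightarrow> 'r"
  where "column d n \<phi> l = retraction (V d) (V n) \<phi> (unit_vec n l)"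

definition row :: "nat \<Rightarrow> ((nat \<Rightarrow> 'r) \<Rightarrow> nat \<Rightarrow> 'r) \<times> (nat \<Rightarrow> 'r) set \<Rightarrow> nat \<Rightarrow> (nat \<Rightarrow> 'r) \<Rightarrow> 'r"
  where "row d \<phi> l = (\<lambda>v\<in>carrier (V d). fst \<phi> v l)"

lemma column_closed: "\<phi> \<in> vic_hom R (V d) (V n) \<Longrightarrow> column d n \<phi> l \<in> carrier (V d)"
  using V.linear_mapsD(1)[OF VV.retraction(1) unit_vec_closed] unfolding column_def by (cases \<phi>) auto

lemma row_closed: "\<lbrakk>\<phi> \<in> vic_hom R (V d) (V n); l < n\<rbrakk> \<Longrightarrow> row d \<phi> l \<in> carrier (V d) \<rightarrow>\<^sub>E carrier R"
  using std_coord_closed[OF V.linear_mapsD(1)[OF VV.vic_homD(1)]] unfolding row_def by (cases \<phi>) auto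

lemma retraction_eq_if_columns_eq:
  assumes "\<phi> \<in> vic_hom R (V d) (V n)" "\<psi> \<in> vic_hom R (V d) (V n)"
    and "\<And>l. l < n \<Longrightarrow> column d n \<phi> l = column d n \<psi> l" and "x \<in> carrier (V n)"
  shows "retraction (V d) (V n) \<phi> x = retraction (V d) (V n) \<psi> x"
proof -
  have "retraction (V d) (V n) \<phi> \<in> linear_maps R (V n) (V d)" if "\<phi> \<in> vic_hom R (V d) (V n)" for \<phi>
    using VV.retraction(1)[of "fst \<phi>" "snd \<phi>"] that by simp
  from linear_eq_on_basis[OF this[OF assms(1)] this[OF assms(2)] std_module_is_module _ assms(4)]
  show ?thesis using assms(3)[unfolded column_def] by blast
qed

text \<open>
  The columns determine the retraction, and with it the complement; the rows determine the injection.
\<close>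

lemma vic_hom_eqI:
  assumes \<phi>: "\<phi> \<in> vic_hom R (V d) (V n)" and \<psi>: "\<psi> \<in> vic_hom R (V d) (V n)"
    and columns: "\<And>l. l < n \<Longrightarrow> column d n \<phi> l = column d n \<psi> l"
    and rows: "\<And>l. l < n \<Longrightarrow> row d \<phi> l = row d \<psi> l"
  shows "\<phi> = \<psi>"
proof -
  obtain f C g D where eq: "\<phi> = (f, C)" "\<psi> = (g, D)" by fastforce
  note f = VV.vic_homD[OF \<phi>[unfolded eq]] and g = VV.vic_homD[OF \<psi>[unfolded eq]]
  have "f = g"
  proof (rule extensionalityI[OF f(2) g(2)])
    fix v assume v: "v \<in> carrier (V d)"
    show "f v = g v"
    proof (rule std_eqI[of _ n])
      show "f v \<in> carrier (V n)" "g v \<in> carrier (V n)"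
        using V.linear_mapsD(1)[OF f(1) v] V.linear_mapsD(1)[OF g(1) v] by auto
      show "f v l = g v l" if "l < n" for l
        using fun_cong[OF rows[OF that], of v] v by (simp add: row_def eq)
    qed
  qed
  moreover have "C = D"
  proof (rule Set.set_eqI)
    fix x
    show "x \<in> C \<longleftrightarrow> x \<in> D"
    proof (cases "x \<in> carrier (V n)")
      case True
      then show ?thesis
        using VV.retraction(3)[OF \<phi>[unfolded eq] True] VV.retraction(3)[OF \<psi>[unfolded eq] True]
          retraction_eq_if_columns_eq[OF \<phi> \<psi> columns True] unfolding eq by simp
    next
      case False
      then show ?thesis
        using V.submodule_closed(1)[OF f(4)] V.submodule_closed(1)[OF g(4)] by blast
    qed
  qed
  ultimately show ?thesis by (simp add: eq)
qed

lemma finsum_coord: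
  assumes "finite A" "f \<in> A \<rightarrow> carrier (V n)" "i < n"
  shows "(\<Oplus>\<^bsub>V n\<^esub>v\<in>A. f v) i = (\<Oplus>v\<in>A. f v i)"
  using assms(1,2)
proof (induction A)
  case empty
  then show ?case using assms(3) by (simp add: zero_coord)
next
  case (insert v A)
  have "(\<Oplus>\<^bsub>V n\<^esub>v\<in>insert v A. f v) = f v \<oplus>\<^bsub>V n\<^esub> (\<Oplus>\<^bsub>V n\<^esub>v\<in>A. f v)"
    using insert by (intro V.M.finsum_insert) auto
  moreover have "(\<Oplus>v\<in>insert v A. f v i) = f v i \<oplus> (\<Oplus>v\<in>A. f v i)"
    using insert std_coord_closed[OF _ assms(3)] by (intro R.finsum_insert) (auto simp: Pi_iff)
  ultimately show ?case using insert assms(3) by (simp add: add_coord)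
qed

lemma restrict_linear:
  "f \<in> linear_maps R (V n) W \<Longrightarrow> restrict f (carrier (V n)) \<in> linear_maps R (V n) W"
  unfolding linear_maps_def by auto

end

section \<open>Inserting letters into a word\<close>

text \<open>
  The word of \<open>\<psi>\<close> arises from that of \<open>\<phi>\<close> by inserting letters: \<open>\<iota>\<close> gives the new positions of the
  old letters. First occurrences of columns stay first occurrences (\<open>\<iota>_first\<close>) and no new columns
  appear, so each inserted column occurs further left. By \<open>row_sums\<close> the inserted rows that belong to
  a given column cancel.
\<close>

locale word_insertion = std_modules R for R :: "'r ring" (structure) +
  fixes d n m :: nat and \<phi> \<psi> :: "((nat \<Rightarrow> 'r) \<Rightarrow> nat \<Rightarrow> 'r) \<times> (nat \<Rightarrow> 'r) set" and \<iota> :: "nat \<Rightarrow> nat"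
  assumes \<phi>: "\<phi> \<in> vic_hom R (V d) (V n)" and \<psi>: "\<psi> \<in> vic_hom R (V d) (V m)"
    and \<iota>_mono: "strict_mono_on {..<n} \<iota>" and \<iota>_less: "l < n \<Longrightarrow> \<iota> l < m"
    and \<iota>_column: "l < n \<Longrightarrow> column d m \<psi> (\<iota> l) = column d n \<phi> l"
    and \<iota>_row: "l < n \<Longrightarrow> row d \<psi> (\<iota> l) = row d \<phi> l"
    and \<iota>_first: "\<lbrakk>l < n; \<And>j. j < l \<Longrightarrow> column d n \<phi> j \<noteq> column d n \<phi> l; i < \<iota> l\<rbrakk> \<Longrightarrow>
      column d m \<psi> i \<noteq> column d m \<psi> (\<iota> l)"
    and columns_subset: "column d m \<psi> ` {..<m} \<subseteq> column d n \<phi> ` {..<n}"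
    and row_sums: "\<lbrakk>c \<in> carrier (V d); v \<in> carrier (V d)\<rbrakk> \<Longrightarrow>
      (\<Oplus>i\<in>{i \<in> {..<m}. column d m \<psi> i = c}. fst \<psi> v i) =
      (\<Oplus>l\<in>{l \<in> {..<n}. column d n \<phi> l = c}. fst \<phi> v l)"
begin

definition inserted :: "nat set" where "inserted = {..<m} - \<iota> ` {..<n}"

text \<open>
  A left inverse of \<open>\<iota>\<close>: every inserted position is sent to the first position where its column occurs
  in \<open>\<phi>\<close>.
\<close>

definition \<kappa> :: "nat \<Rightarrow> nat"
  where "\<kappa> i = (if i \<in> inserted then LEAST l. column d n \<phi> l = column d m \<psi> i else inv_into {..<n} \<iota> i)"

lemma \<iota>_inj: "inj_on \<iota> {..<n}"
  using \<iota>_mono by (rule strict_mono_on_imp_inj_on)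

lemma \<iota>_notin_inserted: "l < n \<Longrightarrow> \<iota> l \<notin> inserted"
  by (auto simp: inserted_def)

lemma \<kappa>_\<iota>: "l < n \<Longrightarrow> \<kappa> (\<iota> l) = l"
  using \<iota>_inj \<iota>_notin_inserted by (simp add: \<kappa>_def inv_into_f_f)

lemma inserted_\<kappa>:
  assumes "i \<in> inserted"
  shows "\<kappa> i < n" "column d n \<phi> (\<kappa> i) = column d m \<psi> i"
    and "j < \<kappa> i \<Longrightarrow> column d n \<phi> j \<noteq> column d n \<phi> (\<kappa> i)"
proof -
  have \<kappa>: "\<kappa> i = (LEAST l. column d n \<phi> l = column d m \<psi> i)" using assms by (simp add: \<kappa>_def)
  obtain l where l: "l < n" "column d n \<phi> l = column d m \<psi> i"
    using assms columns_subset by (force simp: inserted_def)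
  show col: "column d n \<phi> (\<kappa> i) = column d m \<psi> i" unfolding \<kappa> using l(2) by (rule LeastI)
  have "\<kappa> i \<le> l" unfolding \<kappa> using l(2) by (rule Least_le)
  then show "\<kappa> i < n" using l(1) by simp
  show "column d n \<phi> j \<noteq> column d n \<phi> (\<kappa> i)" if "j < \<kappa> i"
    using not_less_Least[OF that[unfolded \<kappa>]] col by simp
qed

lemma not_inserted: "\<lbrakk>i < m; i \<notin> inserted\<rbrakk> \<Longrightarrow> \<exists>l<n. i = \<iota> l"
  by (auto simp: inserted_def)

lemma \<kappa>_less: "i < m \<Longrightarrow> \<kappa> i < n"
  using inserted_\<kappa>(1) not_inserted \<kappa>_\<iota> by metis

lemma \<kappa>_column: "i < m \<Longrightarrow> column d n \<phi> (\<kappa> i) = column d m \<psi> i"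
  using inserted_\<kappa>(2) not_inserted \<kappa>_\<iota> \<iota>_column by metis

text \<open>
  For inserted \<open>i\<close>, position \<open>\<kappa> i\<close> is a first occurrence in \<open>\<phi>\<close>, so \<open>\<iota> (\<kappa> i)\<close> is one in \<open>\<psi>\<close>, of the
  same column as position \<open>i\<close>.
\<close>

lemma \<iota>_\<kappa>_le: assumes "i < m" shows "\<iota> (\<kappa> i) \<le> i"
proof (cases "i \<in> inserted")
  case True
  note \<kappa> = inserted_\<kappa>[OF True]
  have "column d m \<psi> i = column d m \<psi> (\<iota> (\<kappa> i))" using \<kappa>(2) \<iota>_column[OF \<kappa>(1)] by simp
  then show ?thesis using \<iota>_first[OF \<kappa>(1,3)] by (metis linorder_not_less)
next
  case False
  then show ?thesis using not_inserted[OF assms] \<kappa>_\<iota> by auto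
qed

lemma \<kappa>_before: assumes "i < \<iota> q" "q < n" shows "\<kappa> i < q"
proof -
  have "i < m" using assms \<iota>_less[of q] by simp
  then have "\<iota> (\<kappa> i) < \<iota> q" "\<kappa> i < n"
    using le_less_trans[OF \<iota>_\<kappa>_le assms(1)] \<kappa>_less by blast+
  then show ?thesis
    using strict_mono_onD[OF \<iota>_mono, of q "\<kappa> i"] assms(2) by (metis lessThan_iff linorder_neqE_nat order_less_asym)
qed

definition ins :: "nat \<Rightarrow> nat set" where "ins l = {i \<in> inserted. \<kappa> i = l}"

lemma ins_finite: "finite (ins l)" and ins_subset: "ins l \<subseteq> {..<m}"
  by (auto simp: ins_def inserted_def)

lemma fibre_\<kappa>: "l < n \<Longrightarrow> {i \<in> {..<m}. \<kappa> i = l} = insert (\<iota> l) (ins l)"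
  using not_inserted \<kappa>_\<iota> \<iota>_less by (auto simp: ins_def inserted_def)

abbreviation "f \<equiv> fst \<phi>"
abbreviation "g \<equiv> fst \<psi>"
abbreviation "r \<equiv> retraction (V d) (V n) \<phi>"

lemma \<phi>_pair: "(f, snd \<phi>) \<in> vic_hom R (V d) (V n)" and \<psi>_pair: "(g, snd \<psi>) \<in> vic_hom R (V d) (V m)"
  using \<phi> \<psi> by simp_all

lemma r_linear: "r \<in> linear_maps R (V n) (V d)" and r_f: "v \<in> carrier (V d) \<Longrightarrow> r (f v) = v"
  using VV.retraction[OF \<phi>_pair] by simp_all

lemma f_linear: "f \<in> linear_maps R (V d) (V n)" and g_linear: "g \<in> linear_maps R (V d) (V m)"
  using VV.vic_homD(1)[OF \<phi>_pair] VV.vic_homD(1)[OF \<psi>_pair] by simp_all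

lemma g_closed: "\<lbrakk>v \<in> carrier (V d); i < m\<rbrakk> \<Longrightarrow> g v i \<in> carrier R"
  and f_closed: "\<lbrakk>v \<in> carrier (V d); l < n\<rbrakk> \<Longrightarrow> f v l \<in> carrier R"
  using std_coord_closed[OF V.linear_mapsD(1)[OF f_linear]]
    std_coord_closed[OF V.linear_mapsD(1)[OF g_linear]] by blast+

lemma g_\<iota>: "\<lbrakk>v \<in> carrier (V d); l < n\<rbrakk> \<Longrightarrow> g v (\<iota> l) = f v l"
  using fun_cong[OF \<iota>_row, of l v] by (simp add: row_def)

text \<open>
  If \<open>l\<close> is the first occurrence of its column \<open>c\<close>, then \<open>ins l\<close> consists of all inserted positions
  with column \<open>c\<close>, and their rows account for the difference of the row sums of \<open>\<psi>\<close> and \<open>\<phi>\<close> at \<open>c\<close>.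
  Otherwise \<open>ins l\<close> is empty.
\<close>

lemma inserted_rows_sum_zero:
  assumes v: "v \<in> carrier (V d)" and l: "l < n"
  shows "(\<Oplus>i\<in>ins l. g v i) = \<zero>"
proof (cases "\<forall>j<l. column d n \<phi> j \<noteq> column d n \<phi> l")
  case False
  have "i \<notin> ins l" for i
    using False inserted_\<kappa>(3)[of i] by (auto simp: ins_def)
  then have "ins l = {}" by blast
  then show ?thesis by simp
next
  case True
  let ?c = "column d n \<phi> l"
  let ?L = "{l \<in> {..<n}. column d n \<phi> l = ?c}"
  have ins: "ins l = {i \<in> inserted. column d m \<psi> i = ?c}"
  proof
    show "ins l \<subseteq> {i \<in> inserted. column d m \<psi> i = ?c}" using inserted_\<kappa>(2) by (auto simp: ins_def)
    show "{i \<in> inserted. column d m \<psi> i = ?c} \<subseteq> ins l"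
    proof
      fix i assume i: "i \<in> {i \<in> inserted. column d m \<psi> i = ?c}"
      note \<kappa> = inserted_\<kappa>[of i]
      have "\<not> \<kappa> i < l" using True \<kappa>(2) i by auto
      moreover have "\<not> l < \<kappa> i" using \<kappa>(2) \<kappa>(3)[of l] i by auto
      ultimately show "i \<in> ins l" using i by (auto simp: ins_def)
    qed
  qed
  have split: "{i \<in> {..<m}. column d m \<psi> i = ?c} = \<iota> ` ?L \<union> ins l"
    unfolding ins using not_inserted \<iota>_column \<iota>_less by (fastforce simp: inserted_def)
  have disj: "\<iota> ` ?L \<inter> ins l = {}" by (auto simp: ins inserted_def)
  have "?c \<in> carrier (V d)" using column_closed[OF \<phi>] .
  from row_sums[OF this v]
  have "(\<Oplus>l\<in>?L. f v l) = (\<Oplus>i\<in>\<iota> ` ?L \<union> ins l. g v i)" unfolding split by (rule sym)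
  also have "\<dots> = (\<Oplus>i\<in>\<iota> ` ?L. g v i) \<oplus> (\<Oplus>i\<in>ins l. g v i)"
    using disj ins_finite ins_subset[THEN subsetD] g_closed[OF v] \<iota>_less
    by (intro R.finsum_Un_disjoint) auto
  also have "(\<Oplus>i\<in>\<iota> ` ?L. g v i) = (\<Oplus>l\<in>?L. g v (\<iota> l))"
    using g_closed[OF v] \<iota>_less by (intro R.finsum_reindex inj_on_subset[OF \<iota>_inj]) auto
  also have "\<dots> = (\<Oplus>l\<in>?L. f v l)"
    using g_\<iota>[OF v] f_closed[OF v] by (intro R.finsum_cong'[OF refl]) auto
  finally have "(\<Oplus>l\<in>?L. f v l) = (\<Oplus>l\<in>?L. f v l) \<oplus> (\<Oplus>i\<in>ins l. g v i)" .
  moreover have "(\<Oplus>l\<in>?L. f v l) \<in> carrier R" using f_closed[OF v] by (intro R.finsum_closed) auto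
  moreover have "(\<Oplus>i\<in>ins l. g v i) \<in> carrier R"
    using g_closed[OF v] ins_subset by (intro R.finsum_closed) auto
  ultimately show ?thesis by simp
qed

text \<open>
  The linear map with \<open>e\<^sub>i \<mapsto> e\<^bsub>\<kappa> i\<^esub>\<close>, which becomes the retraction of the morphism from \<open>R\<^sup>n\<close> to \<open>R\<^sup>m\<close>.
\<close>

definition collapse :: "(nat \<Rightarrow> 'r) \<Rightarrow> nat \<Rightarrow> 'r"
  where "collapse y = (\<lambda>l\<in>{..<n}. \<Oplus>i\<in>{..<m}. (if \<kappa> i = l then \<one> else \<zero>) \<otimes> y i)"

lemma collapse_linear: "collapse \<in> linear_maps R (V m) (V n)"
  unfolding collapse_def by (rule matrix_linear) auto

lemma collapse_unit_vec: "i < m \<Longrightarrow> collapse (unit_vec m i) = unit_vec n (\<kappa> i)"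
  using matrix_unit_vec[of n m "\<lambda>l i. if \<kappa> i = l then \<one> else \<zero>"]
  by (intro std_eqI[of _ n] V.linear_mapsD(1)[OF collapse_linear] unit_vec_closed)
    (auto simp: collapse_def unit_vec_coord)

lemma collapse_coord:
  assumes y: "y \<in> carrier (V m)" and l: "l < n"
  shows "collapse y l = y (\<iota> l) \<oplus> (\<Oplus>i\<in>ins l. y i)"
proof -
  have cl: "y i \<in> carrier R" if "i < m" for i using std_coord_closed[OF y that] .
  have "collapse y l = (\<Oplus>i\<in>{i \<in> {..<m}. \<kappa> i = l}. y i)"
    using l cl unfolding collapse_def
    by (auto intro!: R.add.finprod_mono_neutral_cong_right split: if_splits)
  also have "\<dots> = y (\<iota> l) \<oplus> (\<Oplus>i\<in>ins l. y i)"
    unfolding fibre_\<kappa>[OF l] using ins_finite ins_subset cl \<iota>_less[OF l] \<iota>_notin_inserted[OF l]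
    by (intro R.finsum_insert) (auto simp: ins_def)
  finally show ?thesis .
qed

text \<open>
  The projection onto the kernel of \<open>collapse\<close> along the span of the unit vectors at the old
  positions.
\<close>

definition kernel_part :: "(nat \<Rightarrow> 'r) \<Rightarrow> nat \<Rightarrow> 'r"
  where "kernel_part y = (\<lambda>i\<in>{..<m}. if i \<in> inserted then y i else y i \<ominus> collapse y (\<kappa> i))"

lemma kernel_part_linear: "kernel_part \<in> linear_maps R (V m) (V m)"
  unfolding kernel_part_def
proof (rule std_linear_mapsI)
  note cl = std_coord_closed
  note cD = V.linear_mapsD[OF collapse_linear]
  note ccl = std_coord_closed[OF cD(1) \<kappa>_less]
  fix y i assume y: "y \<in> carrier (V m)" and i: "i < m"
  show "(if i \<in> inserted then y i else y i \<ominus> collapse y (\<kappa> i)) \<in> carrier R"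
    using cl[OF y i] ccl[OF y i] by simp
  fix c assume c: "c \<in> carrier R"
  have "collapse (c \<odot>\<^bsub>V m\<^esub> y) (\<kappa> i) = c \<otimes> collapse y (\<kappa> i)"
    using cD(3)[OF c y] smult_coord[OF \<kappa>_less[OF i]] by simp
  then show "(if i \<in> inserted then (c \<odot>\<^bsub>V m\<^esub> y) i else (c \<odot>\<^bsub>V m\<^esub> y) i \<ominus> collapse (c \<odot>\<^bsub>V m\<^esub> y) (\<kappa> i)) =
      c \<otimes> (if i \<in> inserted then y i else y i \<ominus> collapse y (\<kappa> i))"
    using cl[OF y i] ccl[OF y i] i c by (simp add: smult_coord a_minus_def R.r_distr R.r_minus)
next
  note cl = std_coord_closed
  note cD = V.linear_mapsD[OF collapse_linear]
  note ccl = std_coord_closed[OF cD(1) \<kappa>_less]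
  fix x y i assume x: "x \<in> carrier (V m)" and y: "y \<in> carrier (V m)" and i: "i < m"
  have "collapse (x \<oplus>\<^bsub>V m\<^esub> y) (\<kappa> i) = collapse x (\<kappa> i) \<oplus> collapse y (\<kappa> i)"
    using cD(2)[OF x y] add_coord[OF \<kappa>_less[OF i]] by simp
  then show "(if i \<in> inserted then (x \<oplus>\<^bsub>V m\<^esub> y) i else (x \<oplus>\<^bsub>V m\<^esub> y) i \<ominus> collapse (x \<oplus>\<^bsub>V m\<^esub> y) (\<kappa> i)) =
      (if i \<in> inserted then x i else x i \<ominus> collapse x (\<kappa> i)) \<oplus>
      (if i \<in> inserted then y i else y i \<ominus> collapse y (\<kappa> i))"
    using cl[OF x i] ccl[OF x i] cl[OF y i] ccl[OF y i] i
    by (simp add: add_coord a_minus_def R.minus_add R.a_ac)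
qed

lemma kernel_part_coord:
  "i \<in> inserted \<Longrightarrow> kernel_part y i = y i"
  "l < n \<Longrightarrow> kernel_part y (\<iota> l) = y (\<iota> l) \<ominus> collapse y l"
  using \<iota>_less \<kappa>_\<iota> \<iota>_notin_inserted by (auto simp: kernel_part_def inserted_def)

lemma collapse_kernel_part:
  assumes y: "y \<in> carrier (V m)"
  shows "collapse (kernel_part y) = \<zero>\<^bsub>V n\<^esub>"
proof (rule std_eqI[of _ n])
  note k = V.linear_mapsD(1)[OF kernel_part_linear y]
  note cy = V.linear_mapsD(1)[OF collapse_linear y]
  show "collapse (kernel_part y) \<in> carrier (V n)" by (rule V.linear_mapsD(1)[OF collapse_linear k])
  fix l assume l: "l < n"
  have cl: "y i \<in> carrier R" if "i < m" for i using std_coord_closed[OF y that] .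
  have sum: "(\<Oplus>i\<in>ins l. y i) \<in> carrier R" using cl ins_subset by (intro R.finsum_closed) auto
  have "(\<Oplus>i\<in>ins l. kernel_part y i) = (\<Oplus>i\<in>ins l. y i)"
    using cl ins_subset by (intro R.finsum_cong'[OF refl]) (auto simp: ins_def kernel_part_coord)
  then have "collapse (kernel_part y) l = (y (\<iota> l) \<ominus> collapse y l) \<oplus> (\<Oplus>i\<in>ins l. y i)"
    using collapse_coord[OF k l] kernel_part_coord(2)[OF l] by simp
  also have "\<dots> = (y (\<iota> l) \<oplus> (\<Oplus>i\<in>ins l. y i)) \<ominus> collapse y l"
    using cl[OF \<iota>_less[OF l]] sum std_coord_closed[OF cy l] by (simp add: a_minus_def R.a_ac)
  also have "\<dots> = \<zero>"
    using collapse_coord[OF y l] std_coord_closed[OF cy l] by (simp add: a_minus_def R.r_neg)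
  finally show "collapse (kernel_part y) l = \<zero>\<^bsub>V n\<^esub> l" using l by (simp add: zero_coord)
qed simp

abbreviation kernel :: "(nat \<Rightarrow> 'r) set"
  where "kernel \<equiv> {y \<in> carrier (V m). collapse y = \<zero>\<^bsub>V n\<^esub>}"

text \<open>
  The vectors \<open>e\<^sub>i - e\<^sub>j\<close> with \<open>i\<close> inserted and \<open>j = \<iota> (\<kappa> i)\<close> form a basis of the kernel. They are the
  images of the unit vectors under \<open>kernel_part\<close>, which kills the other unit vectors, and they are
  independent because the coordinates of \<open>e\<^sub>i - e\<^sub>j\<close> at the inserted positions are those of \<open>e\<^sub>i\<close>.
\<close>

lemma kernel_free: "free_module R (V m\<lparr>carrier := kernel\<rparr>)"
proof -
  note kD = V.linear_mapsD[OF kernel_part_linear]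
  let ?u = "\<lambda>i. kernel_part (unit_vec m i)"
  let ?B = "?u ` inserted"
  have B: "?B \<subseteq> kernel" using kD(1)[OF unit_vec_closed] collapse_kernel_part[OF unit_vec_closed] by auto
  have u_coord: "?u j i = (if i = j then \<one> else \<zero>)" if "i \<in> inserted" for i j
    using that by (simp add: kernel_part_coord unit_vec_coord inserted_def)
  have "lin_indep R (V m) ?B"
    unfolding lin_indep_def
  proof (intro allI impI ballI)
    fix A a w assume A: "finite A" "A \<subseteq> ?B" and a: "a \<in> A \<rightarrow> carrier R" and w: "w \<in> A"
      and sum: "(\<Oplus>\<^bsub>V m\<^esub>v\<in>A. a v \<odot>\<^bsub>V m\<^esub> v) = \<zero>\<^bsub>V m\<^esub>"
    obtain i where i: "i \<in> inserted" "w = ?u i" using w A by blast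
    have im: "i < m" using i by (simp add: inserted_def)
    have cl: "a v \<odot>\<^bsub>V m\<^esub> v \<in> carrier (V m)" if "v \<in> A" for v
    proof -
      have "a v \<in> carrier R" "v \<in> carrier (V m)" using that a A(2) B by blast+
      then show ?thesis by simp
    qed
    have "\<zero> = (\<Oplus>v\<in>A. (a v \<odot>\<^bsub>V m\<^esub> v) i)"
      using finsum_coord[OF A(1) _ im, of "\<lambda>v. a v \<odot>\<^bsub>V m\<^esub> v"] cl sum im by (simp add: zero_coord)
    also have "\<dots> = (\<Oplus>v\<in>A. if w = v then a v else \<zero>)"
    proof (rule R.finsum_cong'[OF refl])
      show "(\<lambda>v. if w = v then a v else \<zero>) \<in> A \<rightarrow> carrier R" using a by auto
      fix v assume v: "v \<in> A"
      then obtain j where j: "j \<in> inserted" "v = ?u j" using A by blast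
      have "a v \<in> carrier R" using a v by blast
      then show "(a v \<odot>\<^bsub>V m\<^esub> v) i = (if w = v then a v else \<zero>)"
      proof (cases "w = v")
        case True
        then show ?thesis
          using u_coord[OF i(1), of i] i(2) im \<open>a v \<in> carrier R\<close> by (simp add: smult_coord)
      next
        case False
        then have "i \<noteq> j" using i(2) j(2) by blast
        then show ?thesis
          using u_coord[OF i(1), of j] j(2) im False \<open>a v \<in> carrier R\<close> by (simp add: smult_coord)
      qed
    qed
    also have "\<dots> = a w" using w A(1) a by (intro R.add.finprod_singleton) auto
    finally show "a w = \<zero>" ..
  qed
  moreover have "kernel \<subseteq> lin_span R (V m) ?B"
  proof
    fix y assume y: "y \<in> kernel"
    have ym: "y \<in> carrier (V m)" using y by simp
    have BV: "?B \<subseteq> carrier (V m)" using B by blast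
    have sub: "submodule (lin_span R (V m) ?B) R (V m)" by (rule V.lin_span_submodule[OF BV])
    \<comment> \<open>elements of the kernel are fixed by the projection, hence spanned by images of unit vectors\<close>
    have "kernel_part y = y"
    proof (rule std_eqI[OF kD(1)[OF ym] ym])
      fix i assume i: "i < m"
      have "collapse y (\<kappa> i) = \<zero>" using y zero_coord[OF \<kappa>_less[OF i]] by simp
      then show "kernel_part y i = y i"
        using i std_coord_closed[OF ym i] by (simp add: kernel_part_def a_minus_def)
    qed
    moreover have "?u i \<in> lin_span R (V m) ?B" if i: "i < m" for i
    proof (cases "i \<in> inserted")
      case True
      then show ?thesis by (intro V.lin_span_base[OF BV]) auto
    next
      case False
      then obtain l where l: "l < n" "i = \<iota> l" using not_inserted i by blast
      have "?u i = \<zero>\<^bsub>V m\<^esub>"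
      proof (rule std_eqI[OF kD(1)[OF unit_vec_closed] V.M.zero_closed])
        fix j assume j: "j < m"
        show "?u i j = \<zero>\<^bsub>V m\<^esub> j"
        proof (cases "j \<in> inserted")
          case True
          then show ?thesis using u_coord[of j i] False j by (auto simp: zero_coord)
        next
          case jn: False
          then obtain l' where l': "l' < n" "j = \<iota> l'" using not_inserted j by blast
          have "collapse (unit_vec m i) l' = unit_vec n l l'"
            using collapse_unit_vec[OF i] \<kappa>_\<iota>[OF l(1)] l(2) by simp
          moreover have "\<iota> l' = \<iota> l \<longleftrightarrow> l' = l"
            using inj_on_eq_iff[OF \<iota>_inj] l(1) l'(1) by simp
          ultimately show ?thesis
            using kernel_part_coord(2)[OF l'(1)] l' l j
            by (simp add: unit_vec_coord zero_coord a_minus_def R.r_neg)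
        qed
      qed
      then show ?thesis by (simp add: lin_span.zero)
    qed
    then have "kernel_part ` (unit_vec m ` {..<m}) \<subseteq> lin_span R (V m) ?B" by auto
    then have "kernel_part y \<in> lin_span R (V m) (lin_span R (V m) ?B)"
      using std_spanned[THEN subsetD, OF ym] unit_vec_closed
      by (intro V.linear_maps_lin_span[OF kernel_part_linear std_module_is_module, of "unit_vec m ` {..<m}"])
        auto
    ultimately show "y \<in> lin_span R (V m) ?B"
      using V.lin_span_minimal[OF sub order_refl] by auto
  qed
  ultimately show ?thesis
    using V.free_submodule_iff[OF VV.kernel_submodule[OF collapse_linear]] B by blast
qed

text \<open>
  Old coordinates are copied. The rows of \<open>\<psi>\<close> at the inserted positions, composed with the retraction
  of \<open>\<phi>\<close>, provide the new coordinates, so that composing with \<open>f\<close> gives back the rows of \<open>\<psi>\<close>.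
\<close>

definition insertion_map :: "(nat \<Rightarrow> 'r) \<Rightarrow> nat \<Rightarrow> 'r"
  where "insertion_map = (\<lambda>x\<in>carrier (V n). \<lambda>i\<in>{..<m}. if i \<in> inserted then g (r x) i else x (\<kappa> i))"

lemma insertion_map_coord:
  assumes "x \<in> carrier (V n)"
  shows "i \<in> inserted \<Longrightarrow> insertion_map x i = g (r x) i" "l < n \<Longrightarrow> insertion_map x (\<iota> l) = x l"
  using assms \<iota>_less \<kappa>_\<iota> \<iota>_notin_inserted by (auto simp: insertion_map_def inserted_def)

lemma insertion_map_linear: "insertion_map \<in> linear_maps R (V n) (V m)"
  unfolding insertion_map_def
proof (intro restrict_linear std_linear_mapsI)
  note rD = V.linear_mapsD[OF r_linear] and gD = V.linear_mapsD[OF g_linear]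
  note cl = std_coord_closed[OF _ \<kappa>_less]
  fix x i assume x: "x \<in> carrier (V n)" and i: "i < m"
  show "(if i \<in> inserted then g (r x) i else x (\<kappa> i)) \<in> carrier R"
    using cl[OF x i] g_closed[OF rD(1)[OF x] i] by simp
  fix c assume c: "c \<in> carrier R"
  show "(if i \<in> inserted then g (r (c \<odot>\<^bsub>V n\<^esub> x)) i else (c \<odot>\<^bsub>V n\<^esub> x) (\<kappa> i)) =
      c \<otimes> (if i \<in> inserted then g (r x) i else x (\<kappa> i))"
    using rD(3)[OF c x] gD(3)[OF c rD(1)[OF x]] i smult_coord[OF \<kappa>_less[OF i]] by (simp add: smult_coord)
next
  note rD = V.linear_mapsD[OF r_linear] and gD = V.linear_mapsD[OF g_linear]
  fix x y i assume x: "x \<in> carrier (V n)" and y: "y \<in> carrier (V n)" and i: "i < m"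
  show "(if i \<in> inserted then g (r (x \<oplus>\<^bsub>V n\<^esub> y)) i else (x \<oplus>\<^bsub>V n\<^esub> y) (\<kappa> i)) =
      (if i \<in> inserted then g (r x) i else x (\<kappa> i)) \<oplus> (if i \<in> inserted then g (r y) i else y (\<kappa> i))"
    using rD(2)[OF x y] gD(2)[OF rD(1)[OF x] rD(1)[OF y]] i add_coord[OF \<kappa>_less[OF i]]
    by (simp add: add_coord)
qed

text \<open>
  The coordinate \<open>l\<close> of the composite is \<open>x l\<close> plus the sum over \<open>ins l\<close> of the inserted rows, evaluated
  at \<open>r x\<close>.
\<close>

lemma collapse_insertion_map:
  assumes x: "x \<in> carrier (V n)"
  shows "collapse (insertion_map x) = x"
proof (rule std_eqI[OF _ x])
  note hx = V.linear_mapsD(1)[OF insertion_map_linear x]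
  show "collapse (insertion_map x) \<in> carrier (V n)" by (rule V.linear_mapsD(1)[OF collapse_linear hx])
  fix l assume l: "l < n"
  have rx: "r x \<in> carrier (V d)" by (rule V.linear_mapsD(1)[OF r_linear x])
  have "(\<Oplus>i\<in>ins l. insertion_map x i) = (\<Oplus>i\<in>ins l. g (r x) i)"
    using g_closed[OF rx] ins_subset x
    by (intro R.finsum_cong'[OF refl]) (auto simp: ins_def insertion_map_coord)
  also have "\<dots> = \<zero>" by (rule inserted_rows_sum_zero[OF rx l])
  finally show "collapse (insertion_map x) l = x l"
    using collapse_coord[OF hx l] insertion_map_coord(2)[OF x l] std_coord_closed[OF x l] by simp
qed

lemma insertion_map_vic_hom: "(insertion_map, kernel) \<in> vic_hom R (V n) (V m)"
  using collapse_insertion_map kernel_free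
  by (intro VV.vic_homI[OF insertion_map_linear _ collapse_linear]) (auto simp: insertion_map_def)

lemma retraction_insertion_map: "y \<in> carrier (V m) \<Longrightarrow> retraction (V n) (V m) (insertion_map, kernel) y = collapse y"
  using collapse_insertion_map by (intro VV.retraction_eqI[OF insertion_map_vic_hom collapse_linear]) auto

context
  fixes b \<chi> assumes \<chi>: "\<chi> \<in> vic_hom R (V b) (V n)"
begin

lemma comp_closed: "vic_comp (V b) (V m) (insertion_map, kernel) \<chi> \<in> vic_hom R (V b) (V m)"
  using VVV.vic_comp_closed(1)[of "fst \<chi>" "snd \<chi>", OF _ insertion_map_vic_hom] \<chi> by simp

lemma comp_column:
  assumes "i < m"
  shows "column b m (vic_comp (V b) (V m) (insertion_map, kernel) \<chi>) i = column b n \<chi> (\<kappa> i)"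
  using VVV.vic_comp_closed(2)[of "fst \<chi>" "snd \<chi>", OF _ insertion_map_vic_hom unit_vec_closed] \<chi>
    retraction_insertion_map[OF unit_vec_closed] collapse_unit_vec[OF assms]
  by (simp add: column_def)

lemma fst_comp:
  "v \<in> carrier (V b) \<Longrightarrow> fst (vic_comp (V b) (V m) (insertion_map, kernel) \<chi>) v = insertion_map (fst \<chi> v)"
  by (cases \<chi>) (simp add: vic_comp_def compose_def)

lemma \<chi>_closed: "v \<in> carrier (V b) \<Longrightarrow> fst \<chi> v \<in> carrier (V n)"
  using V.linear_mapsD(1)[OF VV.vic_homD(1)[of "fst \<chi>" "snd \<chi>"]] \<chi> by simp

lemma comp_row_\<iota>:
  assumes "l < n"
  shows "row b (vic_comp (V b) (V m) (insertion_map, kernel) \<chi>) (\<iota> l) = row b \<chi> l"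
  unfolding row_def using fst_comp insertion_map_coord(2)[OF \<chi>_closed assms] by (intro restrict_ext) simp

end

text \<open>
  Equal columns mean equal retractions, so the retraction of \<open>\<phi>\<close> inside \<open>insertion_map\<close> undoes the
  injection of \<open>\<chi>\<close>, and the row of \<open>\<psi>\<close> remains.
\<close>

lemma comp_row_inserted:
  assumes \<chi>: "\<chi> \<in> vic_hom R (V d) (V n)" and columns: "\<And>l. l < n \<Longrightarrow> column d n \<chi> l = column d n \<phi> l"
    and i: "i \<in> inserted"
  shows "row d (vic_comp (V d) (V m) (insertion_map, kernel) \<chi>) i = row d \<psi> i"
  unfolding row_def
proof (rule restrict_ext)
  fix v assume v: "v \<in> carrier (V d)"
  have "fst (vic_comp (V d) (V m) (insertion_map, kernel) \<chi>) v i = g (r (fst \<chi> v)) i"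
    using fst_comp[OF \<chi> v] insertion_map_coord(1)[OF \<chi>_closed[OF \<chi> v] i] by simp
  also have "r (fst \<chi> v) = retraction (V d) (V n) \<chi> (fst \<chi> v)"
    using retraction_eq_if_columns_eq[OF \<chi> \<phi> columns \<chi>_closed[OF \<chi> v]] by simp
  also have "\<dots> = v" using VV.retraction(2)[of "fst \<chi>" "snd \<chi>"] \<chi> v by simp
  finally show "fst (vic_comp (V d) (V m) (insertion_map, kernel) \<chi>) v i = g v i" .
qed

lemma comp_row:
  assumes \<chi>: "\<chi> \<in> vic_hom R (V d) (V n)" and columns: "\<And>l. l < n \<Longrightarrow> column d n \<chi> l = column d n \<phi> l"
    and "i < m" and "i \<notin> inserted \<Longrightarrow> row d \<chi> (\<kappa> i) = row d \<phi> (\<kappa> i)"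
  shows "row d (vic_comp (V d) (V m) (insertion_map, kernel) \<chi>) i = row d \<psi> i"
proof (cases "i \<in> inserted")
  case True
  then show ?thesis using comp_row_inserted[OF \<chi> columns] by blast
next
  case False
  then obtain l where l: "l < n" "i = \<iota> l" using not_inserted assms(3) by blast
  then show ?thesis using comp_row_\<iota>[OF \<chi> l(1)] assms(4)[OF False] \<iota>_row[OF l(1)] \<kappa>_\<iota>[OF l(1)] by simp
qed

lemma comp_eq: "vic_comp (V d) (V m) (insertion_map, kernel) \<phi> = \<psi>"
  using comp_column[OF \<phi>] \<kappa>_column comp_row[OF \<phi>]
  by (intro vic_hom_eqI[OF comp_closed[OF \<phi>] \<psi>]) auto

end

section \<open>Orders on morphisms\<close>

context std_modules
begin

text \<open>
  The Boolean marks the first occurrence of each column. Since letters are preserved by the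
  subsequence relation, first occurrences go to first occurrences.
\<close>

definition word ::
  "nat \<Rightarrow> nat \<Rightarrow> ((nat \<Rightarrow> 'r) \<Rightarrow> nat \<Rightarrow> 'r) \<times> (nat \<Rightarrow> 'r) set \<Rightarrow>
    ((nat \<Rightarrow> 'r) \<times> ((nat \<Rightarrow> 'r) \<Rightarrow> 'r) \<times> bool) list"
  where "word d n \<phi> = map (\<lambda>l. (column d n \<phi> l, row d \<phi> l,
    \<forall>j<l. column d n \<phi> j \<noteq> column d n \<phi> l)) [0..<n]"

text \<open>
  The data, apart from the word, that must agree for an insertion to be a composition: the set of
  columns, and for each column the sum of its rows.
\<close>

definition colour ::
  "nat \<Rightarrow> nat \<Rightarrow> ((nat \<Rightarrow> 'r) \<Rightarrow> nat \<Rightarrow> 'r) \<times> (nat \<Rightarrow> 'r) set \<Rightarrow>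
    (nat \<Rightarrow> 'r) set \<times> ((nat \<Rightarrow> 'r) \<Rightarrow> (nat \<Rightarrow> 'r) \<Rightarrow> 'r)"
  where "colour d n \<phi> = (column d n \<phi> ` {..<n},
    \<lambda>c\<in>carrier (V d). \<lambda>v\<in>carrier (V d).
      \<Oplus>l\<in>{l \<in> {..<n}. column d n \<phi> l = c}. fst \<phi> v l)"

lemma length_word [simp]: "length (word d n \<phi>) = n"
  by (simp add: word_def)

lemma word_nth: "l < n \<Longrightarrow> word d n \<phi> ! l = (column d n \<phi> l, row d \<phi> l,
    \<forall>j<l. column d n \<phi> j \<noteq> column d n \<phi> l)"
  by (simp add: word_def)

lemma word_insertion_exists:
  assumes \<phi>: "\<phi> \<in> vic_hom R (V d) (V n)" and \<psi>: "\<psi> \<in> vic_hom R (V d) (V m)"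
    and colour: "colour d n \<phi> = colour d m \<psi>" and sub: "subseq (word d n \<phi>) (word d m \<psi>)"
  shows "\<exists>\<iota>. word_insertion R d n m \<phi> \<psi> \<iota>"
proof -
  obtain \<iota> where \<iota>: "strict_mono_on {..<n} \<iota>"
    "\<And>l. l < n \<Longrightarrow> \<iota> l < m \<and> word d m \<psi> ! \<iota> l = word d n \<phi> ! l"
    using subseq_positions[OF sub] by (metis length_word)
  have letters: "column d m \<psi> (\<iota> l) = column d n \<phi> l" "row d \<psi> (\<iota> l) = row d \<phi> l"
    "(\<forall>i<\<iota> l. column d m \<psi> i \<noteq> column d m \<psi> (\<iota> l)) \<longleftrightarrow>
      (\<forall>j<l. column d n \<phi> j \<noteq> column d n \<phi> l)" if "l < n" for l
    using \<iota>(2)[OF that] word_nth[OF that, of d \<phi>] word_nth[of "\<iota> l" m d \<psi>] by auto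
  have "word_insertion R d n m \<phi> \<psi> \<iota>"
  proof (intro word_insertion.intro word_insertion_axioms.intro)
    show "std_modules R" by (rule std_modules_axioms)
    show "column d m \<psi> ` {..<m} \<subseteq> column d n \<phi> ` {..<n}"
      using colour by (simp add: colour_def)
    fix c v assume cv: "c \<in> carrier (V d)" "v \<in> carrier (V d)"
    have "snd (colour d m \<psi>) c v = snd (colour d n \<phi>) c v" using colour by simp
    then show "(\<Oplus>i\<in>{i \<in> {..<m}. column d m \<psi> i = c}. fst \<psi> v i) =
        (\<Oplus>l\<in>{l \<in> {..<n}. column d n \<phi> l = c}. fst \<phi> v l)"
      using cv by (simp add: colour_def)
  next
    fix l i assume "l < n" "\<And>j. j < l \<Longrightarrow> column d n \<phi> j \<noteq> column d n \<phi> l" "i < \<iota> l"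
    then show "column d m \<psi> i \<noteq> column d m \<psi> (\<iota> l)" using letters(3) by blast
  qed (use \<phi> \<psi> \<iota> letters in auto)
  then show ?thesis by blast
qed

text \<open>
  Keys are compared lexicographically by \<open>less_fun\<close>: position \<open>0\<close> holds the number of the generator
  \<open>p\<close>, whose first component is the rank of its object, the next \<open>n\<close> positions hold the columns,
  and the following \<open>n\<close> positions hold the rows of \<open>\<chi>\<close>.
\<close>

definition key ::
  "(nat \<times> 'm \<Rightarrow> nat) \<Rightarrow> nat \<Rightarrow> (nat \<times> 'm) \<times> ((nat \<Rightarrow> 'r) \<Rightarrow> nat \<Rightarrow> 'r) \<times> (nat \<Rightarrow> 'r) set \<Rightarrow> nat \<Rightarrow> nat"
  where "key e n = (\<lambda>(p, \<chi>) k.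
    if k = 0 then e p
    else if k \<le> n then to_nat_on (carrier (V (fst p))) (column (fst p) n \<chi> (k - 1))
    else if k \<le> 2 * n then to_nat_on (carrier (V (fst p)) \<rightarrow>\<^sub>E carrier R) (row (fst p) \<chi> (k - 1 - n))
    else 0)"

lemma key_simps:
  "key e n (p, \<chi>) 0 = e p"
  "l < n \<Longrightarrow> key e n (p, \<chi>) (Suc l) = to_nat_on (carrier (V (fst p))) (column (fst p) n \<chi> l)"
  "l < n \<Longrightarrow> key e n (p, \<chi>) (Suc (n + l)) =
    to_nat_on (carrier (V (fst p)) \<rightarrow>\<^sub>E carrier R) (row (fst p) \<chi> l)"
  "2 * n < k \<Longrightarrow> key e n (p, \<chi>) k = 0"
  by (auto simp: key_def)

lemma position_cases:
  fixes k n :: nat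
  obtains "k = 0" | l where "l < n" "k = Suc l" | l where "l < n" "k = Suc (n + l)" | "2 * n < k"
proof -
  consider "k = 0" | "0 < k" "k \<le> n" | "n < k" "k \<le> 2 * n" | "2 * n < k" by linarith
  then show thesis
  proof cases
    case 2
    then show thesis by (intro that(2)[of "k - 1"]) auto
  next
    case 3
    then show thesis by (intro that(3)[of "k - 1 - n"]) auto
  qed (use that in auto)
qed

context
  assumes finite_R: "finite (carrier R)"
begin

lemma key_eqD:
  assumes "\<phi> \<in> vic_hom R (V (fst p)) (V n)" "\<chi> \<in> vic_hom R (V (fst p)) (V n)" "l < n"
  shows "key e n (p, \<chi>) (Suc l) = key e n (p, \<phi>) (Suc l) \<Longrightarrow>
      column (fst p) n \<chi> l = column (fst p) n \<phi> l"
    and "key e n (p, \<chi>) (Suc (n + l)) = key e n (p, \<phi>) (Suc (n + l)) \<Longrightarrow>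
      row (fst p) \<chi> l = row (fst p) \<phi> l"
  using assms column_closed row_closed
    to_nat_on_inj[OF countable_finite[OF finite_std[OF finite_R]]]
    to_nat_on_inj[OF countable_finite[OF finite_functionals[OF finite_R]]]
  by (auto simp: key_simps)

lemma key_inj:
  assumes "\<phi> \<in> vic_hom R (V (fst p)) (V n)" "\<chi> \<in> vic_hom R (V (fst p)) (V n)"
    and eq: "key e n (p, \<chi>) = key e n (p, \<phi>)"
  shows "\<chi> = \<phi>"
  using key_eqD[OF assms(1,2)] fun_cong[OF eq] by (intro vic_hom_eqI[OF assms(2,1)]) blast+

lemma key_total:
  assumes e: "inj_on e G" and x: "fst x \<in> G" "snd x \<in> vic_hom R (V (fst (fst x))) (V n)"
    and y: "fst y \<in> G" "snd y \<in> vic_hom R (V (fst (fst y))) (V n)"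
  shows "less_fun (key e n x) (key e n y) \<or> x = y \<or> less_fun (key e n y) (key e n x)"
proof -
  obtain p \<chi> where px: "x = (p, \<chi>)" by (cases x)
  obtain q \<phi> where qy: "y = (q, \<phi>)" by (cases y)
  note xy = px qy
  have "key e n x k = key e n y k" if "2 * n < k" for k using that by (simp add: xy key_simps)
  then have "{k. key e n x k \<noteq> key e n y k} \<subseteq> {..2 * n}"
    by (metis (mono_tags) atMost_iff linorder_not_le mem_Collect_eq subsetI)
  then have "finite {k. key e n x k \<noteq> key e n y k}" by (rule finite_subset) simp
  moreover have "x = y" if eq: "key e n x = key e n y"
  proof -
    have "e p = e q" using fun_cong[OF eq, of 0] by (simp add: xy key_simps)
    then have "p = q" using inj_onD[OF e] x(1) y(1) by (simp add: xy)
    then show ?thesis using key_inj[of \<phi> p n \<chi> e] eq x(2) y(2) by (simp add: xy)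
  qed
  ultimately show ?thesis using less_fun_trichotomy[of "key e n x" "key e n y"] by blast
qed

end

end

text \<open>
  Column \<open>i\<close> of the composite is column \<open>\<kappa> i\<close> of \<open>\<chi>\<close>, and \<open>\<kappa> i < l\<close> for \<open>i < \<iota> l\<close>. So a first difference
  in column \<open>l\<close> becomes a first difference in column \<open>\<iota> l\<close>. If all columns agree, inserted rows of
  the composite equal those of \<open>\<psi>\<close>, and a first difference in row \<open>l\<close> moves to row \<open>\<iota> l\<close>.
\<close>

lemma (in word_insertion) key_mono:
  assumes fin: "finite (carrier R)" and d: "fst p = d" and q: "e q = e p \<Longrightarrow> q = p"
    and \<chi>: "\<chi> \<in> vic_hom R (V (fst q)) (V n)"
    and less: "less_fun (key e n (q, \<chi>)) (key e n (p, \<phi>))"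
  shows "less_fun (key e m (q, vic_comp (V (fst q)) (V m) (insertion_map, kernel) \<chi>)) (key e m (p, \<psi>))"
proof -
  let ?\<chi>' = "vic_comp (V (fst q)) (V m) (insertion_map, kernel) \<chi>"
  obtain k where k: "key e n (q, \<chi>) k < key e n (p, \<phi>) k"
    "\<And>j. j < k \<Longrightarrow> key e n (q, \<chi>) j = key e n (p, \<phi>) j"
    using less_funE[OF less] by metis
  show ?thesis
  proof (cases rule: position_cases[where k = k and n = n])
    case 1
    then show ?thesis using k(1) by (intro less_funI exI[of _ 0]) (simp add: key_simps)
  next
    case 4
    then show ?thesis using k(1) by (simp add: key_simps)
  next
    case (2 l)
    have qp: "q = p" using k(2)[of 0] 2 q by (simp add: key_simps)
    note \<chi>d = \<chi>[unfolded qp d]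
    have col: "column d n \<chi> j = column d n \<phi> j" if "j < l" for j
      using key_eqD(1)[OF fin, of \<phi> p n \<chi> j e] k(2)[of "Suc j"] that 2 \<chi>d \<phi> d by (simp add: qp)
    have "key e m (q, ?\<chi>') j = key e m (p, \<psi>) j" if j: "j < Suc (\<iota> l)" for j
    proof (cases j)
      case 0
      then show ?thesis by (simp add: key_simps qp)
    next
      case (Suc i)
      then have i: "i < \<iota> l" "i < m" using j \<iota>_less[OF 2(1)] by auto
      have "column d m ?\<chi>' i = column d m \<psi> i"
        using comp_column[OF \<chi>d i(2)] col[OF \<kappa>_before[OF i(1) 2(1)]] \<kappa>_column[OF i(2)] by (simp add: qp d)
      then show ?thesis using Suc i by (simp add: key_simps qp d)
    qed
    moreover have "key e m (q, ?\<chi>') (Suc (\<iota> l)) < key e m (p, \<psi>) (Suc (\<iota> l))"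
      using k(1) 2 \<iota>_less[OF 2(1)] comp_column[OF \<chi>d, of "\<iota> l"] \<kappa>_\<iota>[OF 2(1)] \<iota>_column[OF 2(1)]
      by (simp add: key_simps qp d)
    ultimately show ?thesis by (intro less_funI exI[of _ "Suc (\<iota> l)"]) blast
  next
    case (3 l)
    have qp: "q = p" using k(2)[of 0] 3 q by (simp add: key_simps)
    note \<chi>d = \<chi>[unfolded qp d]
    have col: "column d n \<chi> j = column d n \<phi> j" if "j < n" for j
      using key_eqD(1)[OF fin, of \<phi> p n \<chi> j e] k(2)[of "Suc j"] that 3 \<chi>d \<phi> d by (simp add: qp)
    have row: "row d \<chi> j = row d \<phi> j" if "j < l" for j
      using key_eqD(2)[OF fin, of \<phi> p n \<chi> j e] k(2)[of "Suc (n + j)"] that 3 \<chi>d \<phi> d by (simp add: qp)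
    have col': "column d m ?\<chi>' i = column d m \<psi> i" if "i < m" for i
      using comp_column[OF \<chi>d that] col[OF \<kappa>_less[OF that]] \<kappa>_column[OF that] by (simp add: qp d)
    have "key e m (q, ?\<chi>') j = key e m (p, \<psi>) j" if j: "j < Suc (m + \<iota> l)" for j
    proof (cases rule: position_cases[where k = j and n = m])
      case (3 i)
      then have i: "i < \<iota> l" "i < m" using j by auto
      have "row d ?\<chi>' i = row d \<psi> i"
        using comp_row[OF \<chi>d col i(2)] row[OF \<kappa>_before[OF i(1) \<open>l < n\<close>]] by (simp add: qp d)
      then show ?thesis using 3 by (simp add: key_simps qp d)
    qed (use col' in \<open>auto simp: key_simps qp d\<close>)
    moreover have "key e m (q, ?\<chi>') (Suc (m + \<iota> l)) < key e m (p, \<psi>) (Suc (m + \<iota> l))"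
      using k(1) 3 \<iota>_less[OF 3(1)] comp_row_\<iota>[OF \<chi>d 3(1)] \<iota>_row[OF 3(1)]
      by (simp add: key_simps qp d)
    ultimately show ?thesis by (intro less_funI exI[of _ "Suc (m + \<iota> l)"]) blast
  qed
qed

section \<open>Local Noetherianity\<close>

context vic_category
begin

text \<open>
  The span of the translates of the generators is stable under all morphisms because the category
  is closed under composition.
\<close>

lemma spanned_by_morphisms:
  assumes M: "cat_module (VIC R U) k M"
    and G: "\<forall>(b, x)\<in>G. b \<in> Obj (VIC R U) \<and> x \<in> carrier (ob M b)"
    and gen: "\<forall>a\<in>Obj (VIC R U). generated_submodule (VIC R U) k M G a = carrier (ob M a)"
  shows "carrier (ob M n) \<subseteq>
    lin_span k (ob M n) {mor M b n \<chi> x |b x \<chi>. (b, x) \<in> G \<and> \<chi> \<in> Hom (VIC R U) b n}"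
proof -
  interpret cat_module "VIC R U" k M by fact
  have obj: "a \<in> Obj (VIC R U)" for a by (simp add: Obj_VIC)
  let ?E = "\<lambda>n. {mor M b n \<chi> x |b x \<chi>. (b, x) \<in> G \<and> \<chi> \<in> Hom (VIC R U) b n}"
  let ?N = "\<lambda>n. lin_span k (ob M n) (?E n)"
  have E: "?E n \<subseteq> carrier (ob M n)" for n
    using module.linear_mapsD(1)[OF ob_module mor_linear, OF obj obj obj] G by blast
  have "cat_submodule (VIC R U) k M ?N"
  proof (rule cat_submodule.intro[OF M cat_submodule_axioms.intro])
    show "submodule (?N a) k (ob M a)" for a
      by (rule module.lin_span_submodule[OF ob_module[OF obj] E])
    fix a b \<psi> assume \<psi>: "\<psi> \<in> Hom (VIC R U) a b"
    have "mor M a b \<psi> ` ?E a \<subseteq> ?E b"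
    proof
      fix y assume "y \<in> mor M a b \<psi> ` ?E a"
      then obtain c x \<chi> where x: "(c, x) \<in> G" "\<chi> \<in> Hom (VIC R U) c a"
        "y = mor M a b \<psi> (mor M c a \<chi> x)" by blast
      then have "y = mor M c b (Comp (VIC R U) c a b \<psi> \<chi>) x"
        using mor_Comp[OF obj obj obj x(2) \<psi>] G by auto
      then show "y \<in> ?E b" using x(1) Comp_closed[OF x(2) \<psi>] by blast
    qed
    then show "mor M a b \<psi> ` ?N a \<subseteq> ?N b"
      using module.linear_maps_lin_span[OF ob_module[OF obj] mor_linear[OF obj obj \<psi>] ob_module[OF obj] E]
      by blast
  qed
  moreover have "x \<in> ?N b" if "(b, x) \<in> G" for b x
  proof -
    have "x \<in> carrier (ob M b)" using G that by blast
    then have "mor M b b (Id (VIC R U) b) x = x" using mor_Id[OF obj] by blast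
    then have "x \<in> ?E b" using that Id_closed by (metis (mono_tags, lifting) mem_Collect_eq)
    then show ?thesis by (rule module.lin_span_base[OF ob_module[OF obj] E])
  qed
  ultimately have "generated_submodule (VIC R U) k M G n \<subseteq> ?N n"
    unfolding generated_submodule_def by blast
  then show ?thesis using gen obj by blast
qed

theorem vic_submodule_finitely_generated:
  fixes k :: "'k ring" and M :: "(nat, ((nat \<Rightarrow> 'r) \<Rightarrow> nat \<Rightarrow> 'r) \<times> (nat \<Rightarrow> 'r) set, 'k, 'm) catmod"
  assumes k: "noetherian_ring k" and M: "cat_module (VIC R U) k M"
    and fg: "finitely_generated (VIC R U) k M" and N: "cat_submodule (VIC R U) k M N"
  shows "finitely_generated (VIC R U) k (sub_catmod M N)"
proof -
  interpret M: cat_module "VIC R U" k M by fact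
  let ?Hom = "Hom (VIC R U)"
  have obj: "a \<in> Obj (VIC R U)" for a by (simp add: Obj_VIC)
  obtain G where G: "finite G" "\<forall>(b, x)\<in>G. b \<in> Obj (VIC R U) \<and> x \<in> carrier (ob M b)"
    "\<forall>a\<in>Obj (VIC R U). generated_submodule (VIC R U) k M G a = carrier (ob M a)"
    using fg unfolding finitely_generated_def by blast
  define num where "num = to_nat_on G"
  have num: "inj_on num G" unfolding num_def
    by (rule inj_on_to_nat_on[OF countable_finite[OF G(1)]])
  define X where "X n = (SIGMA p:G. ?Hom (fst p) n)" for n
  define e where "e n = (\<lambda>(p, \<chi>). mor M (fst p) n \<chi> (snd p))" for n
  define lt where "lt n x y = less_fun (key num n x) (key num n y)" for n x y
  define le :: "nat \<times> (nat \<times> 'm) \<times> _ \<Rightarrow> nat \<times> (nat \<times> 'm) \<times> _ \<Rightarrow> bool"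
    where "le = (\<lambda>(n, p, \<phi>) (m, q, \<psi>). p = q \<and>
    colour (fst p) n \<phi> = colour (fst p) m \<psi> \<and> subseq (word (fst p) n \<phi>) (word (fst p) m \<psi>))"
  have hom: "\<phi> \<in> vic_hom R (V b) (V n)" if "\<phi> \<in> ?Hom b n" for \<phi> b n
    using that by (auto simp: Hom_VIC)
  interpret leading_terms "VIC R U" k M X e lt le
  proof (intro leading_terms.intro[OF M] leading_terms_axioms.intro, goal_cases)
    case 1
    then show ?case by (rule k)
  next
    case (2 n)
    then show ?case unfolding X_def using G(1) finite_Hom by (intro finite_SigmaI) auto
  next
    case (3 n x)
    then show ?case
      using module.linear_mapsD(1)[OF M.ob_module M.mor_linear, OF obj obj obj] G(2)
      by (fastforce simp: X_def e_def)
  next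
    case (4 n)
    have "e n ` X n = {mor M b n \<chi> x |b x \<chi>. (b, x) \<in> G \<and> \<chi> \<in> ?Hom b n}"
      by (force simp: X_def e_def)
    then show ?case using spanned_by_morphisms[OF M G(2,3)] by simp
  next
    case (5 n x)
    then show ?case by (simp add: lt_def less_fun_irrefl)
  next
    case (6 n x y z)
    then show ?case unfolding lt_def by (rule less_fun_trans)
  next
    case (7 n x y)
    then show ?case
      unfolding lt_def using hom by (intro key_total[OF finite_R num]) (auto simp: X_def)
  next
    case (8 n m x y)
    obtain p \<phi> where x: "x = (p, \<phi>)" "p \<in> G" "\<phi> \<in> ?Hom (fst p) n"
      using 8(3) by (auto simp: X_def)
    obtain \<psi> where y: "y = (p, \<psi>)" "\<psi> \<in> ?Hom (fst p) m"
      and le: "colour (fst p) n \<phi> = colour (fst p) m \<psi>" "subseq (word (fst p) n \<phi>) (word (fst p) m \<psi>)"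
      using 8(4,5) by (auto simp: X_def le_def x(1))
    have transport: "mor M n m \<eta> (e n (q, \<chi>)) = e m (q, vic_comp (V (fst q)) (V m) \<eta> \<chi>)"
      "vic_comp (V (fst q)) (V m) \<eta> \<chi> \<in> ?Hom (fst q) m"
      if "\<eta> \<in> ?Hom n m" "q \<in> G" "\<chi> \<in> ?Hom (fst q) n" for \<eta> q \<chi>
      using M.mor_Comp[OF obj obj obj that(3,1)] Comp_closed[OF that(3,1)] G(2) that(2)
      by (auto simp: e_def Comp_VIC)
    \<comment> \<open>equal lengths leave no room for insertions, and the identity satisfies the determinant condition\<close>
    show ?case
    proof (cases "n = m")
      case True
      then have words: "word (fst p) n \<phi> = word (fst p) n \<psi>"
        using le(2) by (intro subseq_same_length) auto
      have "column (fst p) n \<phi> l = column (fst p) n \<psi> l \<and> row (fst p) \<phi> l = row (fst p) \<psi> l"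
        if "l < n" for l
        using arg_cong[OF words, of "\<lambda>w. w ! l"] word_nth[OF that] by simp
      then have "\<phi> = \<psi>"
        using hom[OF x(3)] hom[OF y(2)] True by (intro vic_hom_eqI[of _ "fst p" n]) auto
      moreover have "mor M n n (Id (VIC R U) n) (e n z) = e n z" if "z \<in> X n" for z
        using M.mor_Id[OF obj] module.linear_mapsD(1)[OF M.ob_module M.mor_linear, OF obj obj obj] G(2) that
        by (fastforce simp: X_def e_def)
      ultimately show ?thesis
        using True 8(3) x(1) y(1) Id_closed[of n] by (intro bexI[of _ "Id (VIC R U) n"]) auto
    next
      case False
      obtain \<iota> where "word_insertion R (fst p) n m \<phi> \<psi> \<iota>"
        using word_insertion_exists[OF hom[OF x(3)] hom[OF y(2)] le] by blast
      then interpret w: word_insertion R "fst p" n m \<phi> \<psi> \<iota> .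
      let ?\<eta> = "(w.insertion_map, w.kernel)"
      have \<eta>: "?\<eta> \<in> ?Hom n m" using w.insertion_map_vic_hom False by (simp add: Hom_VIC)
      show ?thesis
      proof (intro bexI[OF _ \<eta>] conjI ballI impI)
        show "mor M n m ?\<eta> (e n x) = e m y"
          using transport(1)[OF \<eta> x(2,3)] w.comp_eq by (simp add: x(1) y(1))
        fix z assume z: "z \<in> X n" "lt n z x"
        obtain q \<chi> where q: "z = (q, \<chi>)" "q \<in> G" "\<chi> \<in> ?Hom (fst q) n"
          using z(1) by (auto simp: X_def)
        have "lt m (q, vic_comp (V (fst q)) (V m) ?\<eta> \<chi>) y"
          using z(2) inj_onD[OF num _ q(2) x(2)] hom[OF q(3)] unfolding lt_def q(1) x(1) y(1)
          by (intro w.key_mono[OF finite_R refl]) auto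
        then show "\<exists>z'\<in>X m. lt m z' y \<and> mor M n m ?\<eta> (e n z) = e m z'"
          using transport[OF \<eta> q(2,3)] q by (intro bexI[of _ "(q, vic_comp (V (fst q)) (V m) ?\<eta> \<chi>)"])
            (auto simp: X_def)
      qed
    qed
  next
    case (9 s)
    define A where "A = (\<Union>p\<in>G. carrier (V (fst p)) \<times> (carrier (V (fst p)) \<rightarrow>\<^sub>E carrier R) \<times> (UNIV :: bool set))"
    define B where "B = (\<Union>p\<in>G. {p} \<times> (Pow (carrier (V (fst p))) \<times>
      (carrier (V (fst p)) \<rightarrow>\<^sub>E carrier (V (fst p)) \<rightarrow>\<^sub>E carrier R)))"
    have fin: "finite A" "finite B"
      unfolding A_def B_def using G(1) finite_R finite_std[OF finite_R] finite_functionals[OF finite_R]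
      by (auto intro!: finite_cartesian_product finite_PiE)
    let ?word = "\<lambda>(n, p, \<phi>). word (fst p) n \<phi>" and ?colour = "\<lambda>(n, p, \<phi>). (p, colour (fst p) n \<phi>)"
    have AB: "set (?word (s i)) \<subseteq> A \<and> ?colour (s i) \<in> B" for i
    proof -
      obtain n p \<phi> where si: "s i = (n, p, \<phi>)" by (metis prod_cases3)
      have p: "p \<in> G" "\<phi> \<in> vic_hom R (V (fst p)) (V n)" using 9[of i] hom by (auto simp: si X_def)
      have "set (word (fst p) n \<phi>) \<subseteq>
          carrier (V (fst p)) \<times> (carrier (V (fst p)) \<rightarrow>\<^sub>E carrier R) \<times> UNIV"
      proof
        fix z assume "z \<in> set (word (fst p) n \<phi>)"
        then obtain l t where "l < n" "z = (column (fst p) n \<phi> l, row (fst p) \<phi> l, t)"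
          by (auto simp: word_def)
        then show "z \<in> carrier (V (fst p)) \<times> (carrier (V (fst p)) \<rightarrow>\<^sub>E carrier R) \<times> UNIV"
          using column_closed[OF p(2), of l] row_closed[OF p(2), of l] by blast
      qed
      moreover have "colour (fst p) n \<phi> \<in> Pow (carrier (V (fst p))) \<times>
          (carrier (V (fst p)) \<rightarrow>\<^sub>E carrier (V (fst p)) \<rightarrow>\<^sub>E carrier R)"
      proof -
        have "fst \<phi> v l \<in> carrier R" if "v \<in> carrier (V (fst p))" "l < n" for v l
          using fun_cong[of "row (fst p) \<phi> l" _ v] PiE_mem[OF row_closed[OF p(2) that(2)] that(1)] that(1)
          by (simp add: row_def)
        then show ?thesis
          using column_closed[OF p(2)] unfolding colour_def by (auto intro!: R.finsum_closed)
      qed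
      ultimately show ?thesis unfolding A_def B_def si using p(1) by auto
    qed
    obtain i j where ij: "i < j" "?colour (s i) = ?colour (s j)" "subseq (?word (s i)) (?word (s j))"
      using higman_finite_colours[OF fin, of ?word s ?colour] AB by blast
    then have "le (s i) (s j)" by (auto simp: le_def split: prod.splits)
    with ij(1) show ?case by blast
  qed
  show ?thesis by (rule submodule_finitely_generated[OF N])
qed

end

theorem theorem4:
  fixes R :: "'r ring" and U :: "'r set"
  assumes "cring R" and "finite (carrier R)"
    and "subgroup U (units_of R)"
  shows "locally_noetherian TYPE('k) TYPE('m) (VIC R U)"
proof -
  interpret vic_category R U
    using assms by (intro vic_category.intro std_modules.intro vic_category_axioms.intro)
  show ?thesis
    unfolding locally_noetherian_def locally_noetherian_over_def
    using vic_submodule_finitely_generated by blast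
qed

end
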